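(* Let $1\le p<\infty$ and let $n\in\mathbb{N}$, $n\geq 1$. Then the $n$-fold projective tensor product $X=\ell_p\hat\otimes\cdots\hat\otimes\ell_p$ ($n$ times) is primary.
   Context: $\hat\otimes$ denotes the (completed) projective tensor product of Banach spaces. A Banach space $X$ is primary if whenever $X=Y\oplus Z$ (a topological direct sum of closed subspaces), $X$ is isomorphic (linearly homeomorphic) to $Y$ or to $Z$. *)

theory Defs
  imports "HOL-Analysis.Analysis" "HOL-Library.Function_Algebras" "HOL-Library.FuncSet"
begin

(* The scalar field is a type 'k of sort {real_normed_field, euclidean_space}. The real and the
   complex numbers are instances and, by the Gelfand-Mazur and Frobenius theorems, they are the
   only ones up to isometric isomorphism, so real and complex Banach spaces are treated together.
   The type class banach only knows real scalars; the locale below adds a compatible action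
   of 'k. *)

locale banach_space_over = vector_space sc
  for sc :: "'k::{real_normed_field,euclidean_space} \<Rightarrow> 'x::banach \<Rightarrow> 'x" +
  assumes norm_scale: "norm (sc c x) = norm c * norm x"
    and scale_of_real: "sc (of_real r) x = r *\<^sub>R x"

lemma banach_space_over_real: "banach_space_over ((*\<^sub>R) :: real \<Rightarrow> 'x::banach \<Rightarrow> 'x)"
  by unfold_locales (simp_all add: scaleR_add_right scaleR_add_left)

lemma banach_space_over_complex: "banach_space_over ((*) :: complex \<Rightarrow> complex \<Rightarrow> complex)"
  by unfold_locales (simp_all add: algebra_simps norm_mult scaleR_conv_of_real)


definition fscale :: "'k::field \<Rightarrow> ('a \<Rightarrow> 'k) \<Rightarrow> 'a \<Rightarrow> 'k" where
  "fscale c f = (\<lambda>a. c * f a)"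

lemma vector_space_fscale: "vector_space fscale"
  by unfold_locales (simp_all add: fscale_def fun_eq_iff algebra_simps)


definition lp_space :: "real \<Rightarrow> (nat \<Rightarrow> 'k::real_normed_field) set" where
  "lp_space p = {x. summable (\<lambda>i. norm (x i) powr p)}"

definition lp_norm :: "real \<Rightarrow> (nat \<Rightarrow> 'k::real_normed_field) \<Rightarrow> real" where
  "lp_norm p x = (\<Sum>i. norm (x i) powr p) powr (1 / p)"


definition linear_map_on ::
  "('k \<Rightarrow> 'a::ab_group_add \<Rightarrow> 'a) \<Rightarrow> ('k \<Rightarrow> 'b::ab_group_add \<Rightarrow> 'b) \<Rightarrow> 'a set \<Rightarrow> ('a \<Rightarrow> 'b) \<Rightarrow> bool" where
  "linear_map_on s t V f \<longleftrightarrow>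
     (\<forall>x\<in>V. \<forall>y\<in>V. f (x + y) = f x + f y) \<and> (\<forall>c. \<forall>x\<in>V. f (s c x) = t c (f x))"


(* In the next four definitions E is a linear subspace of the vector space 'a with scalar
   multiplication s, and N is a norm on E. The n-fold algebraic tensor power of E is realised in
   the usual way inside the linear functionals on the space of n-linear forms on E:
   x_0 (x) ... (x) x_(n-1) is the evaluation B |-> B(x_0, ..., x_(n-1)). Hence two finite sums of
   elementary tensors are equal iff every n-linear form (bounded or not) gives them the same
   value. *)

definition multilinear_forms ::
  "('k::field \<Rightarrow> 'a::ab_group_add \<Rightarrow> 'a) \<Rightarrow> nat \<Rightarrow> 'a set \<Rightarrow> ((nat \<Rightarrow> 'a) \<Rightarrow> 'k) set" where
  "multilinear_forms s n E =
     {B. \<forall>x \<in> {..<n} \<rightarrow>\<^sub>E E. \<forall>i<n.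
           (\<forall>y\<in>E. \<forall>z\<in>E. B (x(i := y + z)) = B (x(i := y)) + B (x(i := z))) \<and>
           (\<forall>c. \<forall>y\<in>E. B (x(i := s c y)) = c * B (x(i := y)))}"

definition elementary_tensor ::
  "('k::field \<Rightarrow> 'a::ab_group_add \<Rightarrow> 'a) \<Rightarrow> nat \<Rightarrow> 'a set \<Rightarrow> (nat \<Rightarrow> 'a) \<Rightarrow> ((nat \<Rightarrow> 'a) \<Rightarrow> 'k) \<Rightarrow> 'k" where
  "elementary_tensor s n E x = (\<lambda>B. if B \<in> multilinear_forms s n E then B x else 0)"

definition tensor_power ::
  "('k::field \<Rightarrow> 'a::ab_group_add \<Rightarrow> 'a) \<Rightarrow> nat \<Rightarrow> 'a set \<Rightarrow> (((nat \<Rightarrow> 'a) \<Rightarrow> 'k) \<Rightarrow> 'k) set" where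
  "tensor_power s n E = module.span fscale (elementary_tensor s n E ` ({..<n} \<rightarrow>\<^sub>E E))"

(* Scalar coefficients in the representations of u are absorbed into one of the factors,
   so this is meant for n >= 1. *)
definition projective_norm ::
  "('k::field \<Rightarrow> 'a::ab_group_add \<Rightarrow> 'a) \<Rightarrow> nat \<Rightarrow> 'a set \<Rightarrow> ('a \<Rightarrow> real) \<Rightarrow>
     (((nat \<Rightarrow> 'a) \<Rightarrow> 'k) \<Rightarrow> 'k) \<Rightarrow> real" where
  "projective_norm s n E N u =
     Inf {(\<Sum>x\<leftarrow>xs. \<Prod>i<n. N (x i)) | xs.
            set xs \<subseteq> ({..<n} \<rightarrow>\<^sub>E E) \<and> u = (\<Sum>x\<leftarrow>xs. elementary_tensor s n E x)}"


(* X, a closed subspace of some Banach space, together with J is a completion of the space V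
   normed by N. Completions are unique up to isometric isomorphism. Every normed space has one of
   this form, for instance in the Banach space of all bounded scalar functions on the unit ball of
   its dual. *)
definition is_completion ::
  "('k \<Rightarrow> 'v::ab_group_add \<Rightarrow> 'v) \<Rightarrow> 'v set \<Rightarrow> ('v \<Rightarrow> real) \<Rightarrow>
     ('k \<Rightarrow> 'x::banach \<Rightarrow> 'x) \<Rightarrow> ('v \<Rightarrow> 'x) \<Rightarrow> 'x set \<Rightarrow> bool" where
  "is_completion s V N sc J X \<longleftrightarrow>
     linear_map_on s sc V J \<and> (\<forall>u\<in>V. norm (J u) = N u) \<and> X = closure (J ` V)"

definition is_projective_tensor_power ::
  "('k::{real_normed_field,euclidean_space} \<Rightarrow> 'a::ab_group_add \<Rightarrow> 'a) \<Rightarrow> nat \<Rightarrow> 'a set \<Rightarrow> ('a \<Rightarrow> real) \<Rightarrow>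
     ('k \<Rightarrow> 'x::banach \<Rightarrow> 'x) \<Rightarrow> ((((nat \<Rightarrow> 'a) \<Rightarrow> 'k) \<Rightarrow> 'k) \<Rightarrow> 'x) \<Rightarrow> 'x set \<Rightarrow> bool" where
  "is_projective_tensor_power s n E N sc J X \<longleftrightarrow>
     is_completion fscale (tensor_power s n E) (projective_norm s n E N) sc J X"


definition topological_direct_sum ::
  "('k::field \<Rightarrow> 'x::banach \<Rightarrow> 'x) \<Rightarrow> 'x set \<Rightarrow> 'x set \<Rightarrow> 'x set \<Rightarrow> bool" where
  "topological_direct_sum sc X Y Z \<longleftrightarrow>
     module.subspace sc Y \<and> closed Y \<and> module.subspace sc Z \<and> closed Z \<and>
     (\<exists>g. homeomorphism (Y \<times> Z) X (\<lambda>(y, z). y + z) g)"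

definition linearly_homeomorphic ::
  "('k \<Rightarrow> 'x::banach \<Rightarrow> 'x) \<Rightarrow> 'x set \<Rightarrow> 'x set \<Rightarrow> bool" where
  "linearly_homeomorphic sc X Y \<longleftrightarrow>
     (\<exists>f g. linear_map_on sc sc X f \<and> homeomorphism X Y f g)"

definition primary :: "('k::field \<Rightarrow> 'x::banach \<Rightarrow> 'x) \<Rightarrow> 'x set \<Rightarrow> bool" where
  "primary sc X \<longleftrightarrow>
     (\<forall>Y Z. topological_direct_sum sc X Y Z \<longrightarrow>
        linearly_homeomorphic sc X Y \<or> linearly_homeomorphic sc X Z)"

end

theory Submission
  imports Defs
begin

text \<open>
  Let \<open>P\<close> be a projection of \<open>X\<close>. We factor the identity of \<open>X\<close> through \<open>T = P\<close> or through
  \<open>1 - T\<close> and then absorb the remaining summand by an Eilenberg swindle.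

  Let \<open>e a\<close>, \<open>a \<in> \<nat>\<^sup>n\<close>, be the tensor basis, and compress \<open>T\<close> along an injection \<open>g\<close> of \<open>\<nat>\<close> in
  every coordinate. Choose \<open>g 0\<close>, \<open>g 1\<close>, and so on, one after the other. Replacing the labels not
  yet chosen by iterated limits along an ultrafilter gives matrices that are bounded by \<open>\<parallel>T\<parallel>\<close> and
  depend on the late labels only through their relative order. Such matrices form a finite
  dimensional space, so entrywise convergence is convergence in norm, and \<open>g\<close> can be chosen so that
  the compression of \<open>T\<close> is close in norm to the limit matrix \<open>W\<close>, which depends on the order of the
  labels only. When the coordinates use disjoint sets of labels, the off-diagonal entries of \<open>W\<close>
  vanish, because a column with one of them would contain arbitrarily many equal coordinates. The diagonal entry at
  \<open>a\<close> depends on the order type of \<open>a\<close>; since triangular truncations may be bounded,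
  it need not be constant. But summing over all permutations of the coordinates, realised on
  disjoint sets of labels, turns \<open>W\<close> into a scalar \<open>s\<close>. The same procedure turns
  \<open>1 - T\<close> into \<open>n! - s\<close>, and one of the two scalars is not small.

  For the swindle, block diagonal operators with equal blocks are bounded on \<open>X\<close>: by averaging over
  signs, block diagonal sums of elementary tensors satisfy the same estimate as one elementary
  tensor, and the unit ball is the closed convex hull of the elementary tensors in it.
\<close>

section \<open>Sequence spaces\<close>

lemma lp_space_iff: "x \<in> lp_space p \<longleftrightarrow> summable (\<lambda>i. norm (x i) powr p)"
  by (simp add: lp_space_def)

lemma lp_norm_nonneg [simp]: "0 \<le> lp_norm p x"
  by (simp add: lp_norm_def)

lemma lp_norm_powr:
  assumes "1 \<le> p" "x \<in> lp_space p"
  shows "lp_norm p x powr p = (\<Sum>i. norm (x i) powr p)"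
  using assms by (simp add: lp_norm_def powr_powr suminf_nonneg lp_space_iff)

lemma lp_norm_leI:
  assumes "1 \<le> p" "x \<in> lp_space p" "0 \<le> C" "(\<Sum>i. norm (x i) powr p) \<le> C powr p"
  shows "lp_norm p x \<le> C"
  using assms powr_mono2[of "1/p" "\<Sum>i. norm (x i) powr p" "C powr p"]
  by (simp add: lp_norm_def powr_powr suminf_nonneg lp_space_iff)

lemma lp_space_bounded_sumI:
  assumes "1 \<le> p" "0 \<le> C" "\<And>T. finite T \<Longrightarrow> (\<Sum>t\<in>T. norm (x t) powr p) \<le> C powr p"
  shows "x \<in> lp_space p" "lp_norm p x \<le> C"
proof -
  have s: "summable (\<lambda>i. norm (x i) powr p)"
    by (rule summableI_nonneg_bounded[where x = "C powr p"]) (use assms(3) in auto)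
  then show x: "x \<in> lp_space p" by (simp add: lp_space_iff)
  have "(\<Sum>i. norm (x i) powr p) \<le> C powr p"
    using s assms(3) by (intro suminf_le_const) auto
  then show "lp_norm p x \<le> C"
    using assms x by (intro lp_norm_leI)
qed

lemma sum_le_lp_norm_powr:
  assumes "1 \<le> p" "x \<in> lp_space p" "finite T"
  shows "(\<Sum>t\<in>T. norm (x t) powr p) \<le> lp_norm p x powr p"
  using assms sum_le_suminf[of "\<lambda>i. norm (x i) powr p" T]
  by (simp add: lp_norm_powr lp_space_iff)

lemma norm_le_lp_norm:
  assumes "1 \<le> p" "x \<in> lp_space p"
  shows "norm (x i) \<le> lp_norm p x"
proof -
  have "norm (x i) powr p \<le> lp_norm p x powr p"
    using sum_le_lp_norm_powr[OF assms, of "{i}"] by simp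
  then show ?thesis
    using assms powr_less_mono2[of p "lp_norm p x" "norm (x i)"] by (meson lp_norm_nonneg not_le zero_less_one less_le_trans)
qed

lemma lp_norm_eq_0D:
  assumes "1 \<le> p" "x \<in> lp_space p" "lp_norm p x = 0"
  shows "x = (\<lambda>i. 0)"
  using norm_le_lp_norm[OF assms(1,2)] assms(3) by auto

lemma lp_scaled_reindex:
  fixes x :: "nat \<Rightarrow> 'k::real_normed_field"
  assumes p: "1 \<le> p" and x: "x \<in> lp_space p" and c: "\<And>t. norm (c t) \<le> r"
    and inj: "inj_on \<phi> {t. c t \<noteq> 0}"
  shows "(\<lambda>t. c t * x (\<phi> t)) \<in> lp_space p" "lp_norm p (\<lambda>t. c t * x (\<phi> t)) \<le> r * lp_norm p x"
proof -
  have r: "0 \<le> r" using c[of 0] norm_ge_zero order_trans by blast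
  have *: "(\<Sum>t\<in>T. norm (c t * x (\<phi> t)) powr p) \<le> (r * lp_norm p x) powr p" if T: "finite T" for T
  proof -
    let ?T = "T \<inter> {t. c t \<noteq> 0}"
    have "(\<Sum>t\<in>T. norm (c t * x (\<phi> t)) powr p) = (\<Sum>t\<in>?T. norm (c t * x (\<phi> t)) powr p)"
      by (rule sum.mono_neutral_right) (use T p in auto)
    also have "\<dots> \<le> (\<Sum>t\<in>?T. r powr p * norm (x (\<phi> t)) powr p)"
      by (intro sum_mono) (use p c r in \<open>auto simp: norm_mult powr_mult intro!: mult_right_mono powr_mono2\<close>)
    also have "\<dots> = r powr p * (\<Sum>s\<in>\<phi> ` ?T. norm (x s) powr p)"
      by (subst sum.reindex) (auto intro: inj_on_subset[OF inj] simp: sum_distrib_left)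
    also have "\<dots> \<le> r powr p * lp_norm p x powr p"
      by (intro mult_left_mono sum_le_lp_norm_powr) (use p x T in auto)
    finally show ?thesis using r by (simp add: powr_mult)
  qed
  show "(\<lambda>t. c t * x (\<phi> t)) \<in> lp_space p" "lp_norm p (\<lambda>t. c t * x (\<phi> t)) \<le> r * lp_norm p x"
    using lp_space_bounded_sumI[OF p _ *] r by auto
qed

lemma lp_fscale:
  fixes x :: "nat \<Rightarrow> 'k::real_normed_field"
  assumes "1 \<le> p" "x \<in> lp_space p"
  shows "fscale c x \<in> lp_space p" "lp_norm p (fscale c x) = norm c * lp_norm p x"
proof -
  have le: "fscale c y \<in> lp_space p \<and> lp_norm p (fscale c y) \<le> norm c * lp_norm p y"
    if "y \<in> lp_space p" for c and y :: "nat \<Rightarrow> 'k"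
    using lp_scaled_reindex[OF assms(1) that, of "\<lambda>_. c" "norm c" id] by (auto simp: fscale_def)
  show "fscale c x \<in> lp_space p" using le assms(2) by blast
  show "lp_norm p (fscale c x) = norm c * lp_norm p x"
  proof (cases "c = 0")
    case True
    then show ?thesis using le[OF assms(2), of c] lp_norm_nonneg[of p "fscale c x"]
      by (auto intro: antisym)
  next
    case False
    have "fscale (inverse c) (fscale c x) = x" using False by (auto simp: fscale_def)
    then have "lp_norm p x \<le> norm (inverse c) * lp_norm p (fscale c x)"
      using le[of "fscale c x" "inverse c"] le[OF assms(2), of c] by simp
    then have "norm c * lp_norm p x \<le> lp_norm p (fscale c x)"
      using False by (simp add: norm_inverse norm_divide field_simps)
    then show ?thesis using le[OF assms(2), of c] by simp
  qed
qed

definition unit_seq :: "nat \<Rightarrow> nat \<Rightarrow> 'k::real_normed_field" where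
  "unit_seq a = (\<lambda>t. if t = a then 1 else 0)"

lemma unit_seq_lp:
  assumes "1 \<le> p"
  shows "(unit_seq a :: nat \<Rightarrow> 'a::real_normed_field) \<in> lp_space p"
    "lp_norm p (unit_seq a :: nat \<Rightarrow> 'a) = 1"
proof -
  have *: "norm (unit_seq a t :: 'a) powr p = (if t = a then 1 else 0)" for t
    using assms by (simp add: unit_seq_def)
  have "(\<lambda>t. norm (unit_seq a t :: 'a) powr p) sums 1"
    unfolding * using sums_single[of a "\<lambda>_. 1::real"] by simp
  then show "(unit_seq a::nat \<Rightarrow> 'a) \<in> lp_space p" "lp_norm p (unit_seq a::nat \<Rightarrow> 'a) = 1"
    by (auto simp: lp_space_iff lp_norm_def sums_iff)
qed

definition lp_head :: "nat \<Rightarrow> (nat \<Rightarrow> 'k::real_normed_field) \<Rightarrow> nat \<Rightarrow> 'k" where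
  "lp_head N x = (\<lambda>t. (if t < N then 1 else 0) * x t)"

definition lp_tail :: "nat \<Rightarrow> (nat \<Rightarrow> 'k::real_normed_field) \<Rightarrow> nat \<Rightarrow> 'k" where
  "lp_tail N x = (\<lambda>t. (if t < N then 0 else 1) * x t)"

lemma lp_head_tail:
  assumes "1 \<le> p" "x \<in> lp_space p"
  shows "lp_head N x \<in> lp_space p" "lp_norm p (lp_head N x) \<le> lp_norm p x"
    "lp_tail N x \<in> lp_space p" "lp_norm p (lp_tail N x) \<le> lp_norm p x"
    "lp_head N x + lp_tail N x = x"
  using lp_scaled_reindex[OF assms, of "\<lambda>t. if t < N then 1 else 0" 1 id]
    lp_scaled_reindex[OF assms, of "\<lambda>t. if t < N then 0 else 1" 1 id]
  by (auto simp: lp_head_def lp_tail_def inj_on_def)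

lemma lp_tail_tendsto_0:
  assumes p: "1 \<le> p" and x: "x \<in> lp_space p"
  shows "(\<lambda>N. lp_norm p (lp_tail N x)) \<longlonglongrightarrow> 0"
proof -
  have s: "summable (\<lambda>i. norm (x i) powr p)" using x by (simp add: lp_space_iff)
  have eq: "(\<Sum>i. norm (lp_tail N x i) powr p) = (\<Sum>i. norm (x i) powr p) - (\<Sum>i<N. norm (x i) powr p)" for N
  proof -
    have "summable (\<lambda>i. norm (lp_tail N x i) powr p)"
      using lp_head_tail(3)[OF p x] by (simp add: lp_space_iff)
    then have "(\<Sum>i. norm (lp_tail N x i) powr p) = (\<Sum>i. norm (lp_tail N x (i + N)) powr p) + (\<Sum>i<N. norm (lp_tail N x i) powr p)"
      by (rule suminf_split_initial_segment)
    also have "\<dots> = (\<Sum>i. norm (x (i + N)) powr p)"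
      using p by (simp add: lp_tail_def)
    finally show ?thesis using suminf_minus_initial_segment[OF s] by simp
  qed
  have "(\<lambda>N. \<Sum>i. norm (lp_tail N x i) powr p) \<longlonglongrightarrow> 0"
    unfolding eq using summable_LIMSEQ[OF s] by (auto intro!: tendsto_eq_intros)
  then have "(\<lambda>N. (\<Sum>i. norm (lp_tail N x i) powr p) powr (1/p)) \<longlonglongrightarrow> 0 powr (1/p)"
    using p by (intro tendsto_powr') (auto simp: eq intro!: always_eventually sum_le_suminf s)
  then show ?thesis by (simp add: lp_norm_def)
qed

text \<open>A weak substitute for the Hoelder inequality which suffices to see that sums of
  \<open>K\<close> coordinates are \<open>o(K)\<close> on the unit ball.\<close>

lemma sum_coords_le:
  fixes d :: real
  assumes p: "1 \<le> p" and x: "x \<in> lp_space p" and d: "0 < d" and T: "finite T"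
  shows "(\<Sum>t\<in>T. norm (x t)) \<le> (card T * d + d powr (1 - p)) * lp_norm p x"
proof (cases "lp_norm p x = 0")
  case True
  then show ?thesis using lp_norm_eq_0D[OF p x True] by simp
next
  case False
  define s where "s = d * lp_norm p x"
  have s: "0 < s" using False d lp_norm_nonneg[of p x] by (auto simp: s_def less_le)
  have *: "t \<le> s + s powr (1 - p) * t powr p" if t: "0 \<le> t" for t :: real
  proof (cases "t \<le> s")
    case True
    then show ?thesis by (simp add: add_increasing2)
  next
    case False
    then have "t = t powr (1 - p) * t powr p" using s by (simp flip: powr_add)
    also have "\<dots> \<le> s powr (1 - p) * t powr p"
      using False s p by (intro mult_right_mono powr_mono2') auto
    finally show ?thesis using s by simp
  qed
  have "(\<Sum>t\<in>T. norm (x t)) \<le> (\<Sum>t\<in>T. s + s powr (1 - p) * norm (x t) powr p)"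
    by (intro sum_mono *) auto
  also have "\<dots> = card T * s + s powr (1 - p) * (\<Sum>t\<in>T. norm (x t) powr p)"
    by (simp add: sum.distrib sum_distrib_left)
  also have "\<dots> \<le> card T * s + s powr (1 - p) * lp_norm p x powr p"
    by (intro add_left_mono mult_left_mono sum_le_lp_norm_powr p x T) auto
  also have "s powr (1 - p) * lp_norm p x powr p = d powr (1 - p) * lp_norm p x"
    using d False by (simp add: s_def powr_mult mult.assoc flip: powr_add)
  finally show ?thesis by (simp add: s_def algebra_simps)
qed

definition block_embed :: "nat \<Rightarrow> (nat \<Rightarrow> 'k::real_normed_field) \<Rightarrow> nat \<Rightarrow> 'k" where
  "block_embed k y = (\<lambda>s. (if fst (prod_decode s) = k then 1 else 0) * y (snd (prod_decode s)))"

definition block_coord :: "nat \<Rightarrow> (nat \<Rightarrow> 'k::real_normed_field) \<Rightarrow> nat \<Rightarrow> 'k" where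
  "block_coord k x = (\<lambda>t. 1 * x (prod_encode (k, t)))"

lemma inj_on_block: "inj_on (\<lambda>s. snd (prod_decode s)) {s. fst (prod_decode s) = k}"
  by (auto simp: inj_on_def) (metis prod.collapse prod_decode_inverse)

lemma inj_block: "inj_on (\<lambda>t. prod_encode (k, t)) A"
  by (auto simp: inj_on_def)

lemma block_embed_lp:
  assumes "1 \<le> p" "y \<in> lp_space p"
  shows "block_embed k y \<in> lp_space p" "lp_norm p (block_embed k y) \<le> lp_norm p y"
proof -
  have "inj_on (\<lambda>s. snd (prod_decode s)) {s. (if fst (prod_decode s) = k then 1 else 0::'a) \<noteq> 0}"
    by (rule inj_on_subset[OF inj_on_block[of k]]) auto
  from lp_scaled_reindex[OF assms _ this, of 1]
  show "block_embed k y \<in> lp_space p" "lp_norm p (block_embed k y) \<le> lp_norm p y"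
    by (auto simp: block_embed_def)
qed

lemma block_coord_lp:
  assumes "1 \<le> p" "x \<in> lp_space p"
  shows "block_coord k x \<in> lp_space p" "lp_norm p (block_coord k x) \<le> lp_norm p x"
  using lp_scaled_reindex[OF assms, of "\<lambda>_. 1" 1, OF _ inj_block]
  by (auto simp: block_coord_def)

lemma sum_lp_norm_block_coord_le:
  assumes p: "1 \<le> p" and x: "x \<in> lp_space p"
  shows "(\<Sum>k<K. lp_norm p (block_coord k x) powr p) \<le> lp_norm p x powr p"
proof -
  have s: "summable (\<lambda>t. norm (block_coord k x t) powr p)" for k
    using block_coord_lp[OF p x, of k] by (simp add: lp_space_iff)
  have "(\<Sum>k<K. lp_norm p (block_coord k x) powr p) = (\<Sum>k<K. \<Sum>t. norm (block_coord k x t) powr p)"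
    by (simp add: lp_norm_powr[OF p block_coord_lp(1)[OF p x]])
  also have "\<dots> = (\<Sum>t. \<Sum>k<K. norm (block_coord k x t) powr p)"
    by (rule suminf_sum[symmetric]) (rule s)
  also have "\<dots> \<le> lp_norm p x powr p"
  proof (rule suminf_le_const)
    show "summable (\<lambda>t. \<Sum>k<K. norm (block_coord k x t) powr p)" by (rule summable_sum) (rule s)
    fix M
    have "(\<Sum>t<M. \<Sum>k<K. norm (block_coord k x t) powr p)
      = (\<Sum>(k,t)\<in>{..<K}\<times>{..<M}. norm (x (prod_encode (k,t))) powr p)"
      by (subst sum.swap) (simp add: sum.cartesian_product block_coord_def)
    also have "\<dots> = (\<Sum>s\<in>prod_encode ` ({..<K}\<times>{..<M}). norm (x s) powr p)"
      by (subst sum.reindex) (auto simp: inj_prod_encode case_prod_unfold)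
    also have "\<dots> \<le> lp_norm p x powr p"
      by (rule sum_le_lp_norm_powr[OF p x]) auto
    finally show "(\<Sum>t<M. \<Sum>k<K. norm (block_coord k x t) powr p) \<le> lp_norm p x powr p" .
  qed
  finally show ?thesis .
qed

definition block_glue :: "nat \<Rightarrow> (nat \<Rightarrow> nat \<Rightarrow> 'k::real_normed_field) \<Rightarrow> nat \<Rightarrow> 'k" where
  "block_glue K y = (\<lambda>s. if fst (prod_decode s) < K then y (fst (prod_decode s)) (snd (prod_decode s)) else 0)"

lemma block_glue_lp:
  assumes p: "1 \<le> p" and y: "\<And>k. k < K \<Longrightarrow> y k \<in> lp_space p"
  shows "block_glue K y \<in> lp_space p"
    "lp_norm p (block_glue K y) \<le> (\<Sum>k<K. lp_norm p (y k) powr p) powr (1/p)"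
proof -
  have s: "summable (\<lambda>t. norm (block_embed k (y k) t) powr p)" if "k < K" for k
    using block_embed_lp[OF p y[OF that], of k] by (simp add: lp_space_iff)
  have eq: "norm (block_glue K y s) powr p = (\<Sum>k<K. norm (block_embed k (y k) s) powr p)" for s
  proof -
    have "(\<Sum>k<K. norm (block_embed k (y k) s) powr p)
      = (\<Sum>k<K. if fst (prod_decode s) = k then norm (y k (snd (prod_decode s))) powr p else 0)"
      using p by (intro sum.cong) (auto simp: block_embed_def)
    then show ?thesis using p by (simp add: block_glue_def)
  qed
  show lp: "block_glue K y \<in> lp_space p"
    unfolding lp_space_iff eq by (rule summable_sum) (use s in auto)
  have "(\<Sum>s. norm (block_glue K y s) powr p) = (\<Sum>k<K. \<Sum>s. norm (block_embed k (y k) s) powr p)"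
    unfolding eq by (rule suminf_sum) (use s in auto)
  also have "\<dots> = (\<Sum>k<K. lp_norm p (block_embed k (y k)) powr p)"
    by (intro sum.cong) (auto simp: lp_norm_powr[OF p block_embed_lp(1)[OF p y]])
  also have "\<dots> \<le> (\<Sum>k<K. lp_norm p (y k) powr p)"
    by (intro sum_mono powr_mono2) (use p in \<open>auto intro: block_embed_lp(2) y\<close>)
  finally show "lp_norm p (block_glue K y) \<le> (\<Sum>k<K. lp_norm p (y k) powr p) powr (1/p)"
    using p lp by (intro lp_norm_leI) (auto simp: powr_powr sum_nonneg)
qed

section \<open>The projective tensor power and its universal property\<close>

interpretation fscale: vector_space fscale
  by (rule vector_space_fscale)

definition bounded_linear_on ::
  "('k \<Rightarrow> 'a::real_normed_vector \<Rightarrow> 'a) \<Rightarrow> ('k \<Rightarrow> 'b::real_normed_vector \<Rightarrow> 'b) \<Rightarrow> 'a set \<Rightarrow> real \<Rightarrow> ('a \<Rightarrow> 'b) \<Rightarrow> bool" where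
  "bounded_linear_on s t V C f \<longleftrightarrow> linear_map_on s t V f \<and> 0 \<le> C \<and> (\<forall>v\<in>V. norm (f v) \<le> C * norm v)"

lemma (in vector_space) separating_functional:
  assumes "z \<noteq> 0"
  obtains \<phi> where "\<And>x y. \<phi> (x + y) = \<phi> x + \<phi> y" "\<And>c x. \<phi> (scale c x) = c * \<phi> x" "\<phi> z \<noteq> 0"
proof -
  have ind: "independent {z}" using assms by simp
  let ?B = "extend_basis {z}"
  note B = independent_extend_basis[OF ind] span_extend_basis[OF ind]
  have z: "z \<in> ?B" using extend_basis_superset[OF ind] by auto
  show thesis
  proof (rule that[of "\<lambda>x. representation ?B x z"])
    show "representation ?B (x + y) z = representation ?B x z + representation ?B y z" for x y
      using B by (subst representation_add) auto
    show "representation ?B (scale c x) z = c * representation ?B x z" for c x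
      using B by (subst representation_scale) auto
    show "representation ?B z z \<noteq> 0"
      using B z by (simp add: representation_basis)
  qed
qed

lemma sum_list_apply: "(\<Sum>x\<leftarrow>xs. F x) b = (\<Sum>x\<leftarrow>xs. F x b)"
  by (induction xs) (auto simp: zero_fun_def)

locale lp_tensor = banach_space_over sc
  for sc :: "'k::{real_normed_field,euclidean_space} \<Rightarrow> 'x::banach \<Rightarrow> 'x" +
  fixes p :: real and n :: nat
    and J :: "(((nat \<Rightarrow> nat \<Rightarrow> 'k) \<Rightarrow> 'k) \<Rightarrow> 'k) \<Rightarrow> 'x"
    and X :: "'x set"
  assumes p1: "1 \<le> p" and n1: "n \<ge> 1"
    and tensor_power: "is_projective_tensor_power fscale n (lp_space p) (lp_norm p) sc J X"
begin

abbreviation E :: "(nat \<Rightarrow> 'k) set" where "E \<equiv> lp_space p"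
abbreviation PE :: "(nat \<Rightarrow> nat \<Rightarrow> 'k) set" where "PE \<equiv> {..<n} \<rightarrow>\<^sub>E E"
abbreviation TP :: "(((nat \<Rightarrow> nat \<Rightarrow> 'k) \<Rightarrow> 'k) \<Rightarrow> 'k) set" where "TP \<equiv> tensor_power fscale n E"
abbreviation et :: "(nat \<Rightarrow> nat \<Rightarrow> 'k) \<Rightarrow> ((nat \<Rightarrow> nat \<Rightarrow> 'k) \<Rightarrow> 'k) \<Rightarrow> 'k" where
  "et \<equiv> elementary_tensor fscale n E"
abbreviation pn :: "(((nat \<Rightarrow> nat \<Rightarrow> 'k) \<Rightarrow> 'k) \<Rightarrow> 'k) \<Rightarrow> real" where
  "pn \<equiv> projective_norm fscale n E (lp_norm p)"

definition pnorm :: "(nat \<Rightarrow> nat \<Rightarrow> 'k) \<Rightarrow> real" where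
  "pnorm x = (\<Prod>i<n. lp_norm p (x i))"

lemma pnorm_nonneg [simp]: "0 \<le> pnorm x"
  by (simp add: pnorm_def prod_nonneg)

definition rep :: "(((nat \<Rightarrow> nat \<Rightarrow> 'k) \<Rightarrow> 'k) \<Rightarrow> 'k) \<Rightarrow> (nat \<Rightarrow> nat \<Rightarrow> 'k) list \<Rightarrow> bool" where
  "rep u xs \<longleftrightarrow> set xs \<subseteq> PE \<and> u = (\<Sum>x\<leftarrow>xs. et x)"

lemma J_lin: "u \<in> TP \<Longrightarrow> v \<in> TP \<Longrightarrow> J (u + v) = J u + J v"
  "u \<in> TP \<Longrightarrow> J (fscale c u) = sc c (J u)"
  and J_norm: "u \<in> TP \<Longrightarrow> norm (J u) = pn u"
  and X_def: "X = closure (J ` TP)"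
  using tensor_power by (auto simp: is_projective_tensor_power_def is_completion_def linear_map_on_def)

lemma TP_subspace: "module.subspace fscale TP"
  unfolding tensor_power_def by (rule fscale.subspace_span)

lemma et_TP: "x \<in> PE \<Longrightarrow> et x \<in> TP"
  unfolding tensor_power_def by (rule fscale.span_base) auto

lemma TP_0: "0 \<in> TP" and TP_add: "u \<in> TP \<Longrightarrow> v \<in> TP \<Longrightarrow> u + v \<in> TP"
  and TP_diff: "u \<in> TP \<Longrightarrow> v \<in> TP \<Longrightarrow> u - v \<in> TP"
  and TP_scale: "u \<in> TP \<Longrightarrow> fscale c u \<in> TP"
  using TP_subspace by (auto simp: fscale.subspace_0 fscale.subspace_add fscale.subspace_diff fscale.subspace_scale)

lemma et_add:
  assumes "x \<in> PE" "i < n" "y \<in> E" "z \<in> E"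
  shows "et (x(i := y + z)) = et (x(i := y)) + et (x(i := z))"
  using assms by (auto simp: elementary_tensor_def multilinear_forms_def fun_eq_iff)

lemma et_scale:
  assumes "x \<in> PE" "i < n" "y \<in> E"
  shows "et (x(i := fscale c y)) = fscale c (et (x(i := y)))"
  using assms by (auto simp: elementary_tensor_def multilinear_forms_def fun_eq_iff fscale_def)

lemma PE_upd: "x \<in> PE \<Longrightarrow> i < n \<Longrightarrow> y \<in> E \<Longrightarrow> x(i := y) \<in> PE"
  by (auto simp: PiE_def extensional_def)

lemma PE_D: "x \<in> PE \<Longrightarrow> i < n \<Longrightarrow> x i \<in> E"
  by auto

lemma n0: "0 < n"
  using n1 by simp

lemma rep_add: "rep u xs \<Longrightarrow> rep v ys \<Longrightarrow> rep (u + v) (xs @ ys)"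
  by (auto simp: rep_def)

lemma rep_scale:
  assumes "rep u xs"
  shows "rep (fscale c u) (map (\<lambda>x. x(0 := fscale c (x 0))) xs)"
proof -
  have *: "et (x(0 := fscale c (x 0))) = fscale c (et x)" if "x \<in> PE" for x
    using et_scale[OF that n0 PE_D[OF that n0], of c] by simp
  have "x(0 := fscale c (x 0)) \<in> PE" if "x \<in> PE" for x
    using that by (intro PE_upd lp_fscale p1 n0 PE_D)
  moreover have "fscale c (\<Sum>x\<leftarrow>ys. et x) = (\<Sum>x\<leftarrow>ys. et (x(0 := fscale c (x 0))))" if "set ys \<subseteq> PE" for ys
    using that by (induction ys) (auto simp: * fscale.scale_right_distrib simp del: fun_upd_apply)
  ultimately show ?thesis using assms by (auto simp: rep_def o_def)
qed

lemma rep_TP: "rep u xs \<Longrightarrow> u \<in> TP"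
proof -
  have "set xs \<subseteq> PE \<Longrightarrow> (\<Sum>x\<leftarrow>xs. et x) \<in> TP" for xs
    by (induction xs) (auto intro: TP_0 TP_add et_TP)
  then show "rep u xs \<Longrightarrow> u \<in> TP" by (auto simp: rep_def)
qed

lemma TP_rep:
  assumes "u \<in> TP"
  obtains xs where "rep u xs"
proof -
  from assms have "\<exists>xs. rep u xs"
    unfolding tensor_power_def
  proof (induction rule: fscale.span_induct_alt)
    case base
    then show ?case by (intro exI[of _ "[]"]) (simp add: rep_def zero_fun_def)
  next
    case (step c x y)
    then obtain w ys where w: "w \<in> PE" "x = et w" and ys: "rep y ys" by auto
    have "rep x [w]" using w by (simp add: rep_def)
    from rep_add[OF rep_scale[OF this, of c] ys] show ?case by blast
  qed
  then show thesis using that by blast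
qed

lemma pn_le: "rep u xs \<Longrightarrow> pn u \<le> (\<Sum>x\<leftarrow>xs. pnorm x)"
  unfolding projective_norm_def pnorm_def rep_def
  by (intro cInf_lower bdd_belowI[of _ 0]) (auto intro!: sum_list_nonneg prod_nonneg)

lemma pn_approx:
  assumes "u \<in> TP" "pn u < r"
  obtains xs where "rep u xs" "(\<Sum>x\<leftarrow>xs. pnorm x) < r"
proof -
  let ?S = "{(\<Sum>x\<leftarrow>xs. \<Prod>i<n. lp_norm p (x i)) | xs.
            set xs \<subseteq> PE \<and> u = (\<Sum>x\<leftarrow>xs. et x)}"
  obtain xs0 where "rep u xs0" using TP_rep[OF assms(1)] .
  then have "?S \<noteq> {}" by (auto simp: rep_def)
  then obtain s where "s \<in> ?S" "s < r"
    using cInf_lessD[of ?S r] assms(2) by (auto simp: projective_norm_def)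
  then show thesis using that by (auto simp: rep_def pnorm_def)
qed

lemma pn_et: "x \<in> PE \<Longrightarrow> pn (et x) \<le> pnorm x"
  using pn_le[of "et x" "[x]"] by (simp add: rep_def)

lemma closed_X: "closed X" by (simp add: X_def)

lemma J_0: "J 0 = 0"
  using J_lin(1)[OF TP_0 TP_0] by simp

lemma J_diff: "u \<in> TP \<Longrightarrow> v \<in> TP \<Longrightarrow> J (u - v) = J u - J v"
  using J_lin(1)[of "u - v" v] TP_diff[of u v] by simp

lemma J_TP_sub: "J ` TP \<subseteq> X"
  unfolding X_def by (rule closure_subset)

lemma X_seq:
  assumes "v \<in> X"
  obtains u where "\<And>m. u m \<in> TP" "(\<lambda>m. J (u m)) \<longlonglongrightarrow> v"
proof -
  obtain s where s: "\<And>m. s m \<in> J ` TP" "s \<longlonglongrightarrow> v"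
    using assms unfolding X_def closure_sequential by blast
  then have "\<forall>m. \<exists>u. u \<in> TP \<and> s m = J u" by auto
  then obtain u where u: "\<And>m. u m \<in> TP" "\<And>m. s m = J (u m)" by metis
  have "s = (\<lambda>m. J (u m))" using u(2) by auto
  then show thesis using that[of u] u(1) s(2) by simp
qed

lemma scale_tendsto:
  assumes "s \<longlonglongrightarrow> v"
  shows "(\<lambda>m. sc c (s m)) \<longlonglongrightarrow> sc c v"
proof -
  have "(\<lambda>m. norm c * norm (s m - v)) \<longlonglongrightarrow> norm c * 0"
    using assms by (intro tendsto_intros) (simp add: tendsto_norm_zero_iff LIM_zero_iff)
  then have "(\<lambda>m. sc c (s m) - sc c v) \<longlonglongrightarrow> 0"
    by (simp add: tendsto_norm_zero_iff flip: norm_scale scale_right_diff_distrib)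
  then show ?thesis by (simp add: LIM_zero_iff)
qed

lemma X_subspace: "subspace X"
proof (rule subspaceI)
  show "0 \<in> X" using J_TP_sub TP_0 J_0 by force
  show "v + w \<in> X" if vw: "v \<in> X" "w \<in> X" for v w
  proof -
    obtain a b where a: "\<And>m. a m \<in> TP" "(\<lambda>m. J (a m)) \<longlonglongrightarrow> v"
      and b: "\<And>m. b m \<in> TP" "(\<lambda>m. J (b m)) \<longlonglongrightarrow> w"
      using X_seq[OF vw(1)] X_seq[OF vw(2)] by metis
    have "(\<lambda>m. J (a m + b m)) \<longlonglongrightarrow> v + w"
      using tendsto_add[OF a(2) b(2)] by (simp add: J_lin a b)
    then show ?thesis
      using closed_X J_TP_sub TP_add[OF a(1) b(1)] by (auto elim!: closed_sequentially)
  qed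
  show "sc c v \<in> X" if v: "v \<in> X" for c v
  proof -
    obtain a where a: "\<And>m. a m \<in> TP" "(\<lambda>m. J (a m)) \<longlonglongrightarrow> v"
      using X_seq[OF v] by metis
    have "(\<lambda>m. J (fscale c (a m))) \<longlonglongrightarrow> sc c v"
      using scale_tendsto[OF a(2)] by (simp add: J_lin a)
    then show ?thesis
      using closed_X J_TP_sub TP_scale[OF a(1)] by (auto elim!: closed_sequentially)
  qed
qed

lemmas X_0 = subspace_0[OF X_subspace] and X_add = subspace_add[OF X_subspace]
  and X_diff = subspace_diff[OF X_subspace] and X_scale = subspace_scale[OF X_subspace]
  and X_sum = subspace_sum[OF X_subspace]

text \<open>Well-definedness on the algebraic tensor power is tested against the multilinear forms
  \<open>\<phi> \<circ> \<Psi>\<close>, where \<open>\<phi>\<close> runs through the (possibly unbounded) linear functionals on the target.\<close>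

lemma universal_property:
  fixes \<Psi> :: "(nat \<Rightarrow> nat \<Rightarrow> 'k) \<Rightarrow> 'y::banach" and t :: "'k \<Rightarrow> 'y \<Rightarrow> 'y"
  assumes t: "banach_space_over t"
    and add: "\<And>x i y z. x \<in> PE \<Longrightarrow> i < n \<Longrightarrow> y \<in> E \<Longrightarrow> z \<in> E \<Longrightarrow>
      \<Psi> (x(i := y + z)) = \<Psi> (x(i := y)) + \<Psi> (x(i := z))"
    and hom: "\<And>x i y c. x \<in> PE \<Longrightarrow> i < n \<Longrightarrow> y \<in> E \<Longrightarrow> \<Psi> (x(i := fscale c y)) = t c (\<Psi> (x(i := y)))"
    and bound: "\<And>x. x \<in> PE \<Longrightarrow> norm (\<Psi> x) \<le> C * pnorm x" and C: "0 \<le> C"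
  obtains f where "bounded_linear_on sc t X C f" "\<And>x. x \<in> PE \<Longrightarrow> f (J (et x)) = \<Psi> x"
proof -
  interpret t: banach_space_over t by (rule t)
  have wd: "(\<Sum>x\<leftarrow>xs. \<Psi> x) = (\<Sum>x\<leftarrow>ys. \<Psi> x)" if xs: "rep u xs" and ys: "rep u ys" for u xs ys
  proof (rule ccontr)
    define z where "z = (\<Sum>x\<leftarrow>xs. \<Psi> x) - (\<Sum>x\<leftarrow>ys. \<Psi> x)"
    assume "(\<Sum>x\<leftarrow>xs. \<Psi> x) \<noteq> (\<Sum>x\<leftarrow>ys. \<Psi> x)"
    then have "z \<noteq> 0" by (simp add: z_def)
    from t.separating_functional[OF this]
    obtain \<phi> where \<phi>: "\<And>x y. \<phi> (x + y) = \<phi> x + \<phi> y" "\<And>c x. \<phi> (t c x) = c * \<phi> x" "\<phi> z \<noteq> 0"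
      by metis
    define B where "B x = \<phi> (\<Psi> x)" for x
    have B: "B \<in> multilinear_forms fscale n E"
      by (auto simp: multilinear_forms_def B_def add hom \<phi>)
    have \<phi>0: "\<phi> 0 = 0" using \<phi>(1)[of 0 0] by simp
    have \<phi>sum: "\<phi> (\<Sum>x\<leftarrow>l. \<Psi> x) = (\<Sum>x\<leftarrow>l. B x)" for l
      by (induction l) (auto simp: \<phi> \<phi>0 B_def)
    have ev: "(\<Sum>x\<leftarrow>l. et x) B = (\<Sum>x\<leftarrow>l. B x)" for l
      unfolding sum_list_apply using B by (simp add: elementary_tensor_def)
    have "\<phi> (\<Sum>x\<leftarrow>xs. \<Psi> x) = \<phi> (\<Sum>x\<leftarrow>ys. \<Psi> x)"
      using xs ys ev[of xs] ev[of ys] by (simp add: rep_def \<phi>sum)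
    moreover have "\<phi> (\<Sum>x\<leftarrow>xs. \<Psi> x) = \<phi> z + \<phi> (\<Sum>x\<leftarrow>ys. \<Psi> x)"
      by (subst \<phi>(1)[symmetric]) (simp add: z_def)
    ultimately show False using \<phi>(3) by simp
  qed
  define f0 where "f0 u = (\<Sum>x\<leftarrow>(SOME xs. rep u xs). \<Psi> x)" for u
  have f0: "f0 u = (\<Sum>x\<leftarrow>xs. \<Psi> x)" if "rep u xs" for u xs
    unfolding f0_def using someI[of "rep u", OF that] that by (rule wd)
  have f0_add: "f0 (u + v) = f0 u + f0 v" if "u \<in> TP" "v \<in> TP" for u v
  proof -
    obtain xs where "rep u xs" using TP_rep[OF \<open>u \<in> TP\<close>] .
    moreover obtain ys where "rep v ys" using TP_rep[OF \<open>v \<in> TP\<close>] .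
    ultimately show ?thesis using rep_add[of u xs v ys] by (simp add: f0)
  qed
  have f0_scale: "f0 (fscale c u) = t c (f0 u)" if "u \<in> TP" for u c
  proof -
    obtain xs where xs: "rep u xs" using TP_rep[OF \<open>u \<in> TP\<close>] .
    have *: "\<Psi> (x(0 := fscale c (x 0))) = t c (\<Psi> x)" if "x \<in> PE" for x
      using hom[OF that n0 PE_D[OF that n0], of c] by simp
    have "set ys \<subseteq> PE \<Longrightarrow> (\<Sum>x\<leftarrow>ys. \<Psi> (x(0 := fscale c (x 0)))) = t c (\<Sum>x\<leftarrow>ys. \<Psi> x)" for ys
      by (induction ys) (auto simp: * t.scale_right_distrib)
    then show ?thesis using f0[OF xs] f0[OF rep_scale[OF xs]] xs by (simp add: o_def rep_def)
  qed
  have f0_norm: "norm (f0 u) \<le> C * pn u" if u: "u \<in> TP" for u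
  proof (rule field_le_epsilon)
    fix e :: real assume e: "0 < e"
    have C1: "0 < C + 1" using C by simp
    obtain xs where xs: "rep u xs" "(\<Sum>x\<leftarrow>xs. pnorm x) < pn u + e / (C + 1)"
      using pn_approx[OF u, of "pn u + e / (C + 1)"] e C1 by auto
    have "set ys \<subseteq> PE \<Longrightarrow> norm (\<Sum>x\<leftarrow>ys. \<Psi> x) \<le> C * (\<Sum>x\<leftarrow>ys. pnorm x)" for ys
    proof (induction ys)
      case (Cons y ys)
      then show ?case
        using bound[of y] norm_triangle_ineq[of "\<Psi> y" "\<Sum>x\<leftarrow>ys. \<Psi> x"] by (simp add: distrib_left)
    qed simp
    then have "norm (f0 u) \<le> C * (\<Sum>x\<leftarrow>xs. pnorm x)" using xs(1) f0[OF xs(1)] by (simp add: rep_def)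
    also have "\<dots> \<le> C * (pn u + e / (C + 1))" using xs(2) C by (intro mult_left_mono) auto
    also have "\<dots> \<le> C * pn u + e" using e C by (simp add: field_simps)
    finally show "norm (f0 u) \<le> C * pn u + e" .
  qed
  have f0_diff: "f0 (u - v) = f0 u - f0 v" if "u \<in> TP" "v \<in> TP" for u v
    using f0_add[of "u - v" v] TP_diff that by simp
  have inj: "f0 u = f0 v" if "u \<in> TP" "v \<in> TP" "J u = J v" for u v
  proof -
    have "pn (u - v) = 0" using J_norm[of "u - v"] TP_diff[of u v] J_diff[of u v] that by simp
    then show ?thesis using f0_norm[of "u - v"] TP_diff[of u v] f0_diff[of u v] that by simp
  qed
  define f1 where "f1 v = f0 (SOME u. u \<in> TP \<and> J u = v)" for v
  have f1: "f1 (J u) = f0 u" if "u \<in> TP" for u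
  proof -
    have "(SOME w. w \<in> TP \<and> J w = J u) \<in> TP \<and> J (SOME w. w \<in> TP \<and> J w = J u) = J u"
      by (rule someI[of "\<lambda>w. w \<in> TP \<and> J w = J u" u]) (use that in auto)
    then show ?thesis unfolding f1_def using inj that by blast
  qed
  have "C-lipschitz_on (J ` TP) f1"
  proof (rule lipschitz_onI)
    fix v w assume "v \<in> J ` TP" "w \<in> J ` TP"
    then obtain a b where ab: "a \<in> TP" "v = J a" "b \<in> TP" "w = J b" by auto
    then have "dist (f1 v) (f1 w) = norm (f0 (a - b))" by (simp add: f1 f0_diff dist_norm)
    also have "\<dots> \<le> C * norm (J (a - b))" using f0_norm[of "a - b"] ab by (simp add: TP_diff J_norm)
    finally show "dist (f1 v) (f1 w) \<le> C * dist v w" using ab by (simp add: J_diff dist_norm)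
  qed (rule C)
  from uniformly_continuous_on_extension_on_closure[OF lipschitz_on_uniformly_continuous[OF this]]
  obtain f where f: "uniformly_continuous_on X f" "\<And>v. v \<in> J ` TP \<Longrightarrow> f1 v = f v"
    unfolding X_def by metis
  have cont: "continuous_on X f" by (rule uniformly_continuous_imp_continuous[OF f(1)])
  have fJ: "f (J u) = f0 u" if "u \<in> TP" for u using f(2)[of "J u"] f1[OF that] that by simp
  have lim: "(\<lambda>m. f0 (a m)) \<longlonglongrightarrow> f v" if "\<And>m. a m \<in> TP" "(\<lambda>m. J (a m)) \<longlonglongrightarrow> v" "v \<in> X" for a v
  proof -
    have "J (a m) \<in> X" for m using J_TP_sub that(1) by blast
    then show ?thesis using continuous_on_tendsto_compose[OF cont that(2,3)] that(1) by (simp add: fJ)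
  qed
  have "f (v + w) = f v + f w" if vw: "v \<in> X" "w \<in> X" for v w
  proof -
    obtain a b where a: "\<And>m. a m \<in> TP" "(\<lambda>m. J (a m)) \<longlonglongrightarrow> v"
      and b: "\<And>m. b m \<in> TP" "(\<lambda>m. J (b m)) \<longlonglongrightarrow> w"
      using X_seq[OF vw(1)] X_seq[OF vw(2)] by metis
    have "(\<lambda>m. f0 (a m + b m)) \<longlonglongrightarrow> f (v + w)"
      using tendsto_add[OF a(2) b(2)] by (intro lim) (auto simp: J_lin a b TP_add X_add vw)
    moreover have "(\<lambda>m. f0 (a m + b m)) \<longlonglongrightarrow> f v + f w"
      using tendsto_add[OF lim[OF a vw(1)] lim[OF b vw(2)]] by (simp add: f0_add a b)
    ultimately show ?thesis by (rule LIMSEQ_unique)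
  qed
  moreover have "f (sc c v) = t c (f v) \<and> norm (f v) \<le> C * norm v" if v: "v \<in> X" for c v
  proof -
    obtain a where a: "\<And>m. a m \<in> TP" "(\<lambda>m. J (a m)) \<longlonglongrightarrow> v"
      using X_seq[OF v] by metis
    have "(\<lambda>m. f0 (fscale c (a m))) \<longlonglongrightarrow> f (sc c v)"
      using scale_tendsto[OF a(2)] by (intro lim) (auto simp: J_lin a TP_scale X_scale v)
    moreover have "(\<lambda>m. f0 (fscale c (a m))) \<longlonglongrightarrow> t c (f v)"
    proof -
      have "(\<lambda>m. norm c * norm (f0 (a m) - f v)) \<longlonglongrightarrow> norm c * 0"
        using lim[OF a v] by (intro tendsto_intros) (simp add: tendsto_norm_zero_iff LIM_zero_iff)
      then have "(\<lambda>m. t c (f0 (a m)) - t c (f v)) \<longlonglongrightarrow> 0"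
        by (simp add: tendsto_norm_zero_iff flip: t.norm_scale t.scale_right_diff_distrib)
      then show ?thesis by (simp add: LIM_zero_iff f0_scale a)
    qed
    ultimately have "f (sc c v) = t c (f v)" by (rule LIMSEQ_unique)
    moreover have "norm (f v) \<le> C * norm v"
      by (rule LIMSEQ_le[OF tendsto_norm[OF lim[OF a v]] tendsto_mult_left[OF tendsto_norm[OF a(2)]]])
        (auto simp: J_norm a intro!: f0_norm)
    ultimately show ?thesis by simp
  qed
  ultimately have "bounded_linear_on sc t X C f"
    by (auto simp: bounded_linear_on_def linear_map_on_def C)
  moreover have "f (J (et x)) = \<Psi> x" if "x \<in> PE" for x
    using fJ[OF et_TP[OF that]] f0[of "et x" "[x]"] that by (simp add: rep_def)
  ultimately show thesis using that by blast
qed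

definition tup :: "(nat \<Rightarrow> nat \<Rightarrow> 'k) \<Rightarrow> bool" where
  "tup x \<longleftrightarrow> (\<forall>i<n. x i \<in> E)"

definition jt :: "(nat \<Rightarrow> nat \<Rightarrow> 'k) \<Rightarrow> 'x" where
  "jt x = J (et (restrict x {..<n}))"

lemma tupD: "tup x \<Longrightarrow> i < n \<Longrightarrow> x i \<in> E"
  by (simp add: tup_def)

lemma tup_restrict: "tup x \<Longrightarrow> restrict x {..<n} \<in> PE"
  by (auto simp: tup_def)

lemma tup_upd: "tup x \<Longrightarrow> y \<in> E \<Longrightarrow> tup (x(i := y))"
  by (simp add: tup_def)

lemma jt_cong: "(\<And>i. i < n \<Longrightarrow> x i = y i) \<Longrightarrow> jt x = jt y"
  unfolding jt_def by (intro arg_cong[of _ _ J] arg_cong[of _ _ et]) auto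

lemma pnorm_cong: "(\<And>i. i < n \<Longrightarrow> x i = y i) \<Longrightarrow> pnorm x = pnorm y"
  unfolding pnorm_def by (intro prod.cong) auto

lemma pnorm_upd: "i < n \<Longrightarrow> pnorm (x(i := y)) = lp_norm p y * (\<Prod>j\<in>{..<n}-{i}. lp_norm p (x j))"
  unfolding pnorm_def by (subst prod.remove[of _ i]) auto

lemma restrict_upd': "i < n \<Longrightarrow> restrict (x(i := y)) {..<n} = (restrict x {..<n})(i := y)"
  by auto

lemma jt_X: "tup x \<Longrightarrow> jt x \<in> X"
  unfolding jt_def using J_TP_sub et_TP[OF tup_restrict] by auto

lemma jt_norm: "tup x \<Longrightarrow> norm (jt x) \<le> pnorm x"
  unfolding jt_def using J_norm[OF et_TP[OF tup_restrict]] pn_et[OF tup_restrict, of x]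
    pnorm_cong[of "restrict x {..<n}" x] by simp

lemma jt_add:
  assumes "tup x" "i < n" "y \<in> E" "z \<in> E"
  shows "jt (x(i := y + z)) = jt (x(i := y)) + jt (x(i := z))"
  unfolding jt_def restrict_upd'[OF assms(2)] et_add[OF tup_restrict[OF assms(1)] assms(2-4)]
  by (intro J_lin et_TP PE_upd tup_restrict assms)

lemma jt_scale:
  assumes "tup x" "i < n" "y \<in> E"
  shows "jt (x(i := fscale c y)) = sc c (jt (x(i := y)))"
  unfolding jt_def restrict_upd'[OF assms(2)] et_scale[OF tup_restrict[OF assms(1)] assms(2-3)]
  by (intro J_lin et_TP PE_upd tup_restrict assms)

lemma jt_eq_0:
  assumes "tup x" "i < n" "x i = (\<lambda>t. 0)"
  shows "jt x = 0"
  using jt_norm[OF assms(1)] assms(2,3) pnorm_upd[of i x "x i"] by (simp add: lp_norm_def del: fun_upd_apply) (simp add: assms(3)[symmetric])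

lemma jt_approx:
  assumes v: "v \<in> X" and r: "norm v < r" and e: "0 < e"
  obtains xs where "\<And>x. x \<in> set xs \<Longrightarrow> tup x" "norm (v - (\<Sum>x\<leftarrow>xs. jt x)) < e"
    "(\<Sum>x\<leftarrow>xs. pnorm x) < r"
proof -
  obtain u where u: "\<And>m. u m \<in> TP" "(\<lambda>m. J (u m)) \<longlonglongrightarrow> v" using X_seq[OF v] by metis
  have "eventually (\<lambda>m. norm (J (u m)) < r) sequentially"
    by (rule order_tendstoD(2)[OF tendsto_norm[OF u(2)] r])
  moreover have "eventually (\<lambda>m. dist (J (u m)) v < e) sequentially"
    by (rule tendstoD[OF u(2) e])
  ultimately have "eventually (\<lambda>m. norm (J (u m)) < r \<and> dist (J (u m)) v < e) sequentially"
    by eventually_elim simp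
  then obtain m where m: "norm (J (u m)) < r" "dist (J (u m)) v < e"
    by (auto simp: eventually_sequentially)
  obtain xs where xs: "rep (u m) xs" "(\<Sum>x\<leftarrow>xs. pnorm x) < r"
    using pn_approx[OF u(1), of m r] m(1) J_norm[OF u(1)] by auto
  have tup: "tup x" if "x \<in> set xs" for x
    using xs(1) that by (auto simp: rep_def tup_def)
  have "set ys \<subseteq> PE \<Longrightarrow> J (\<Sum>x\<leftarrow>ys. et x) = (\<Sum>x\<leftarrow>ys. jt x)" for ys
  proof (induction ys)
    case Nil
    then show ?case using J_0 by (simp add: zero_fun_def)
  next
    case (Cons y ys)
    have "(\<Sum>x\<leftarrow>ys. et x) \<in> TP" using Cons.prems rep_TP[of _ ys] by (simp add: rep_def)
    then have "J (et y + (\<Sum>x\<leftarrow>ys. et x)) = J (et y) + J (\<Sum>x\<leftarrow>ys. et x)"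
      using Cons.prems by (intro J_lin et_TP) auto
    moreover have "jt y = J (et y)" using Cons.prems PiE_restrict[of y "{..<n}" "\<lambda>_. E"] by (simp add: jt_def)
    ultimately show ?case
      using Cons by (simp only: list.map sum_list.Cons) simp
  qed
  then have "J (u m) = (\<Sum>x\<leftarrow>xs. jt x)" using xs(1) by (simp add: rep_def)
  then show thesis using that[of xs] tup xs(2) m(2) by (simp add: dist_norm norm_minus_commute)
qed

lemma jt_universal:
  fixes \<Psi> :: "(nat \<Rightarrow> nat \<Rightarrow> 'k) \<Rightarrow> 'y::banach" and t :: "'k \<Rightarrow> 'y \<Rightarrow> 'y"
  assumes t: "banach_space_over t"
    and cong: "\<And>x y. (\<And>i. i < n \<Longrightarrow> x i = y i) \<Longrightarrow> \<Psi> x = \<Psi> y"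
    and add: "\<And>x i y z. tup x \<Longrightarrow> i < n \<Longrightarrow> y \<in> E \<Longrightarrow> z \<in> E \<Longrightarrow>
      \<Psi> (x(i := y + z)) = \<Psi> (x(i := y)) + \<Psi> (x(i := z))"
    and hom: "\<And>x i y c. tup x \<Longrightarrow> i < n \<Longrightarrow> y \<in> E \<Longrightarrow> \<Psi> (x(i := fscale c y)) = t c (\<Psi> (x(i := y)))"
    and bound: "\<And>x. tup x \<Longrightarrow> norm (\<Psi> x) \<le> C * pnorm x" and C: "0 \<le> C"
  obtains f where "bounded_linear_on sc t X C f" "\<And>x. tup x \<Longrightarrow> f (jt x) = \<Psi> x"
proof -
  have tup: "tup x" if "x \<in> PE" for x using that by (auto simp: tup_def)
  have "\<exists>f. bounded_linear_on sc t X C f \<and> (\<forall>x\<in>PE. f (J (et x)) = \<Psi> x)"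
    by (rule universal_property[of t \<Psi> C])
      (assumption | rule t add[OF tup] hom[OF tup] bound[OF tup] C | blast)+
  then obtain f where f: "bounded_linear_on sc t X C f" "\<And>x. x \<in> PE \<Longrightarrow> f (J (et x)) = \<Psi> x"
    by blast
  have "f (jt x) = \<Psi> x" if "tup x" for x
    unfolding jt_def f(2)[OF tup_restrict[OF that]] by (rule cong) simp
  then show thesis using that f(1) by blast
qed

lemma bl_add: "bounded_linear_on sc t X C f \<Longrightarrow> v \<in> X \<Longrightarrow> w \<in> X \<Longrightarrow> f (v + w) = f v + f w"
  and bl_scale: "bounded_linear_on sc t X C f \<Longrightarrow> v \<in> X \<Longrightarrow> f (sc c v) = t c (f v)"
  and bl_norm: "bounded_linear_on sc t X C f \<Longrightarrow> v \<in> X \<Longrightarrow> norm (f v) \<le> C * norm v"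
  and bl_nonneg: "bounded_linear_on sc t X C f \<Longrightarrow> 0 \<le> C"
  by (auto simp: bounded_linear_on_def linear_map_on_def)

lemma bl_0: "bounded_linear_on sc t X C f \<Longrightarrow> f 0 = 0"
  using bl_add[of t C f 0 0] X_0 by simp

lemma bl_diff: "bounded_linear_on sc t X C f \<Longrightarrow> v \<in> X \<Longrightarrow> w \<in> X \<Longrightarrow> f (v - w) = f v - f w"
  using bl_add[of t C f "v - w" w] X_diff by simp

lemma bl_sum:
  assumes "bounded_linear_on sc t X C f" "\<And>i. i \<in> I \<Longrightarrow> v i \<in> X"
  shows "f (sum v I) = (\<Sum>i\<in>I. f (v i))"
  using assms(2)
proof (induction I rule: infinite_finite_induct)
  case (insert i I)
  moreover have "sum v I \<in> X" using insert.prems by (intro X_sum) auto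
  ultimately show ?case using bl_add[OF assms(1), of "v i" "sum v I"] by simp
qed (simp_all add: bl_0[OF assms(1)])

lemma X_sum_list: "(\<And>x. x \<in> set xs \<Longrightarrow> F x \<in> X) \<Longrightarrow> (\<Sum>x\<leftarrow>xs. F x) \<in> X"
  by (induction xs) (auto intro: X_0 X_add)

lemma bl_sum_list:
  assumes "bounded_linear_on sc t X C f" "\<And>x. x \<in> set xs \<Longrightarrow> F x \<in> X"
  shows "f (\<Sum>x\<leftarrow>xs. F x) = (\<Sum>x\<leftarrow>xs. f (F x))"
  using assms(2) by (induction xs) (auto simp: bl_0[OF assms(1)] bl_add[OF assms(1)] X_sum_list)

lemma bl_tendsto:
  assumes f: "bounded_linear_on sc t X C f" and v: "v \<in> X" and u: "\<And>m. u m \<in> X" "u \<longlonglongrightarrow> v"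
  shows "(\<lambda>m. f (u m)) \<longlonglongrightarrow> f v"
proof -
  have "(\<lambda>m. C * norm (u m - v)) \<longlonglongrightarrow> C * 0"
    using u(2) by (intro tendsto_intros) (simp add: tendsto_norm_zero_iff LIM_zero_iff)
  then have "(\<lambda>m. C * norm (u m - v)) \<longlonglongrightarrow> 0" by simp
  then have "(\<lambda>m. f (u m) - f v) \<longlonglongrightarrow> 0"
    using bl_norm[OF f X_diff[OF u(1) v]]
    by (intro Lim_null_comparison[OF always_eventually \<open>(\<lambda>m. C * norm (u m - v)) \<longlonglongrightarrow> 0\<close>])
      (simp add: bl_diff[OF f u(1) v])
  then show ?thesis by (simp add: LIM_zero_iff)
qed

lemma norm_le_from_jt:
  assumes f: "bounded_linear_on sc t X C' f" and C: "0 \<le> C"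
    and bound: "\<And>x. tup x \<Longrightarrow> norm (f (jt x)) \<le> C * pnorm x" and v: "v \<in> X"
  shows "norm (f v) \<le> C * norm v"
proof (rule field_le_epsilon)
  fix e :: real assume e: "0 < e"
  define d where "d = e / (C + C' + 1)"
  have CC: "0 < C + C' + 1" using C bl_nonneg[OF f] by simp
  have d: "0 < d" using e CC by (simp add: d_def)
  obtain xs where xs: "\<And>x. x \<in> set xs \<Longrightarrow> tup x" "norm (v - (\<Sum>x\<leftarrow>xs. jt x)) < d"
    "(\<Sum>x\<leftarrow>xs. pnorm x) < norm v + d"
    using jt_approx[OF v, of "norm v + d" d] d by auto
  let ?s = "\<Sum>x\<leftarrow>xs. jt x"
  have s: "?s \<in> X" using xs(1) by (intro X_sum_list jt_X)
  have "(\<And>x. x \<in> set ys \<Longrightarrow> tup x) \<Longrightarrow> norm (\<Sum>x\<leftarrow>ys. f (jt x)) \<le> C * (\<Sum>x\<leftarrow>ys. pnorm x)" for ys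
  proof (induction ys)
    case (Cons y ys)
    then show ?case
      using bound[of y] norm_triangle_ineq[of "f (jt y)" "\<Sum>x\<leftarrow>ys. f (jt x)"] by (simp add: distrib_left)
  qed simp
  then have "norm (f ?s) \<le> C * (\<Sum>x\<leftarrow>xs. pnorm x)"
    using xs(1) by (subst bl_sum_list[OF f]) (auto intro: jt_X)
  also have "\<dots> \<le> C * (norm v + d)" using xs(3) C by (intro mult_left_mono) auto
  finally have 1: "norm (f ?s) \<le> C * (norm v + d)" .
  have 2: "norm (f (v - ?s)) \<le> C' * d"
    using bl_norm[OF f X_diff[OF v s]] xs(2) bl_nonneg[OF f]
    by (meson less_imp_le mult_left_mono order_trans)
  have "norm (f v) \<le> norm (f (v - ?s)) + norm (f ?s)"
    using norm_triangle_ineq[of "f (v - ?s)" "f ?s"] bl_diff[OF f v s] by simp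
  also have "\<dots> \<le> C' * d + C * (norm v + d)" using 1 2 by simp
  also have "\<dots> \<le> C * norm v + (C + C' + 1) * d" using d by (simp add: algebra_simps)
  also have "(C + C' + 1) * d = e" using CC by (simp add: d_def)
  finally show "norm (f v) \<le> C * norm v + e" .
qed

lemma eq_from_jt:
  assumes t: "banach_space_over t" and f: "bounded_linear_on sc t X C f" and g: "bounded_linear_on sc t X C' g"
    and eq: "\<And>x. tup x \<Longrightarrow> f (jt x) = g (jt x)" and v: "v \<in> X"
  shows "f v = g v"
proof -
  interpret t: banach_space_over t by (rule t)
  have "bounded_linear_on sc t X (C + C') (\<lambda>v. f v - g v)"
    unfolding bounded_linear_on_def linear_map_on_def
  proof (intro conjI ballI allI)
    show "0 \<le> C + C'" using bl_nonneg[OF f] bl_nonneg[OF g] by simp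
    show "norm (f v - g v) \<le> (C + C') * norm v" if "v \<in> X" for v
      using norm_triangle_ineq4[of "f v" "g v"] bl_norm[OF f that] bl_norm[OF g that] by (simp add: distrib_right)
  qed (simp_all add: bl_add[OF f] bl_add[OF g] bl_scale[OF f] bl_scale[OF g] t.scale_right_diff_distrib)
  from norm_le_from_jt[OF this, of 0 v] eq v show ?thesis by simp
qed

definition oper :: "real \<Rightarrow> ('x \<Rightarrow> 'x) \<Rightarrow> bool" where
  "oper C f \<longleftrightarrow> bounded_linear_on sc sc X C f \<and> (\<forall>v\<in>X. f v \<in> X)"

lemma oper_bl: "oper C f \<Longrightarrow> bounded_linear_on sc sc X C f"
  by (simp add: oper_def)

lemma oper_X: "oper C f \<Longrightarrow> v \<in> X \<Longrightarrow> f v \<in> X"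
  by (simp add: oper_def)

lemmas oper_add = bl_add[OF oper_bl] and oper_scale = bl_scale[OF oper_bl]
  and oper_norm = bl_norm[OF oper_bl] and oper_nonneg = bl_nonneg[OF oper_bl]
  and oper_0 = bl_0[OF oper_bl] and oper_diff = bl_diff[OF oper_bl]
  and oper_sum = bl_sum[OF oper_bl] and oper_sum_list = bl_sum_list[OF oper_bl]
  and oper_tendsto = bl_tendsto[OF oper_bl]

lemma operI:
  assumes "\<And>v w. v \<in> X \<Longrightarrow> w \<in> X \<Longrightarrow> f (v + w) = f v + f w"
    "\<And>c v. v \<in> X \<Longrightarrow> f (sc c v) = sc c (f v)" "\<And>v. v \<in> X \<Longrightarrow> norm (f v) \<le> C * norm v" "0 \<le> C"
    "\<And>v. v \<in> X \<Longrightarrow> f v \<in> X"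
  shows "oper C f"
  using assms by (simp add: oper_def bounded_linear_on_def linear_map_on_def)

lemma oper_mono: "oper C f \<Longrightarrow> C \<le> D \<Longrightarrow> oper D f"
  by (auto simp: oper_def bounded_linear_on_def) (meson mult_right_mono norm_ge_zero order_trans)

lemma oper_id: "oper 1 (\<lambda>v. v)"
  by (rule operI) auto

lemma oper_comp: "oper C f \<Longrightarrow> oper D g \<Longrightarrow> oper (C * D) (\<lambda>v. f (g v))"
proof (rule operI)
  assume f: "oper C f" and g: "oper D g"
  show "norm (f (g v)) \<le> C * D * norm v" if "v \<in> X" for v
  proof -
    have "norm (f (g v)) \<le> C * norm (g v)" using oper_norm[OF f oper_X[OF g that]] .
    also have "\<dots> \<le> C * (D * norm v)" by (intro mult_left_mono oper_norm[OF g that] oper_nonneg[OF f])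
    finally show ?thesis by (simp add: mult.assoc)
  qed
qed (auto simp: oper_add oper_scale oper_X oper_nonneg)

lemma oper_plus: "oper C f \<Longrightarrow> oper D g \<Longrightarrow> oper (C + D) (\<lambda>v. f v + g v)"
proof (rule operI)
  assume f: "oper C f" and g: "oper D g"
  show "norm (f v + g v) \<le> (C + D) * norm v" if "v \<in> X" for v
    using norm_triangle_ineq[of "f v" "g v"] oper_norm[OF f that] oper_norm[OF g that] by (simp add: distrib_right)
qed (auto simp: oper_add oper_scale oper_X oper_nonneg X_add scale_right_distrib)

lemma oper_smult: "oper C f \<Longrightarrow> oper (norm c * C) (\<lambda>v. sc c (f v))"
proof (rule operI)
  assume f: "oper C f"
  show "norm (sc c (f v)) \<le> norm c * C * norm v" if "v \<in> X" for v
    using oper_norm[OF f that] by (simp add: norm_scale mult.assoc mult_left_mono)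
qed (auto simp: oper_add oper_scale oper_X oper_nonneg X_scale scale_right_distrib mult.commute)

lemma oper_minus: "oper C f \<Longrightarrow> oper D g \<Longrightarrow> oper (C + D) (\<lambda>v. f v - g v)"
  using oper_plus[of C f D "\<lambda>v. sc (-1) (g v)"] oper_smult[of D g "-1"] by simp

lemma oper_zero: "oper 0 (\<lambda>v. 0)"
  by (rule operI) (auto simp: X_0)

lemma oper_sum_fun:
  assumes "finite I" "\<And>i. i \<in> I \<Longrightarrow> oper (C i) (f i)"
  shows "oper (\<Sum>i\<in>I. C i) (\<lambda>v. \<Sum>i\<in>I. f i v)"
  using assms by (induction I rule: finite_induct) (auto simp: oper_zero oper_plus)

lemma sc_banach: "banach_space_over sc"
  by unfold_locales

lemma oper_eqI:
  assumes "oper C f" "oper D g" "\<And>x. tup x \<Longrightarrow> f (jt x) = g (jt x)" "v \<in> X"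
  shows "f v = g v"
  using eq_from_jt[OF sc_banach oper_bl[OF assms(1)] oper_bl[OF assms(2)]] assms(3,4) by blast

lemma oper_universal:
  assumes cong: "\<And>x y. (\<And>i. i < n \<Longrightarrow> x i = y i) \<Longrightarrow> \<Psi> x = \<Psi> y"
    and add: "\<And>x i y z. tup x \<Longrightarrow> i < n \<Longrightarrow> y \<in> E \<Longrightarrow> z \<in> E \<Longrightarrow>
      \<Psi> (x(i := y + z)) = \<Psi> (x(i := y)) + \<Psi> (x(i := z))"
    and hom: "\<And>x i y c. tup x \<Longrightarrow> i < n \<Longrightarrow> y \<in> E \<Longrightarrow> \<Psi> (x(i := fscale c y)) = sc c (\<Psi> (x(i := y)))"
    and bound: "\<And>x. tup x \<Longrightarrow> norm (\<Psi> x) \<le> C * pnorm x" and C: "0 \<le> C"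
    and X: "\<And>x. tup x \<Longrightarrow> \<Psi> x \<in> X"
  obtains f where "oper C f" "\<And>x. tup x \<Longrightarrow> f (jt x) = \<Psi> x"
proof -
  have "\<exists>f. bounded_linear_on sc sc X C f \<and> (\<forall>x. tup x \<longrightarrow> f (jt x) = \<Psi> x)"
    by (rule jt_universal[of sc \<Psi> C]) (assumption | rule sc_banach cong add hom bound C | blast)+
  then obtain f where f: "bounded_linear_on sc sc X C f" "\<And>x. tup x \<Longrightarrow> f (jt x) = \<Psi> x"
    by blast
  have "f v \<in> X" if v: "v \<in> X" for v
  proof -
    have "\<exists>w\<in>X. norm (v - w) < 1 / Suc m \<and> f w \<in> X" for m
    proof -
      obtain xs where xs: "\<And>x. x \<in> set xs \<Longrightarrow> tup x" "norm (v - (\<Sum>x\<leftarrow>xs. jt x)) < 1 / Suc m"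
        using jt_approx[OF v, of "norm v + 1" "1 / Suc m"] by (metis less_add_one of_nat_0_less_iff zero_less_Suc zero_less_divide_1_iff)
      have jX: "(\<Sum>x\<leftarrow>xs. jt x) \<in> X" using xs(1) by (intro X_sum_list jt_X)
      have "f (\<Sum>x\<leftarrow>xs. jt x) = (\<Sum>x\<leftarrow>xs. f (jt x))"
        using xs(1) by (intro bl_sum_list[OF f(1)] jt_X)
      moreover have "\<dots> \<in> X" using xs(1) X f(2) by (intro X_sum_list) simp
      ultimately show ?thesis using xs(2) jX by auto
    qed
    then obtain w where w: "\<And>m. w m \<in> X" "\<And>m. norm (v - w m) < 1 / Suc m" "\<And>m. f (w m) \<in> X"
      by metis
    have "(\<lambda>m. w m - v) \<longlonglongrightarrow> 0"
    proof (rule Lim_null_comparison[OF always_eventually lim_inverse_n'[THEN LIMSEQ_Suc]], rule allI)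
      show "norm (w m - v) \<le> 1 / real (Suc m)" for m
        using less_imp_le[OF w(2)[of m]] by (simp add: norm_minus_commute)
    qed
    then have "w \<longlonglongrightarrow> v" by (simp add: LIM_zero_iff)
    from bl_tendsto[OF f(1) v w(1) this] show ?thesis
      using closed_X w(3) by (auto elim!: closed_sequentially)
  qed
  then show thesis using that f by (auto simp: oper_def)
qed

section \<open>Tensor operators and coordinates\<close>


definition reindex_op :: "(nat \<Rightarrow> 'k) \<Rightarrow> (nat \<Rightarrow> nat) \<Rightarrow> (nat \<Rightarrow> 'k) \<Rightarrow> nat \<Rightarrow> 'k" where
  "reindex_op c \<phi> y = (\<lambda>t. c t * y (\<phi> t))"

definition contractive :: "(nat \<Rightarrow> 'k) \<Rightarrow> (nat \<Rightarrow> nat) \<Rightarrow> bool" where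
  "contractive c \<phi> \<longleftrightarrow> (\<forall>t. norm (c t) \<le> 1) \<and> inj_on \<phi> {t. c t \<noteq> 0}"

lemma reindex_op_E:
  assumes "contractive c \<phi>" "y \<in> E"
  shows "reindex_op c \<phi> y \<in> E" "lp_norm p (reindex_op c \<phi> y) \<le> lp_norm p y"
  using lp_scaled_reindex[OF p1 assms(2), of c 1 \<phi>] assms(1)
  by (auto simp: reindex_op_def contractive_def)

lemma reindex_op_add: "reindex_op c \<phi> (y + z) = reindex_op c \<phi> y + reindex_op c \<phi> z"
  by (auto simp: reindex_op_def algebra_simps)

lemma reindex_op_fscale: "reindex_op c \<phi> (fscale a y) = fscale a (reindex_op c \<phi> y)"
  by (auto simp: reindex_op_def fscale_def)

definition tensor_op :: "(nat \<Rightarrow> nat) \<Rightarrow> (nat \<Rightarrow> nat \<Rightarrow> 'k) \<Rightarrow> (nat \<Rightarrow> nat \<Rightarrow> nat) \<Rightarrow> 'x \<Rightarrow> 'x" where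
  "tensor_op \<pi> c \<phi> = (SOME f. oper 1 f \<and>
     (\<forall>x. tup x \<longrightarrow> f (jt x) = jt (\<lambda>j. reindex_op (c j) (\<phi> j) (x (\<pi> j)))))"

lemma tensor_op_exists:
  assumes \<pi>: "\<pi> permutes {..<n}" and c: "\<And>j. j < n \<Longrightarrow> contractive (c j) (\<phi> j)"
  shows "\<exists>f. oper 1 f \<and> (\<forall>x. tup x \<longrightarrow> f (jt x) = jt (\<lambda>j. reindex_op (c j) (\<phi> j) (x (\<pi> j))))"
proof -
  let ?h = "\<lambda>j. reindex_op (c j) (\<phi> j)"
  let ?\<Psi> = "\<lambda>x. jt (\<lambda>j. ?h j (x (\<pi> j)))"
  have \<pi>n: "\<pi> j < n \<longleftrightarrow> j < n" for j using permutes_in_image[OF \<pi>, of j] by simp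
  have tup: "tup (\<lambda>j. ?h j (x (\<pi> j)))" if "tup x" for x
    unfolding tup_def using that \<pi>n by (auto intro!: reindex_op_E c simp: tup_def)
  have inv: "\<pi> (inv \<pi> i) = i" "inv \<pi> (\<pi> i) = i" for i
    using permutes_inverses[OF \<pi>] by auto
  have invn: "inv \<pi> i < n" if "i < n" for i using \<pi>n[of "inv \<pi> i"] that by (simp add: inv)
  have upd: "(\<lambda>j. ?h j ((x(i := y)) (\<pi> j))) = (\<lambda>j. ?h j (x (\<pi> j)))(inv \<pi> i := ?h (inv \<pi> i) y)" for x i y
    using inv by (auto simp: fun_eq_iff)
  have bound: "norm (?\<Psi> x) \<le> 1 * pnorm x" if x: "tup x" for x
  proof -
    have "norm (?\<Psi> x) \<le> (\<Prod>j<n. lp_norm p (?h j (x (\<pi> j))))"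
      using jt_norm[OF tup[OF x]] by (simp add: pnorm_def)
    also have "\<dots> \<le> (\<Prod>j<n. lp_norm p (x (\<pi> j)))"
      using x \<pi>n by (intro prod_mono) (auto intro!: reindex_op_E c simp: tup_def)
    also have "\<dots> = pnorm x"
      unfolding pnorm_def using prod.permute[OF \<pi>, of "\<lambda>i. lp_norm p (x i)"] by (simp add: o_def)
    finally show ?thesis by simp
  qed
  have add: "?\<Psi> (x(i := y + z)) = ?\<Psi> (x(i := y)) + ?\<Psi> (x(i := z))"
    if "tup x" "i < n" "y \<in> E" "z \<in> E" for x i y z
    unfolding upd reindex_op_add using that invn by (intro jt_add tup reindex_op_E c) auto
  have hom: "?\<Psi> (x(i := fscale a y)) = sc a (?\<Psi> (x(i := y)))"
    if "tup x" "i < n" "y \<in> E" for x i y a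
    unfolding upd reindex_op_fscale using that invn by (intro jt_scale tup reindex_op_E c) auto
  have cong: "?\<Psi> x = ?\<Psi> y" if "\<And>i. i < n \<Longrightarrow> x i = y i" for x y
    using that \<pi>n by (intro jt_cong) auto
  show ?thesis
    by (rule oper_universal[of ?\<Psi> 1])
      (assumption | rule cong add hom bound zero_le_one jt_X[OF tup] | blast)+
qed

lemma tensor_op:
  assumes "\<pi> permutes {..<n}" "\<And>j. j < n \<Longrightarrow> contractive (c j) (\<phi> j)"
  shows "oper 1 (tensor_op \<pi> c \<phi>)"
    "tup x \<Longrightarrow> tensor_op \<pi> c \<phi> (jt x) = jt (\<lambda>j. reindex_op (c j) (\<phi> j) (x (\<pi> j)))"
  using someI_ex[OF tensor_op_exists[of \<pi> c \<phi>, OF assms]] unfolding tensor_op_def by blast+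

lemma tup_reindex:
  assumes \<pi>: "\<pi> permutes {..<n}" and c: "\<And>j. j < n \<Longrightarrow> contractive (c j) (\<phi> j)" and x: "tup x"
  shows "tup (\<lambda>j. reindex_op (c j) (\<phi> j) (x (\<pi> j)))"
  unfolding tup_def using x permutes_in_image[OF \<pi>] by (auto intro!: reindex_op_E c simp: tup_def)

lemma mult_banach: "banach_space_over ((*) :: 'k \<Rightarrow> 'k \<Rightarrow> 'k)"
  by unfold_locales (simp_all add: algebra_simps norm_mult scaleR_conv_of_real)

definition co :: "(nat \<Rightarrow> nat) \<Rightarrow> 'x \<Rightarrow> 'k" where
  "co a = (SOME f. bounded_linear_on sc (*) X 1 f \<and> (\<forall>x. tup x \<longrightarrow> f (jt x) = (\<Prod>i<n. x i (a i))))"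

lemma co_exists: "\<exists>f. bounded_linear_on sc (*) X 1 f \<and> (\<forall>x. tup x \<longrightarrow> f (jt x) = (\<Prod>i<n. x i (a i)))"
proof -
  let ?\<Psi> = "\<lambda>x. \<Prod>i<n. x i (a i)"
  have upd: "?\<Psi> (x(i := y)) = y (a i) * (\<Prod>j\<in>{..<n}-{i}. x j (a j))" if "i < n" for x :: "nat \<Rightarrow> nat \<Rightarrow> 'k" and i y
    using that by (subst prod.remove[of _ i]) auto
  have bound: "norm (?\<Psi> x) \<le> 1 * pnorm x" if "tup x" for x :: "nat \<Rightarrow> nat \<Rightarrow> 'k"
    unfolding pnorm_def using that
    by (auto simp flip: prod_norm intro!: prod_mono norm_le_lp_norm p1 tupD)
  have add: "?\<Psi> (x(i := y + z)) = ?\<Psi> (x(i := y)) + ?\<Psi> (x(i := z))"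
    if "i < n" for x i and y z :: "nat \<Rightarrow> 'k"
    unfolding upd[OF that] by (simp add: algebra_simps)
  have hom: "?\<Psi> (x(i := fscale b y)) = b * (?\<Psi> (x(i := y)))"
    if "i < n" for x i b and y :: "nat \<Rightarrow> 'k"
    unfolding upd[OF that] by (simp add: fscale_def)
  have cong: "?\<Psi> x = ?\<Psi> y" if "\<And>i. i < n \<Longrightarrow> x i = y i" for x y :: "nat \<Rightarrow> nat \<Rightarrow> 'k"
    using that by (intro prod.cong) auto
  show ?thesis
    by (rule jt_universal[of "(*)" ?\<Psi> 1])
      (assumption | rule mult_banach cong add hom bound zero_le_one | blast)+
qed

lemma co_bl: "bounded_linear_on sc (*) X 1 (co a)"
  and co_jt: "tup x \<Longrightarrow> co a (jt x) = (\<Prod>i<n. x i (a i))"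
  using someI_ex[OF co_exists[of a]] unfolding co_def by blast+

lemmas co_add = bl_add[OF co_bl] and co_scale = bl_scale[OF co_bl]
  and co_diff = bl_diff[OF co_bl] and co_sum = bl_sum[OF co_bl]

lemma co_norm: "v \<in> X \<Longrightarrow> norm (co a v) \<le> norm v"
  using bl_norm[OF co_bl] by fastforce

lemma co_cong: "(\<And>i. i < n \<Longrightarrow> a i = b i) \<Longrightarrow> co a = co b"
proof -
  assume "\<And>i. i < n \<Longrightarrow> a i = b i"
  then have "(\<Prod>i<n. x i (a i)) = (\<Prod>i<n. x i (b i))" for x :: "nat \<Rightarrow> nat \<Rightarrow> 'k"
    by (intro prod.cong) auto
  then show ?thesis unfolding co_def by simp
qed

definition e :: "(nat \<Rightarrow> nat) \<Rightarrow> 'x" where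
  "e a = jt (\<lambda>i. unit_seq (a i))"

lemma tup_unit: "tup (\<lambda>i. unit_seq (a i))"
  by (simp add: tup_def unit_seq_lp p1)

lemma e_X: "e a \<in> X"
  unfolding e_def by (rule jt_X[OF tup_unit])

lemma e_cong: "(\<And>i. i < n \<Longrightarrow> a i = b i) \<Longrightarrow> e a = e b"
  unfolding e_def by (rule jt_cong) simp

lemma e_norm: "norm (e a) \<le> 1"
  using jt_norm[OF tup_unit, of a] by (simp add: e_def pnorm_def unit_seq_lp p1)

lemma co_e: "co a (e b) = (if \<forall>i<n. a i = b i then 1 else 0)"
  unfolding e_def co_jt[OF tup_unit] by (auto simp: unit_seq_def intro!: prod.neutral)

lemma tensor_op_e:
  assumes "\<pi> permutes {..<n}" "\<And>j. j < n \<Longrightarrow> contractive (c j) (\<phi> j)"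
    and "\<And>j. j < n \<Longrightarrow> reindex_op (c j) (\<phi> j) (unit_seq (b (\<pi> j))) = unit_seq (a j)"
  shows "tensor_op \<pi> c \<phi> (e b) = e a"
  unfolding e_def using tensor_op(2)[OF assms(1,2) tup_unit] assms(3)
  by (auto intro: jt_cong)

lemma bl_comp:
  assumes "bounded_linear_on sc t X C f" "oper D g"
  shows "bounded_linear_on sc t X (C * D) (\<lambda>v. f (g v))"
  unfolding bounded_linear_on_def linear_map_on_def
proof (intro conjI ballI allI)
  show "norm (f (g v)) \<le> C * D * norm v" if "v \<in> X" for v
  proof -
    have "norm (f (g v)) \<le> C * norm (g v)" using bl_norm[OF assms(1) oper_X[OF assms(2) that]] .
    also have "\<dots> \<le> C * (D * norm v)"
      by (intro mult_left_mono oper_norm[OF assms(2) that] bl_nonneg[OF assms(1)])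
    finally show ?thesis by (simp add: mult.assoc)
  qed
qed (simp_all add: bl_add[OF assms(1)] bl_scale[OF assms(1)] bl_nonneg[OF assms(1)]
      oper_add[OF assms(2)] oper_scale[OF assms(2)] oper_X[OF assms(2)] oper_nonneg[OF assms(2)])

lemma co_tensor_op:
  assumes \<pi>: "\<pi> permutes {..<n}" and c: "\<And>j. j < n \<Longrightarrow> contractive (c j) (\<phi> j)" and v: "v \<in> X"
  shows "co a (tensor_op \<pi> c \<phi> v) = (\<Prod>j<n. c j (a j)) * co (\<lambda>i. \<phi> (inv \<pi> i) (a (inv \<pi> i))) v"
proof -
  let ?d = "\<Prod>j<n. c j (a j)" and ?b = "\<lambda>i. \<phi> (inv \<pi> i) (a (inv \<pi> i))"
  have "bounded_linear_on sc (*) X (norm ?d) (\<lambda>v. ?d * co ?b v)"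
    unfolding bounded_linear_on_def linear_map_on_def
    by (auto simp: co_add co_scale distrib_left mult.left_commute norm_mult intro: mult_left_mono co_norm)
  moreover have "bounded_linear_on sc (*) X (1 * 1) (\<lambda>v. co a (tensor_op \<pi> c \<phi> v))"
    by (rule bl_comp[OF co_bl tensor_op(1)[OF \<pi> c]])
  moreover have "co a (tensor_op \<pi> c \<phi> (jt x)) = ?d * co ?b (jt x)" if x: "tup x" for x
  proof -
    have "co a (tensor_op \<pi> c \<phi> (jt x)) = (\<Prod>j<n. c j (a j) * x (\<pi> j) (\<phi> j (a j)))"
      by (simp add: tensor_op(2)[OF \<pi> c x] co_jt[OF tup_reindex[OF \<pi> c x]]) (simp add: reindex_op_def)
    also have "\<dots> = ?d * (\<Prod>j<n. x (\<pi> j) (\<phi> j (a j)))" by (simp add: prod.distrib)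
    also have "(\<Prod>j<n. x (\<pi> j) (\<phi> j (a j))) = (\<Prod>i<n. x i (?b i))"
      using prod.permute[OF \<pi>, of "\<lambda>i. x i (?b i)"] permutes_inverses[OF \<pi>] by (simp add: o_def)
    finally show ?thesis by (simp add: co_jt[OF x])
  qed
  ultimately show ?thesis using eq_from_jt[OF mult_banach] v by blast
qed

definition box :: "nat \<Rightarrow> (nat \<Rightarrow> nat) set" where
  "box N = {..<n} \<rightarrow>\<^sub>E {..<N}"

lemma finite_box [simp]: "finite (box N)"
  by (simp add: box_def finite_PiE)

definition proj :: "nat \<Rightarrow> 'x \<Rightarrow> 'x" where
  "proj N v = (\<Sum>a\<in>box N. sc (co a v) (e a))"

definition cut :: "nat \<Rightarrow> 'x \<Rightarrow> 'x" where
  "cut N = tensor_op id (\<lambda>_ t. if t < N then 1 else 0) (\<lambda>_ t. t)"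

lemma cut: "oper 1 (cut N)" "tup x \<Longrightarrow> cut N (jt x) = jt (\<lambda>i. lp_head N (x i))"
proof -
  have *: "contractive (\<lambda>t. if t < N then 1 else 0) (\<lambda>t. t)"
    by (auto simp: contractive_def)
  show "oper 1 (cut N)" "tup x \<Longrightarrow> cut N (jt x) = jt (\<lambda>i. lp_head N (x i))"
    unfolding cut_def using tensor_op[OF permutes_id, of "\<lambda>_ t. if t < N then 1 else 0" "\<lambda>_ t. t"] *
    by (simp_all add: reindex_op_def lp_head_def id_def)
qed

lemma jt_head_expand:
  assumes x: "tup x" and i: "i < n" and y: "y \<in> E"
  shows "jt (x(i := lp_head N y)) = (\<Sum>t<N. sc (y t) (jt (x(i := unit_seq t))))"
proof (induction N)
  case 0
  have "lp_head 0 y = (\<lambda>t. 0)" by (simp add: lp_head_def)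
  then show ?case using jt_eq_0[OF tup_upd[OF x lp_head_tail(1)[OF p1 y]] i, of i 0] by (simp del: fun_upd_apply add: fun_upd_same)
next
  case (Suc N)
  have "lp_head (Suc N) y = lp_head N y + fscale (y N) (unit_seq N)"
    by (auto simp: lp_head_def fscale_def unit_seq_def fun_eq_iff)
  then have "jt (x(i := lp_head (Suc N) y)) = jt (x(i := lp_head N y)) + sc (y N) (jt (x(i := unit_seq N)))"
    by (simp only: jt_add[OF x i lp_head_tail(1)[OF p1 y] lp_fscale(1)[OF p1 unit_seq_lp(1)[OF p1]]]
        jt_scale[OF x i unit_seq_lp(1)[OF p1]])
  then show ?case using Suc by (simp only: sum.lessThan_Suc)
qed

lemma cut_expand:
  assumes x: "tup x" and m: "m \<le> n"
  shows "jt (\<lambda>i. if i < m then lp_head N (x i) else x i) =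
    (\<Sum>a\<in>{..<m} \<rightarrow>\<^sub>E {..<N}. sc (\<Prod>i<m. x i (a i)) (jt (\<lambda>i. if i < m then unit_seq (a i) else x i)))"
  using x m
proof (induction m arbitrary: x)
  case 0
  then show ?case by simp
next
  case (Suc m)
  let ?P = "{..<m} \<rightarrow>\<^sub>E {..<N}"
  let ?h = "\<lambda>i. if i < m then lp_head N (x i) else x i"
  let ?u = "\<lambda>a i. if i < Suc m then unit_seq (a i) else x i"
  have mn: "m < n" using Suc.prems by simp
  have xm: "x m \<in> E" using Suc.prems mn by (simp add: tup_def)
  have h: "tup ?h" using Suc.prems by (auto simp: tup_def lp_head_tail p1)
  have step: "jt (?h(m := unit_seq t)) = (\<Sum>a\<in>?P. sc (\<Prod>i<m. x i (a i)) (jt (?u (a(m := t)))))" for t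
  proof -
    have x': "tup (x(m := unit_seq t))" by (rule tup_upd[OF Suc.prems(1)]) (simp add: unit_seq_lp p1)
    have "jt (?h(m := unit_seq t))
        = jt (\<lambda>i. if i < m then lp_head N ((x(m := unit_seq t)) i) else (x(m := unit_seq t)) i)"
      by (rule jt_cong) auto
    also have "\<dots> = (\<Sum>a\<in>?P. sc (\<Prod>i<m. (x(m := unit_seq t)) i (a i))
        (jt (\<lambda>i. if i < m then unit_seq (a i) else (x(m := unit_seq t)) i)))"
      by (rule Suc.IH[OF x']) (use mn in simp)
    also have "\<dots> = (\<Sum>a\<in>?P. sc (\<Prod>i<m. x i (a i)) (jt (?u (a(m := t)))))"
      by (intro sum.cong refl arg_cong2[of _ _ _ _ sc] jt_cong prod.cong) auto
    finally show ?thesis .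
  qed
  have "jt (\<lambda>i. if i < Suc m then lp_head N (x i) else x i) = jt (?h(m := lp_head N (x m)))"
    by (rule jt_cong) auto
  also have "\<dots> = (\<Sum>t<N. sc (x m t) (jt (?h(m := unit_seq t))))"
    by (rule jt_head_expand[OF h mn xm])
  also have "\<dots> = (\<Sum>t<N. \<Sum>a\<in>?P. sc (\<Prod>i<Suc m. x i ((a(m := t)) i)) (jt (?u (a(m := t)))))"
    unfolding step by (simp add: scale_sum_right mult.commute)
  also have "\<dots> = (\<Sum>a\<in>{..<Suc m} \<rightarrow>\<^sub>E {..<N}. sc (\<Prod>i<Suc m. x i (a i)) (jt (?u a)))"
    unfolding lessThan_Suc PiE_insert_eq
    by (subst sum.reindex, rule inj_combinator) (auto simp: sum.cartesian_product case_prod_unfold simp del: prod.insert)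
  finally show ?case .
qed

lemma e_box: "jt (\<lambda>i. if i < n then unit_seq (a i) else x i) = e a"
  unfolding e_def by (rule jt_cong) simp

lemma proj_oper: "oper (\<Sum>a\<in>box N. 1) (proj N)"
  unfolding proj_def
proof (rule oper_sum_fun)
  fix a assume "a \<in> box N"
  show "oper 1 (\<lambda>v. sc (co a v) (e a))"
  proof (rule operI)
    show "norm (sc (co a v) (e a)) \<le> 1 * norm v" if "v \<in> X" for v
      using mult_mono[OF co_norm[OF that, of a] e_norm[of a]] by (simp add: norm_scale)
  qed (auto simp: co_add co_scale scale_left_distrib X_scale e_X)
qed simp

lemma proj_eq_cut:
  assumes v: "v \<in> X"
  shows "proj N v = cut N v"
proof (rule oper_eqI[OF proj_oper cut(1) _ v])
  fix x assume x: "tup x"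
  have "cut N (jt x) = jt (\<lambda>i. if i < n then lp_head N (x i) else x i)"
    unfolding cut(2)[OF x] by (rule jt_cong) simp
  also have "\<dots> = proj N (jt x)"
    unfolding proj_def box_def using cut_expand[OF x order_refl, of N] by (simp add: e_box co_jt[OF x])
  finally show "proj N (jt x) = cut N (jt x)" ..
qed

lemma proj_norm: "v \<in> X \<Longrightarrow> norm (proj N v) \<le> norm v"
  using oper_norm[OF cut(1)] by (simp add: proj_eq_cut)

lemma proj_X: "v \<in> X \<Longrightarrow> proj N v \<in> X"
  using oper_X[OF cut(1)] by (simp add: proj_eq_cut)

lemma proj_jt_tendsto:
  assumes x: "tup x"
  shows "(\<lambda>N. proj N (jt x)) \<longlonglongrightarrow> jt x"
proof -
  have "m \<le> n \<Longrightarrow> (\<lambda>N. jt (\<lambda>i. if i < m then lp_head N (x i) else x i)) \<longlonglongrightarrow> jt x" for m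
  proof (induction m)
    case 0
    then show ?case by simp
  next
    case (Suc m)
    then have m: "m < n" by simp
    have xm: "x m \<in> E" using x m by (simp add: tup_def)
    let ?h = "\<lambda>N i. if i < m then lp_head N (x i) else x i"
    have h: "tup (?h N)" for N using x by (auto simp: tup_def lp_head_tail p1)
    define K where "K = (\<Prod>j\<in>{..<n}-{m}. lp_norm p (x j))"
    have eq: "jt (?h N) - jt (\<lambda>i. if i < Suc m then lp_head N (x i) else x i) = jt ((?h N)(m := lp_tail N (x m)))" for N
    proof -
      have "jt (?h N) = jt ((?h N)(m := lp_head N (x m) + lp_tail N (x m)))"
        by (rule jt_cong) (simp add: lp_head_tail[OF p1 xm])
      also have "\<dots> = jt ((?h N)(m := lp_head N (x m))) + jt ((?h N)(m := lp_tail N (x m)))"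
        by (rule jt_add[OF h m]) (rule lp_head_tail[OF p1 xm])+
      also have "jt ((?h N)(m := lp_head N (x m))) = jt (\<lambda>i. if i < Suc m then lp_head N (x i) else x i)"
        by (rule jt_cong) auto
      finally show ?thesis by (simp only: add_diff_cancel_left')
    qed
    have le: "norm (jt ((?h N)(m := lp_tail N (x m)))) \<le> lp_norm p (lp_tail N (x m)) * K" for N
    proof -
      have "norm (jt ((?h N)(m := lp_tail N (x m)))) \<le> pnorm ((?h N)(m := lp_tail N (x m)))"
        by (rule jt_norm[OF tup_upd[OF h]]) (rule lp_head_tail[OF p1 xm])
      also have "\<dots> \<le> lp_norm p (lp_tail N (x m)) * K"
        unfolding pnorm_upd[OF m] K_def using x
        by (intro mult_left_mono prod_mono) (auto simp: tup_def lp_head_tail p1)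
      finally show ?thesis .
    qed
    have lim: "(\<lambda>N. lp_norm p (lp_tail N (x m)) * K) \<longlonglongrightarrow> 0"
      using tendsto_mult_right[OF lp_tail_tendsto_0[OF p1 xm], of K] by simp
    have "(\<lambda>N. jt (?h N) - jt (\<lambda>i. if i < Suc m then lp_head N (x i) else x i)) \<longlonglongrightarrow> 0"
      unfolding eq by (rule Lim_null_comparison[OF always_eventually lim]) (use le in blast)
    from tendsto_diff[OF Suc.IH this] show ?case using Suc.prems by simp
  qed
  from this[OF order_refl] show ?thesis
    by (simp add: proj_eq_cut[OF jt_X[OF x]] cut(2)[OF x] cong: jt_cong)
qed

lemma proj_approx:
  assumes v: "v \<in> X" and d: "0 < d"
  obtains N where "norm (v - proj N v) < d" "\<And>M. M \<ge> N \<Longrightarrow> norm (v - proj M v) < d"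
proof -
  have d3: "0 < d / 3" using d by simp
  obtain xs where xs: "\<And>x. x \<in> set xs \<Longrightarrow> tup x" "norm (v - (\<Sum>x\<leftarrow>xs. jt x)) < d / 3"
    using jt_approx[OF v less_add_one d3] by metis
  let ?s = "\<Sum>x\<leftarrow>xs. jt x"
  have s: "?s \<in> X" using xs(1) by (intro X_sum_list jt_X)
  have "(\<And>x. x \<in> set ys \<Longrightarrow> tup x) \<Longrightarrow> (\<lambda>N. \<Sum>x\<leftarrow>ys. proj N (jt x)) \<longlonglongrightarrow> (\<Sum>x\<leftarrow>ys. jt x)" for ys
    by (induction ys) (auto intro!: tendsto_add proj_jt_tendsto)
  then have "(\<lambda>N. \<Sum>x\<leftarrow>xs. proj N (jt x)) \<longlonglongrightarrow> ?s" using xs(1) by blast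
  moreover have "(\<Sum>x\<leftarrow>xs. proj N (jt x)) = proj N ?s" for N
    using xs(1) by (intro oper_sum_list[OF proj_oper, symmetric] jt_X)
  ultimately have "(\<lambda>N. proj N ?s) \<longlonglongrightarrow> ?s" by (simp only:)
  from LIMSEQ_D[OF this d3] obtain N where N: "\<And>M. M \<ge> N \<Longrightarrow> norm (proj M ?s - ?s) < d / 3" by blast
  have "norm (v - proj M v) < d" if "M \<ge> N" for M
  proof -
    have "v - proj M v = (v - ?s) - (proj M ?s - ?s) - proj M (v - ?s)"
      using oper_diff[OF proj_oper v s] by simp
    then have "norm (v - proj M v) = norm ((v - ?s) - (proj M ?s - ?s) - proj M (v - ?s))"
      by (simp only:)
    then have "norm (v - proj M v) \<le> norm (v - ?s) + norm (proj M ?s - ?s) + norm (proj M (v - ?s))"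
      using norm_triangle_ineq4[of "(v - ?s) - (proj M ?s - ?s)" "proj M (v - ?s)"]
        norm_triangle_ineq4[of "v - ?s" "proj M ?s - ?s"] by linarith
    then show ?thesis using xs(2) N[OF that] proj_norm[OF X_diff[OF v s], of M] by linarith
  qed
  then show thesis using that by blast
qed

lemma proj_tendsto: "v \<in> X \<Longrightarrow> (\<lambda>N. proj N v) \<longlonglongrightarrow> v"
  by (rule LIMSEQ_I) (metis norm_minus_commute proj_approx)

end

section \<open>Iterated limits along an ultrafilter\<close>

lemma free_ultrafilter_exists:
  "\<exists>F :: nat filter. F \<noteq> bot \<and> F \<le> at_top \<and> (\<forall>P. eventually P F \<or> eventually (\<lambda>x. \<not> P x) F)"
proof -
  define filt where "filt S \<longleftrightarrow> (\<forall>n. {n..} \<in> S) \<and> {} \<notin> S \<and> (\<forall>A\<in>S. \<forall>B\<in>S. A \<inter> B \<in> S)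
    \<and> (\<forall>A\<in>S. \<forall>B. A \<subseteq> B \<longrightarrow> B \<in> S)" for S :: "nat set set"
  have "filt {A. \<exists>n. {n..} \<subseteq> A}"
    unfolding filt_def
  proof (intro conjI ballI allI impI)
    show "A \<inter> B \<in> {A. \<exists>n. {n..} \<subseteq> A}" if "A \<in> {A. \<exists>n. {n..} \<subseteq> A}" "B \<in> {A. \<exists>n. {n..} \<subseteq> A}" for A B :: "nat set"
    proof -
      from that obtain m n where "{m..} \<subseteq> A" "{n..} \<subseteq> B" by auto
      moreover have "{m + n..} \<subseteq> {m..} \<inter> {n..}" by auto
      ultimately have "{m + n..} \<subseteq> A \<inter> B" by blast
      then show ?thesis by blast
    qed
  qed auto
  then have "\<exists>M\<in>Collect filt. \<forall>S\<in>Collect filt. M \<subseteq> S \<longrightarrow> S = M"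
  proof (intro subset_Zorn_nonempty)
    fix \<C> assume ne: "\<C> \<noteq> {}" and chain: "subset.chain (Collect filt) \<C>"
    have f: "filt S" if "S \<in> \<C>" for S using chain that by (auto simp: subset.chain_def)
    show "\<Union>\<C> \<in> Collect filt"
      unfolding mem_Collect_eq filt_def
    proof (intro conjI ballI allI impI)
      show "{n..} \<in> \<Union>\<C>" for n using ne f by (auto simp: filt_def)
      show "{} \<notin> \<Union>\<C>" using f by (auto simp: filt_def)
      show "A \<inter> B \<in> \<Union>\<C>" if AB: "A \<in> \<Union>\<C>" "B \<in> \<Union>\<C>" for A B
      proof -
        obtain S S' where S: "S \<in> \<C>" "A \<in> S" "S' \<in> \<C>" "B \<in> S'" using AB by auto
        then have "S \<subseteq> S' \<or> S' \<subseteq> S" using chain by (auto simp: subset.chain_def)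
        then obtain S where "S \<in> \<C>" "A \<in> S" "B \<in> S" using S by blast
        then show ?thesis using f[of S] unfolding filt_def by blast
      qed
      show "B \<in> \<Union>\<C>" if AB: "A \<in> \<Union>\<C>" "A \<subseteq> B" for A B
      proof -
        obtain S where "S \<in> \<C>" "A \<in> S" using AB by blast
        then show ?thesis using f[of S] AB(2) unfolding filt_def by blast
      qed
    qed
  qed auto
  then obtain M where M: "filt M" and max: "\<And>S. filt S \<Longrightarrow> M \<subseteq> S \<Longrightarrow> S = M" by auto
  note M' = M[unfolded filt_def]
  have ultra: "A \<in> M \<or> - A \<in> M" for A
  proof (rule ccontr)
    assume A: "\<not> (A \<in> M \<or> - A \<in> M)"
    let ?S = "{B. \<exists>C\<in>M. C \<inter> A \<subseteq> B}"
    have "filt ?S"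
      unfolding filt_def
    proof (intro conjI ballI allI impI)
      show "{n..} \<in> ?S" for n using M' by auto
      show "{} \<notin> ?S"
      proof
        assume "{} \<in> ?S"
        then obtain C where "C \<in> M" "C \<subseteq> - A" by auto
        then show False using A M' by blast
      qed
      show "B \<inter> B' \<in> ?S" if BB: "B \<in> ?S" "B' \<in> ?S" for B B'
      proof -
        obtain C C' where "C \<in> M" "C \<inter> A \<subseteq> B" "C' \<in> M" "C' \<inter> A \<subseteq> B'" using BB by auto
        then show ?thesis using M' by (intro CollectI bexI[of _ "C \<inter> C'"]) auto
      qed
    qed auto
    then have "?S = M" by (rule max) auto
    moreover have "A \<in> ?S" using M' by auto
    ultimately show False using A by simp
  qed
  have "is_filter (\<lambda>P. Collect P \<in> M)"
  proof
    show "Collect (\<lambda>x. True) \<in> M" using M' by (metis Collect_cong UNIV_I subset_UNIV UNIV_def)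
    show "Collect (\<lambda>x. P x \<and> Q x) \<in> M" if "Collect P \<in> M" "Collect Q \<in> M" for P Q
      using M' that by (simp add: Collect_conj_eq)
    show "Collect Q \<in> M" if "\<forall>x. P x \<longrightarrow> Q x" "Collect P \<in> M" for P Q
    proof -
      have "Collect P \<subseteq> Collect Q" using that(1) by auto
      then show ?thesis using M' that(2) by blast
    qed
  qed
  note ev = eventually_Abs_filter[OF this]
  let ?F = "Abs_filter (\<lambda>P. Collect P \<in> M)"
  have "?F \<noteq> bot"
    unfolding trivial_limit_def ev using M' by simp
  moreover have "?F \<le> at_top"
    unfolding le_filter_def ev
  proof (intro allI impI)
    fix P :: "nat \<Rightarrow> bool" assume "eventually P at_top"
    then obtain n where "{n..} \<subseteq> Collect P" by (auto simp: eventually_at_top_linorder)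
    then show "Collect P \<in> M" using M' by blast
  qed
  moreover have "eventually P ?F \<or> eventually (\<lambda>x. \<not> P x) ?F" for P
    unfolding ev using ultra[of "Collect P"] by (simp add: Collect_neg_eq)
  ultimately show ?thesis by blast
qed

definition ultra :: "nat filter" where
  "ultra = (SOME F. F \<noteq> bot \<and> F \<le> at_top \<and> (\<forall>P. eventually P F \<or> eventually (\<lambda>x. \<not> P x) F))"

lemma ultra: "ultra \<noteq> bot" "ultra \<le> at_top" "eventually P ultra \<or> eventually (\<lambda>x. \<not> P x) ultra"
  using someI_ex[OF free_ultrafilter_exists] unfolding ultra_def by blast+

lemma eventually_ultra_notin: "finite A \<Longrightarrow> eventually (\<lambda>x. x \<notin> A) ultra"
  by (rule filter_leD[OF ultra(2)])
    (metis eventually_at_top_linorder finite_nat_set_iff_bounded not_less)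

definition ulim :: "(nat \<Rightarrow> 'k::euclidean_space) \<Rightarrow> 'k" where
  "ulim f = Lim ultra f"

lemma ulim_eq: "(f \<longlongrightarrow> l) ultra \<Longrightarrow> ulim f = l"
  unfolding ulim_def by (rule tendsto_Lim[OF ultra(1)])

lemma ulim_const [simp]: "ulim (\<lambda>x. c) = c"
  by (rule ulim_eq) (rule tendsto_const)

lemma ulim_tendsto:
  fixes f :: "nat \<Rightarrow> 'k::euclidean_space"
  assumes "\<And>x. norm (f x) \<le> C"
  shows "(f \<longlongrightarrow> ulim f) ultra"
proof -
  let ?G = "filtermap f ultra"
  have "?G \<noteq> bot" using ultra(1) by (simp add: filtermap_bot_iff)
  moreover have "?G \<le> principal (cball 0 C)"
    by (simp add: le_principal eventually_filtermap assms always_eventually)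
  ultimately obtain l where l: "inf (nhds l) ?G \<noteq> bot"
    using compact_cball[of "0::'k" C] unfolding compact_filter by (auto simp: le_principal)
  have "(f \<longlongrightarrow> l) ultra"
  proof (rule topological_tendstoI)
    fix S assume S: "open S" "l \<in> S"
    show "eventually (\<lambda>x. f x \<in> S) ultra"
    proof (rule ccontr)
      assume "\<not> eventually (\<lambda>x. f x \<in> S) ultra"
      then have "eventually (\<lambda>x. f x \<notin> S) ultra" using ultra(3)[of "\<lambda>x. f x \<in> S"] by simp
      then have "eventually (\<lambda>y. y \<notin> S) ?G" by (simp add: eventually_filtermap)
      moreover have "eventually (\<lambda>y. y \<in> S) (nhds l)" using S by (rule eventually_nhds_in_open)
      ultimately have "eventually (\<lambda>y. False) (inf (nhds l) ?G)"
        unfolding eventually_inf by (intro exI[of _ "\<lambda>y. y \<in> S"] exI[of _ "\<lambda>y. y \<notin> S"]) auto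
      then show False using l by (simp add: trivial_limit_def)
    qed
  qed
  then show ?thesis using ulim_eq by metis
qed

lemma ulim_norm:
  assumes "\<And>x. norm (f x) \<le> C"
  shows "norm (ulim f) \<le> C"
  by (rule Lim_norm_ubound[OF ultra(1) ulim_tendsto[OF assms]]) (simp add: assms always_eventually)

text \<open>\<open>itlim f k d\<close> replaces the values of the argument of \<open>f\<close> at the places \<open>d, \<dots>, d + k - 1\<close>
  by variables and lets these tend to infinity one after the other, the last place first.\<close>

primrec itlim :: "((nat \<Rightarrow> nat) \<Rightarrow> 'k::euclidean_space) \<Rightarrow> nat \<Rightarrow> nat \<Rightarrow> (nat \<Rightarrow> nat) \<Rightarrow> 'k" where
  "itlim f 0 = (\<lambda>d g. f g)"
| "itlim f (Suc k) = (\<lambda>d g. ulim (\<lambda>x. itlim f k (Suc d) (g(d := x))))"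

lemma itlim_norm:
  assumes "\<And>g. norm (f g) \<le> C"
  shows "norm (itlim f k d g) \<le> C"
  by (induction k arbitrary: d g) (auto simp: assms intro!: ulim_norm)

lemma itlim_tendsto:
  assumes "\<And>g. norm (f g) \<le> C"
  shows "((\<lambda>x. itlim f k (Suc d) (g(d := x))) \<longlongrightarrow> itlim f (Suc k) d g) ultra"
  using ulim_tendsto[of "\<lambda>x. itlim f k (Suc d) (g(d := x))", OF itlim_norm[OF assms]] by simp

definition depends_below :: "nat \<Rightarrow> ((nat \<Rightarrow> nat) \<Rightarrow> 'k) \<Rightarrow> bool" where
  "depends_below R f \<longleftrightarrow> (\<forall>g g'. (\<forall>l<R. g l = g' l) \<longrightarrow> f g = f g')"

lemma depends_belowD: "depends_below R f \<Longrightarrow> (\<And>l. l < R \<Longrightarrow> g l = g' l) \<Longrightarrow> f g = f g'"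
  by (auto simp: depends_below_def)

lemma itlim_depends:
  assumes "depends_below R f" "R \<le> d + k" "\<And>l. l < d \<Longrightarrow> g l = g' l"
  shows "itlim f k d g = itlim f k d g'"
  using assms(2,3)
proof (induction k arbitrary: d g g')
  case 0
  then show ?case by (auto intro: depends_belowD[OF assms(1)])
next
  case (Suc k)
  have "itlim f k (Suc d) (g(d := x)) = itlim f k (Suc d) (g'(d := x))" for x
    using Suc.prems by (intro Suc.IH) (auto simp: less_Suc_eq)
  then show ?case by simp
qed

lemma itlim_add:
  assumes f: "depends_below R f" and R: "R \<le> d + k"
  shows "itlim f (k + j) d g = itlim f k d g"
  using R
proof (induction k arbitrary: d g)
  case 0
  have "R \<le> d \<Longrightarrow> itlim f j d g = f g" for j d g
  proof (induction j arbitrary: d g)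
    case (Suc j)
    have "f (g(d := x)) = f g" for x
      using Suc.prems by (intro depends_belowD[OF f]) auto
    then show ?case using Suc.prems by (simp only: itlim.simps Suc.IH le_SucI ulim_const)
  qed simp
  then show ?case using 0 by simp
next
  case (Suc k)
  then show ?case by (simp only: add_Suc add_Suc_right itlim.simps(2))
qed

lemma itlim_eq:
  assumes "depends_below R f" "R \<le> d + k" "R \<le> d + k'"
  shows "itlim f k d g = itlim f k' d g"
  using itlim_add[OF assms(1,2), of "k' - k" g] itlim_add[OF assms(1,3), of "k - k'" g]
  by (cases "k \<le> k'") auto

definition skip :: "nat \<Rightarrow> nat \<Rightarrow> nat" where
  "skip k l = (if l < k then l else Suc l)"

lemma itlim_skip_above:
  assumes "k \<le> d"
  shows "itlim (\<lambda>g. f (g \<circ> skip k)) j (Suc d) g = itlim f j d (g \<circ> skip k)"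
  using assms
proof (induction j arbitrary: d g)
  case (Suc j)
  have "(g(Suc d := x)) \<circ> skip k = (g \<circ> skip k)(d := x)" for x
    using Suc.prems by (auto simp: skip_def fun_eq_iff)
  then show ?case
    using Suc.IH[of "Suc d"] Suc.prems by (simp only: itlim.simps(2) le_SucI)
qed simp

lemma itlim_skip:
  assumes f: "depends_below R f" and "R \<le> d + j" "d \<le> k" "k \<le> d + j"
  shows "itlim (\<lambda>g. f (g \<circ> skip k)) (Suc j) d g = itlim f j d g"
  using assms(2-)
proof (induction j arbitrary: d g)
  case 0
  have "f (g(d := x) \<circ> skip k) = f g" for x
    using 0 by (intro depends_belowD[OF f]) (auto simp: skip_def)
  then show ?case by (simp only: itlim.simps ulim_const)
next
  case (Suc j)
  show ?case
  proof (cases "d = k")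
    case True
    have "itlim f (Suc j) d (g(d := x) \<circ> skip k) = itlim f (Suc j) d g" for x
      using True Suc.prems by (intro itlim_depends[OF f]) (auto simp: skip_def)
    then have "itlim (\<lambda>g. f (g \<circ> skip k)) (Suc j) (Suc d) (g(d := x)) = itlim f (Suc j) d g" for x
      using itlim_skip_above[of k d f "Suc j" "g(d := x)"] True by simp
    then show ?thesis by (subst itlim.simps(2)) (simp only: ulim_const)
  next
    case False
    then have "itlim (\<lambda>g. f (g \<circ> skip k)) (Suc j) (Suc d) (g(d := x)) = itlim f j (Suc d) (g(d := x))" for x
      using Suc.prems by (intro Suc.IH) auto
    then show ?thesis by (subst itlim.simps(2)) (simp only: itlim.simps(2))
  qed
qed

section \<open>Matrices that are invariant under spreading\<close>

type_synonym 'k matr = "(nat \<Rightarrow> nat) \<Rightarrow> (nat \<Rightarrow> nat) \<Rightarrow> 'k"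

definition local_below :: "nat \<Rightarrow> 'k matr \<Rightarrow> bool" where
  "local_below n W \<longleftrightarrow> (\<forall>a a' b b'. (\<forall>i<n. a i = a' i \<and> b i = b' i) \<longrightarrow> W a b = W a' b')"

lemma local_belowD: "local_below n W \<Longrightarrow> (\<And>i. i < n \<Longrightarrow> a i = a' i \<and> b i = b' i) \<Longrightarrow> W a b = W a' b'"
  unfolding local_below_def by blast

definition spreading :: "nat \<Rightarrow> nat \<Rightarrow> 'k matr \<Rightarrow> bool" where
  "spreading n d W \<longleftrightarrow> local_below n W \<and> (\<forall>k\<ge>d. \<forall>a b. W (skip k \<circ> a) (skip k \<circ> b) = W a b)"

lemma spreading_mono: "spreading n d W \<Longrightarrow> d \<le> d' \<Longrightarrow> spreading n d' W"
  by (auto simp: spreading_def)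

definition rank :: "nat set \<Rightarrow> nat \<Rightarrow> nat" where
  "rank U l = card {u \<in> U. u < l}"

lemma rank_mono_image:
  assumes h: "\<And>u v. u \<in> U \<Longrightarrow> v \<in> U \<Longrightarrow> h u < h v \<longleftrightarrow> u < v" and l: "l \<in> U"
  shows "rank (h ` U) (h l) = rank U l"
proof -
  have "inj_on h U" by (rule inj_onI) (metis h less_irrefl nat_neq_iff)
  moreover have "{v \<in> h ` U. v < h l} = h ` {u \<in> U. u < l}" using h l by auto
  ultimately show ?thesis
    unfolding rank_def by (metis (no_types, lifting) card_image inj_on_subset mem_Collect_eq subsetI)
qed

lemma spreading_rank:
  assumes W: "spreading n d W" and U: "finite U" "{..<d} \<subseteq> U" and ab: "\<And>i. i < n \<Longrightarrow> a i \<in> U \<and> b i \<in> U"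
  shows "W a b = W (rank U \<circ> a) (rank U \<circ> b)"
  using U ab
proof (induction "\<Sum>U" arbitrary: U a b rule: less_induct)
  case less
  have loc: "local_below n W" using W by (simp add: spreading_def)
  show ?case
  proof (cases "\<exists>k u. k \<notin> U \<and> u \<in> U \<and> k < u")
    case False
    have "rank U l = l" if "l \<in> U" for l
    proof -
      have "{u \<in> U. u < l} = {..<l}" using False that by auto
      then show ?thesis by (simp add: rank_def)
    qed
    then show ?thesis using less.prems(3) by (intro local_belowD[OF loc]) simp
  next
    case True
    then obtain k u where k: "k \<notin> U" "u \<in> U" "k < u" by blast
    have dk: "d \<le> k" using k less.prems(2) by (meson lessThan_iff not_less subsetD)
    define q where "q l = (if l < k then l else l - 1)" for l
    have skip_q: "skip k (q l) = l" if "l \<in> U" for l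
      using that k by (cases "l = k") (auto simp: skip_def q_def)
    have q_mono: "q l < q m \<longleftrightarrow> l < m" if "l \<in> U" "m \<in> U" for l m
      using that k by (cases "l = k"; cases "m = k") (auto simp: q_def)
    have inj: "inj_on q U" by (rule inj_on_inverseI[of _ "skip k"]) (rule skip_q)
    have "\<Sum>(q ` U) = (\<Sum>l\<in>U. q l)" using sum.reindex[OF inj, of "\<lambda>x. x"] by simp
    also have "\<dots> < (\<Sum>l\<in>U. l)"
    proof (rule sum_strict_mono_ex1)
      show "\<exists>l\<in>U. q l < l" using k by (intro bexI[of _ u]) (auto simp: q_def)
    qed (use less.prems in \<open>auto simp: q_def\<close>)
    finally have lt: "\<Sum>(q ` U) < \<Sum>U" by simp
    have "{..<d} \<subseteq> q ` U"
    proof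
      fix l assume "l \<in> {..<d}"
      then have "l \<in> U" "q l = l" using less.prems(2) dk by (auto simp: q_def)
      then show "l \<in> q ` U" by (metis imageI)
    qed
    then have IH: "W (q \<circ> a) (q \<circ> b) = W (rank (q ` U) \<circ> (q \<circ> a)) (rank (q ` U) \<circ> (q \<circ> b))"
      using less.prems by (intro less.hyps[OF lt]) auto
    have "W a b = W (skip k \<circ> (q \<circ> a)) (skip k \<circ> (q \<circ> b))"
      using less.prems(3) skip_q by (intro local_belowD[OF loc]) simp
    also have "\<dots> = W (q \<circ> a) (q \<circ> b)"
      using W dk by (auto simp: spreading_def)
    also have "\<dots> = W (rank U \<circ> a) (rank U \<circ> b)"
      unfolding IH using less.prems(3) rank_mono_image[of U q] q_mono by (intro local_belowD[OF loc]) simp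
    finally show ?thesis .
  qed
qed

lemma spreading_image:
  assumes W: "spreading n 0 W" and U: "finite U" and ab: "\<And>i. i < n \<Longrightarrow> a i \<in> U \<and> b i \<in> U"
    and h: "\<And>u v. u \<in> U \<Longrightarrow> v \<in> U \<Longrightarrow> h u < h v \<longleftrightarrow> u < v"
  shows "W (h \<circ> a) (h \<circ> b) = W a b"
proof -
  have loc: "local_below n W" using W by (simp add: spreading_def)
  have "W (h \<circ> a) (h \<circ> b) = W (rank (h ` U) \<circ> (h \<circ> a)) (rank (h ` U) \<circ> (h \<circ> b))"
    by (rule spreading_rank[OF W]) (use U ab in auto)
  also have "\<dots> = W (rank U \<circ> a) (rank U \<circ> b)"
    using ab rank_mono_image[of U h] h by (intro local_belowD[OF loc]) simp
  also have "\<dots> = W a b"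
    by (rule spreading_rank[OF W, symmetric]) (use U ab in auto)
  finally show ?thesis .
qed

lemma spreading_eq_0:
  fixes W :: "'k::zero matr"
  assumes W: "spreading n d W"
    and 0: "\<And>a b. a \<in> {..<n} \<rightarrow>\<^sub>E {..<d + 2*n} \<Longrightarrow> b \<in> {..<n} \<rightarrow>\<^sub>E {..<d + 2*n} \<Longrightarrow> W a b = 0"
  shows "W a b = 0"
proof -
  have loc: "local_below n W" using W by (simp add: spreading_def)
  let ?U = "{..<d} \<union> a ` {..<n} \<union> b ` {..<n}"
  have "card ?U \<le> card {..<d} + card (a ` {..<n}) + card (b ` {..<n})"
    by (meson add_mono card_Un_le order_refl order_trans)
  also have "\<dots> \<le> d + 2 * n"
    using card_image_le[of "{..<n}" a] card_image_le[of "{..<n}" b] by simp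
  finally have U: "card ?U \<le> d + 2*n" .
  have "rank ?U l < card ?U" if "l \<in> ?U" for l
  proof -
    have "{u \<in> ?U. u < l} \<subset> ?U" using that by blast
    then show ?thesis unfolding rank_def by (intro psubset_card_mono) simp_all
  qed
  then have r: "rank ?U l < d + 2*n" if "l \<in> ?U" for l using U that by (meson less_le_trans)
  have "W a b = W (rank ?U \<circ> a) (rank ?U \<circ> b)"
    by (rule spreading_rank[OF W]) auto
  also have "\<dots> = W (restrict (rank ?U \<circ> a) {..<n}) (restrict (rank ?U \<circ> b) {..<n})"
    by (rule local_belowD[OF loc]) simp
  also have "\<dots> = 0" using r by (intro 0) auto
  finally show ?thesis .
qed

lemma finite_determined_bound:
  fixes V :: "('i \<Rightarrow> 'k::real_normed_field) set" and q :: "real \<Rightarrow> ('i \<Rightarrow> 'k) \<Rightarrow> bool"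
  assumes "finite \<Theta>"
    and V: "\<And>v w c. v \<in> V \<Longrightarrow> w \<in> V \<Longrightarrow> (\<lambda>i. v i + c * w i) \<in> V"
    and q: "\<And>v. v \<in> V \<Longrightarrow> \<exists>C\<ge>0. q C v"
    and q_comb: "\<And>v w c C D. q C v \<Longrightarrow> q D w \<Longrightarrow> q (C + norm c * D) (\<lambda>i. v i + c * w i)"
    and q_mono: "\<And>v C D. q C v \<Longrightarrow> C \<le> D \<Longrightarrow> q D v"
    and q_0: "\<And>v. v \<in> V \<Longrightarrow> (\<And>\<theta>. \<theta> \<in> \<Theta> \<Longrightarrow> v \<theta> = 0) \<Longrightarrow> q 0 v"
  shows "\<exists>K\<ge>0. \<forall>v\<in>V. q (K * (\<Sum>\<theta>\<in>\<Theta>. norm (v \<theta>))) v"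
  using assms(1) V q q_0
proof (induction \<Theta> arbitrary: V rule: finite_induct)
  case empty
  then show ?case by (intro exI[of _ 0]) auto
next
  case (insert \<theta>0 \<Theta>)
  show ?case
  proof (cases "\<forall>v\<in>V. v \<theta>0 = 0")
    case True
    have "\<exists>K\<ge>0. \<forall>v\<in>V. q (K * (\<Sum>\<theta>\<in>\<Theta>. norm (v \<theta>))) v"
    proof (rule insert.IH)
      show "q 0 v" if "v \<in> V" "\<And>\<theta>. \<theta> \<in> \<Theta> \<Longrightarrow> v \<theta> = 0" for v
        using that True by (intro insert.prems(3)) blast+
    qed (use insert.prems in blast)+
    then obtain K where "0 \<le> K" "\<forall>v\<in>V. q (K * (\<Sum>\<theta>\<in>\<Theta>. norm (v \<theta>))) v" by blast
    moreover have "(\<Sum>\<theta>\<in>insert \<theta>0 \<Theta>. norm (v \<theta>)) = (\<Sum>\<theta>\<in>\<Theta>. norm (v \<theta>))" if "v \<in> V" for v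
      using True insert.hyps that by simp
    ultimately show ?thesis by auto
  next
    case False
    then obtain b where b: "b \<in> V" "b \<theta>0 \<noteq> 0" by auto
    obtain B where B: "0 \<le> B" "q B b" using insert.prems(2)[OF b(1)] by auto
    let ?V = "{v \<in> V. v \<theta>0 = 0}"
    have "\<exists>K\<ge>0. \<forall>v\<in>?V. q (K * (\<Sum>\<theta>\<in>\<Theta>. norm (v \<theta>))) v"
    proof (rule insert.IH)
      show "q 0 v" if "v \<in> ?V" "\<And>\<theta>. \<theta> \<in> \<Theta> \<Longrightarrow> v \<theta> = 0" for v
        using that by (intro insert.prems(3)) blast+
    qed (use insert.prems(1,2) in auto)
    then obtain K where K: "0 \<le> K" "\<And>v. v \<in> ?V \<Longrightarrow> q (K * (\<Sum>\<theta>\<in>\<Theta>. norm (v \<theta>))) v" by auto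
    define L where "L = (K * (\<Sum>\<theta>\<in>\<Theta>. norm (b \<theta>)) + B) / norm (b \<theta>0)"
    have L: "0 \<le> L" using K(1) B(1) by (simp add: L_def sum_nonneg)
    show ?thesis
    proof (intro exI[of _ "K + L"] conjI ballI)
      show "0 \<le> K + L" using K L by simp
      fix v assume v: "v \<in> V"
      define c where "c = v \<theta>0 / b \<theta>0"
      define w where "w = (\<lambda>i. v i + (- c) * b i)"
      have w: "w \<in> ?V" using insert.prems(1)[OF v b(1), of "- c"] b(2) by (auto simp: w_def c_def)
      have v_eq: "v = (\<lambda>i. w i + c * b i)" by (auto simp: w_def)
      have "q (K * (\<Sum>\<theta>\<in>\<Theta>. norm (w \<theta>)) + norm c * B) v"
        using q_comb[OF K(2)[OF w] B(2), of c] unfolding v_eq[symmetric] .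
      moreover have "K * (\<Sum>\<theta>\<in>\<Theta>. norm (w \<theta>)) + norm c * B \<le> (K + L) * (\<Sum>\<theta>\<in>insert \<theta>0 \<Theta>. norm (v \<theta>))"
      proof -
        have "(\<Sum>\<theta>\<in>\<Theta>. norm (w \<theta>)) \<le> (\<Sum>\<theta>\<in>\<Theta>. norm (v \<theta>) + norm c * norm (b \<theta>))"
        proof (rule sum_mono)
          show "norm (w \<theta>) \<le> norm (v \<theta>) + norm c * norm (b \<theta>)" for \<theta>
            using norm_triangle_ineq4[of "v \<theta>" "c * b \<theta>"] by (simp add: w_def norm_mult)
        qed
        then have "K * (\<Sum>\<theta>\<in>\<Theta>. norm (w \<theta>)) \<le> K * (\<Sum>\<theta>\<in>\<Theta>. norm (v \<theta>) + norm c * norm (b \<theta>))"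
          using K(1) by (rule mult_left_mono)
        then have "K * (\<Sum>\<theta>\<in>\<Theta>. norm (w \<theta>)) + norm c * B
            \<le> K * (\<Sum>\<theta>\<in>\<Theta>. norm (v \<theta>)) + norm c * (K * (\<Sum>\<theta>\<in>\<Theta>. norm (b \<theta>)) + B)"
          by (simp add: sum.distrib sum_distrib_left algebra_simps)
        also have "norm c * (K * (\<Sum>\<theta>\<in>\<Theta>. norm (b \<theta>)) + B) = L * norm (v \<theta>0)"
          using b(2) by (simp add: L_def c_def norm_divide)
        also have "K * (\<Sum>\<theta>\<in>\<Theta>. norm (v \<theta>)) + L * norm (v \<theta>0) \<le> (K + L) * (\<Sum>\<theta>\<in>insert \<theta>0 \<Theta>. norm (v \<theta>))"
          using insert.hyps K(1) L by (simp add: algebra_simps add_nonneg_nonneg sum_nonneg)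
        finally show ?thesis .
      qed
      ultimately show "q ((K + L) * (\<Sum>\<theta>\<in>insert \<theta>0 \<Theta>. norm (v \<theta>))) v" by (rule q_mono)
    qed
  qed
qed

text \<open>\<open>spread n M d g a b\<close> is the entry of \<open>M\<close> at the labels \<open>g (a i)\<close>, \<open>g (b i)\<close> after all labels
  from \<open>d\<close> on have been sent to infinity, larger ones first.\<close>

definition spread :: "nat \<Rightarrow> 'k::euclidean_space matr \<Rightarrow> nat \<Rightarrow> (nat \<Rightarrow> nat) \<Rightarrow> 'k matr" where
  "spread n M d g a b = itlim (\<lambda>g. M (g \<circ> a) (g \<circ> b)) (Suc (\<Sum>i<n. a i + b i)) d g"

context
  fixes n :: nat and M :: "'k::euclidean_space matr" and C :: real
  assumes loc: "local_below n M" and bound: "\<And>a b. norm (M a b) \<le> C"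
begin

lemma depends_labels:
  assumes "\<And>i. i < n \<Longrightarrow> a i < R \<and> b i < R"
  shows "depends_below R (\<lambda>g. M (g \<circ> a) (g \<circ> b))"
  unfolding depends_below_def using assms by (auto intro!: local_belowD[OF loc])

lemma labels_less: "i < n \<Longrightarrow> a i < Suc (\<Sum>i<n. a i + b i) \<and> b i < Suc (\<Sum>i<n. a i + b i)"
  using member_le_sum[of i "{..<n}" "\<lambda>i. a i + b i"] by (auto simp: less_Suc_eq_le)

lemma labels_less_add:
  assumes "i < n"
  shows "a i < d + (Suc (\<Sum>i<n. a i + b i) + j) \<and> b i < d + (Suc (\<Sum>i<n. a i + b i) + j)"
  using labels_less[OF assms, of a b] by linarith

lemma spread_eq:
  assumes "\<And>i. i < n \<Longrightarrow> a i < d + k \<and> b i < d + k"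
  shows "spread n M d g a b = itlim (\<lambda>g. M (g \<circ> a) (g \<circ> b)) k d g"
proof -
  let ?m = "Suc (\<Sum>i<n. a i + b i)"
  have "depends_below (min ?m (d + k)) (\<lambda>g. M (g \<circ> a) (g \<circ> b))"
    by (rule depends_labels) (use labels_less assms in auto)
  then show ?thesis unfolding spread_def by (rule itlim_eq) auto
qed

lemma spread_full:
  assumes "\<And>i. i < n \<Longrightarrow> a i < d \<and> b i < d"
  shows "spread n M d g a b = M (g \<circ> a) (g \<circ> b)"
  using spread_eq[of a d 0 b g] assms by simp

lemma spread_tendsto: "((\<lambda>x. spread n M (Suc d) (g(d := x)) a b) \<longlongrightarrow> spread n M d g a b) ultra"
proof -
  let ?m = "Suc (\<Sum>i<n. a i + b i)"
  have "spread n M (Suc d) g a b = itlim (\<lambda>g. M (g \<circ> a) (g \<circ> b)) ?m (Suc d) g" for g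
    by (simp add: spread_def)
  moreover have "spread n M d g a b = itlim (\<lambda>g. M (g \<circ> a) (g \<circ> b)) (Suc ?m) d g"
    by (rule spread_eq) (use labels_less_add[of _ a d b 1] in simp)
  ultimately show ?thesis using itlim_tendsto[of "\<lambda>g. M (g \<circ> a) (g \<circ> b)" C ?m d g] bound by simp
qed

lemma spread_depends:
  assumes "\<And>l. l < d \<Longrightarrow> g l = g' l"
  shows "spread n M d g = spread n M d g'"
proof (intro ext)
  fix a b
  show "spread n M d g a b = spread n M d g' a b"
    unfolding spread_def
    by (rule itlim_depends[OF depends_labels]) (use labels_less assms in \<open>blast, auto\<close>)
qed

lemma spread_spreading: "spreading n d (spread n M d g)"
  unfolding spreading_def
proof (intro conjI allI impI)
  show "local_below n (spread n M d g)"
    unfolding local_below_def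
  proof (intro allI impI)
    fix a a' b b' :: "nat \<Rightarrow> nat" assume eq: "\<forall>i<n. a i = a' i \<and> b i = b' i"
    have "M (g \<circ> a) (g \<circ> b) = M (g \<circ> a') (g \<circ> b')" for g
      using eq by (intro local_belowD[OF loc]) simp
    then show "spread n M d g a b = spread n M d g a' b'"
      unfolding spread_def using eq by simp
  qed
  fix k :: nat and a b :: "nat \<Rightarrow> nat" assume k: "d \<le> k"
  let ?j = "Suc (\<Sum>i<n. a i + b i) + k" and ?f = "\<lambda>g :: nat \<Rightarrow> nat. M (g \<circ> a) (g \<circ> b)"
  have "spread n M d g (skip k \<circ> a) (skip k \<circ> b)
      = itlim (\<lambda>g. M (g \<circ> (skip k \<circ> a)) (g \<circ> (skip k \<circ> b))) (Suc ?j) d g"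
  proof (rule spread_eq)
    fix i assume "i < n"
    from labels_less_add[OF this, of a d b k]
    show "(skip k \<circ> a) i < d + Suc ?j \<and> (skip k \<circ> b) i < d + Suc ?j"
      by (auto simp: skip_def)
  qed
  also have "\<dots> = itlim (\<lambda>g. ?f (g \<circ> skip k)) (Suc ?j) d g"
    by (simp add: comp_assoc)
  also have "\<dots> = itlim ?f ?j d g"
    by (rule itlim_skip[OF depends_labels]) (use labels_less[of _ a b] k in \<open>blast, auto\<close>)
  also have "\<dots> = spread n M d g a b"
    by (rule spread_eq[symmetric]) (rule labels_less_add)
  finally show "spread n M d g (skip k \<circ> a) (skip k \<circ> b) = spread n M d g a b" .
qed

end

section \<open>Stabilising an operator on a subtensor product\<close>

context lp_tensor
begin

definition sec :: "nat \<Rightarrow> 'k matr \<Rightarrow> 'x \<Rightarrow> 'x" where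
  "sec N W v = (\<Sum>a\<in>box N. \<Sum>b\<in>box N. sc (W a b * co b v) (e a))"

definition bnd :: "real \<Rightarrow> 'k matr \<Rightarrow> bool" where
  "bnd C W \<longleftrightarrow> (\<forall>N. \<forall>v\<in>X. norm (sec N W v) \<le> C * norm v)"

lemma bndD: "bnd C W \<Longrightarrow> v \<in> X \<Longrightarrow> norm (sec N W v) \<le> C * norm v"
  by (simp add: bnd_def)

lemma sec_comb: "sec N (\<lambda>a b. W a b + c * W' a b) v = sec N W v + sc c (sec N W' v)"
  by (simp add: sec_def scale_sum_right sum.distrib scale_left_distrib algebra_simps)

lemma sec_cong: "(\<And>a b. a \<in> box N \<Longrightarrow> b \<in> box N \<Longrightarrow> W a b = W' a b) \<Longrightarrow> sec N W v = sec N W' v"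
  unfolding sec_def by (intro sum.cong refl) auto

lemma bnd_comb:
  assumes "bnd C W" "bnd D W'"
  shows "bnd (C + norm c * D) (\<lambda>a b. W a b + c * W' a b)"
  unfolding bnd_def sec_comb
proof (intro allI ballI)
  fix N v assume v: "v \<in> X"
  have "norm (sec N W v + sc c (sec N W' v)) \<le> norm (sec N W v) + norm c * norm (sec N W' v)"
    using norm_triangle_ineq[of "sec N W v" "sc c (sec N W' v)"] by (simp add: norm_scale)
  also have "\<dots> \<le> C * norm v + norm c * (D * norm v)"
    by (intro add_mono mult_left_mono bndD assms v) auto
  finally show "norm (sec N W v + sc c (sec N W' v)) \<le> (C + norm c * D) * norm v"
    by (simp add: algebra_simps)
qed

lemma bnd_mono: "bnd C W \<Longrightarrow> C \<le> D \<Longrightarrow> bnd D W"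
  unfolding bnd_def by (meson mult_right_mono norm_ge_zero order_trans)

lemma bnd_0: "(\<And>a b. W a b = 0) \<Longrightarrow> bnd 0 W"
  by (simp add: bnd_def sec_def)

definition mat :: "('x \<Rightarrow> 'x) \<Rightarrow> 'k matr" where
  "mat T a b = co a (T (e b))"

lemma mat_local: "local_below n (mat T)"
  unfolding local_below_def mat_def by (metis co_cong e_cong)

lemma mat_norm:
  assumes T: "oper C T"
  shows "norm (mat T a b) \<le> C"
proof -
  have "norm (mat T a b) \<le> norm (T (e b))"
    unfolding mat_def by (rule co_norm[OF oper_X[OF T e_X]])
  also have "\<dots> \<le> C * norm (e b)" by (rule oper_norm[OF T e_X])
  also have "\<dots> \<le> C" using oper_nonneg[OF T] e_norm[of b] by (simp add: mult_left_le)
  finally show ?thesis .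
qed

definition emb :: "nat set \<Rightarrow> (nat \<Rightarrow> nat) \<Rightarrow> 'x \<Rightarrow> 'x" where
  "emb A g = tensor_op id (\<lambda>_ t. if t \<in> g ` A then 1 else 0) (\<lambda>_. inv_into A g)"

definition res :: "nat set \<Rightarrow> (nat \<Rightarrow> nat) \<Rightarrow> 'x \<Rightarrow> 'x" where
  "res A g = tensor_op id (\<lambda>_ t. if t \<in> A then 1 else 0) (\<lambda>_. g)"

lemma contractive_emb: "contractive (\<lambda>t. if t \<in> g ` A then 1 else 0) (inv_into A g)"
  by (auto simp: contractive_def intro: inj_on_inv_into)

lemma contractive_res: "inj_on g A \<Longrightarrow> contractive (\<lambda>t. if t \<in> A then 1 else 0) g"
  by (auto simp: contractive_def)

lemma emb_oper: "oper 1 (emb A g)"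
  unfolding emb_def by (rule tensor_op(1)[OF permutes_id contractive_emb])

lemma res_oper: "inj_on g A \<Longrightarrow> oper 1 (res A g)"
  unfolding res_def by (rule tensor_op(1)[OF permutes_id contractive_res])

lemma reindex_emb_unit:
  assumes "inj_on g A" "m \<in> A"
  shows "reindex_op (\<lambda>t. if t \<in> g ` A then 1 else 0) (inv_into A g) (unit_seq m) = unit_seq (g m)"
  using assms by (auto simp: reindex_op_def unit_seq_def fun_eq_iff)

lemma emb_e:
  assumes "inj_on g A" "\<And>i. i < n \<Longrightarrow> b i \<in> A"
  shows "emb A g (e b) = e (g \<circ> b)"
  unfolding emb_def
  by (rule tensor_op_e[OF permutes_id contractive_emb]) (use assms reindex_emb_unit in auto)

lemma co_res:
  assumes "inj_on g A" "\<And>i. i < n \<Longrightarrow> a i \<in> A" "v \<in> X"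
  shows "co a (res A g v) = co (g \<circ> a) v"
  unfolding res_def
  by (subst co_tensor_op[OF permutes_id contractive_res[OF assms(1)] assms(3)])
    (use assms in \<open>simp add: inv_id o_def\<close>)

lemma boxD: "a \<in> box N \<Longrightarrow> i < n \<Longrightarrow> a i < N"
  by (auto simp: box_def)

lemma box_restrict: "(\<And>i. i < n \<Longrightarrow> a i < N) \<Longrightarrow> restrict a {..<n} \<in> box N"
  by (auto simp: box_def)

lemma sec_mat:
  assumes g: "inj_on g {..<N}" and T: "oper C T" and v: "v \<in> X"
  shows "sec N (\<lambda>a b. mat T (g \<circ> a) (g \<circ> b)) v
    = proj N (res {..<N} g (T (emb {..<N} g (proj N v))))"
proof -
  have "emb {..<N} g (proj N v) = (\<Sum>b\<in>box N. sc (co b v) (e (g \<circ> b)))"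
    unfolding proj_def
    by (subst oper_sum[OF emb_oper])
      (auto simp: oper_scale[OF emb_oper] X_scale e_X emb_e[OF g] boxD intro!: sum.cong)
  then have Te: "T (emb {..<N} g (proj N v)) = (\<Sum>b\<in>box N. sc (co b v) (T (e (g \<circ> b))))"
    by (simp add: oper_sum[OF T] X_scale e_X oper_scale[OF T])
  have "co a (res {..<N} g (T (emb {..<N} g (proj N v)))) = (\<Sum>b\<in>box N. mat T (g \<circ> a) (g \<circ> b) * co b v)"
    if a: "a \<in> box N" for a
    unfolding Te using a
    by (subst co_res[OF g])
      (auto simp: boxD co_sum X_scale X_sum oper_X[OF T] e_X co_scale mat_def mult.commute)
  then show ?thesis
    unfolding sec_def proj_def[of N "res _ _ _"] by (simp add: scale_sum_left cong: sum.cong)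
qed

lemma sec_mat_norm:
  assumes g: "inj_on g {..<N}" and T: "oper C T" and v: "v \<in> X"
  shows "norm (sec N (\<lambda>a b. mat T (g \<circ> a) (g \<circ> b)) v) \<le> C * norm v"
proof -
  have pv: "proj N v \<in> X" by (rule proj_X[OF v])
  note X1 = oper_X[OF emb_oper pv, of "{..<N}" g]
  note X2 = oper_X[OF T X1]
  have "norm (sec N (\<lambda>a b. mat T (g \<circ> a) (g \<circ> b)) v) \<le> norm (res {..<N} g (T (emb {..<N} g (proj N v))))"
    unfolding sec_mat[OF g T v] by (rule proj_norm[OF oper_X[OF res_oper[OF g] X2]])
  also have "\<dots> \<le> norm (T (emb {..<N} g (proj N v)))"
    using oper_norm[OF res_oper[OF g] X2] by simp
  also have "\<dots> \<le> C * norm (emb {..<N} g (proj N v))" by (rule oper_norm[OF T X1])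
  also have "\<dots> \<le> C * norm v"
    using oper_norm[OF emb_oper pv, of "{..<N}" g] proj_norm[OF v, of N]
    by (intro mult_left_mono oper_nonneg[OF T]) auto
  finally show ?thesis .
qed

lemma inj_on_upd:
  assumes "inj_on g {..<d::nat}" "x \<notin> g ` {..<d}"
  shows "inj_on (g(d := x)) {..<Suc d}"
  using assms by (auto simp: inj_on_def less_Suc_eq)

lemma eventually_inj_upd:
  assumes "inj_on g {..<d::nat}"
  shows "eventually (\<lambda>x. inj_on (g(d := x)) {..<Suc d}) ultra"
  using eventually_ultra_notin[of "g ` {..<d}"] by (rule eventually_mono) (auto intro!: inj_on_upd assms)

lemma sec_tendsto:
  assumes "\<And>a b. ((\<lambda>x. W x a b) \<longlongrightarrow> W' a b) F"
  shows "((\<lambda>x. sec N (W x) v) \<longlongrightarrow> sec N W' v) F"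
proof -
  have *: "((\<lambda>x. sc (c x) w) \<longlongrightarrow> sc c' w) F" if "(c \<longlongrightarrow> c') F" for c c' w
  proof -
    have "((\<lambda>x. norm (c x - c') * norm w) \<longlongrightarrow> 0 * norm w) F"
      using that by (intro tendsto_intros) (simp add: tendsto_norm_zero_iff LIM_zero_iff)
    then have "((\<lambda>x. sc (c x) w - sc c' w) \<longlongrightarrow> 0) F"
      by (simp add: tendsto_norm_zero_iff flip: norm_scale scale_left_diff_distrib)
    then show ?thesis by (simp add: LIM_zero_iff)
  qed
  show ?thesis unfolding sec_def
    by (intro tendsto_sum * tendsto_mult assms tendsto_const)
qed

lemma sec_spread_norm:
  assumes T: "oper C T" and v: "v \<in> X"
  shows "inj_on g {..<d} \<Longrightarrow> norm (sec N (spread n (mat T) d g) v) \<le> C * norm v"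
proof (induction "N - d" arbitrary: d g)
  case 0
  have "sec N (spread n (mat T) d g) v = sec N (\<lambda>a b. mat T (g \<circ> a) (g \<circ> b)) v"
  proof (rule sec_cong)
    fix a b assume ab: "a \<in> box N" "b \<in> box N"
    have "a i < d \<and> b i < d" if "i < n" for i
      using boxD[OF ab(1) that] boxD[OF ab(2) that] 0(1) by simp
    then show "spread n (mat T) d g a b = mat T (g \<circ> a) (g \<circ> b)"
      by (rule spread_full[OF mat_local mat_norm[OF T]])
  qed
  moreover have "inj_on g {..<N}" using 0 by (auto intro: inj_on_subset)
  ultimately show ?case using sec_mat_norm[OF _ T v] by simp
next
  case (Suc k)
  have "((\<lambda>x. sec N (spread n (mat T) (Suc d) (g(d := x))) v) \<longlongrightarrow> sec N (spread n (mat T) d g) v) ultra"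
    by (rule sec_tendsto) (rule spread_tendsto[OF mat_local mat_norm[OF T]])
  moreover have "eventually (\<lambda>x. norm (sec N (spread n (mat T) (Suc d) (g(d := x))) v) \<le> C * norm v) ultra"
    using eventually_inj_upd[OF Suc.prems]
  proof eventually_elim
    case (elim x)
    show ?case by (rule Suc.hyps(1)[OF _ elim]) (use Suc.hyps(2) in simp)
  qed
  ultimately show ?case by (intro Lim_norm_ubound[OF ultra(1)])
qed

lemma bnd_spread: "oper C T \<Longrightarrow> inj_on g {..<d} \<Longrightarrow> bnd C (spread n (mat T) d g)"
  unfolding bnd_def using sec_spread_norm by blast

lemma spreading_comb:
  fixes W W' :: "'k matr"
  shows "spreading n d W \<Longrightarrow> spreading n d W' \<Longrightarrow> spreading n d (\<lambda>a b. W a b + c * W' a b)"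
  unfolding spreading_def local_below_def by metis

text \<open>The matrices \<open>D x\<close> below belong to a space on which finitely many entries control the norm,
  and these entries tend to zero along the ultrafilter.\<close>

lemma stabilise_step:
  assumes T: "oper C T" and g: "inj_on g {..<d}" and \<delta>: "0 < \<delta>"
  obtains x where "x \<notin> g ` {..<d}"
    "bnd \<delta> (\<lambda>a b. spread n (mat T) (Suc d) (g(d := x)) a b - spread n (mat T) d g a b)"
proof -
  define V where "V = {v :: (nat \<Rightarrow> nat) \<times> (nat \<Rightarrow> nat) \<Rightarrow> 'k.
    spreading n (Suc d) (\<lambda>a b. v (a, b)) \<and> (\<exists>C\<ge>0. bnd C (\<lambda>a b. v (a, b)))}"
  define L where "L = {..<n} \<rightarrow>\<^sub>E {..<Suc d + 2 * n}"
  have L: "finite L" by (simp add: L_def finite_PiE)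
  have "\<exists>K\<ge>0. \<forall>v\<in>V. bnd (K * (\<Sum>\<theta>\<in>L\<times>L. norm (v \<theta>))) (\<lambda>a b. v (a, b))"
  proof (rule finite_determined_bound[where q = "\<lambda>C v. bnd C (\<lambda>a b. v (a, b))"])
    show "finite (L \<times> L)" using L by simp
    show "(\<lambda>i. v i + c * w i) \<in> V" if vw: "v \<in> V" "w \<in> V" for v w c
    proof -
      obtain A B where "0 \<le> A" "bnd A (\<lambda>a b. v (a, b))" "0 \<le> B" "bnd B (\<lambda>a b. w (a, b))"
        using vw by (auto simp: V_def)
      then have "0 \<le> A + norm c * B" "bnd (A + norm c * B) (\<lambda>a b. v (a, b) + c * w (a, b))"
        by (simp, intro bnd_comb)
      moreover have "spreading n (Suc d) (\<lambda>a b. v (a, b) + c * w (a, b))"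
        using vw by (intro spreading_comb) (simp_all add: V_def)
      ultimately show ?thesis unfolding V_def by blast
    qed
    show "bnd 0 (\<lambda>a b. v (a, b))" if "v \<in> V" "\<And>\<theta>. \<theta> \<in> L \<times> L \<Longrightarrow> v \<theta> = 0" for v
      using that spreading_eq_0[of n "Suc d" "\<lambda>a b. v (a, b)"] by (intro bnd_0) (auto simp: V_def L_def)
  next
    show "\<exists>C\<ge>0. bnd C (\<lambda>a b. v (a, b))" if "v \<in> V" for v using that by (simp add: V_def)
  qed (rule bnd_comb bnd_mono; assumption)+
  then obtain K where K: "0 \<le> K"
    "\<And>v. v \<in> V \<Longrightarrow> bnd (K * (\<Sum>\<theta>\<in>L\<times>L. norm (v \<theta>))) (\<lambda>a b. v (a, b))" by blast
  define D where "D x = (\<lambda>(a, b). spread n (mat T) (Suc d) (g(d := x)) a b + (-1) * spread n (mat T) d g a b)" for x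
  have D_V: "D x \<in> V" if x: "x \<notin> g ` {..<d}" for x
  proof -
    have "spreading n (Suc d) (\<lambda>a b. D x (a, b))"
      unfolding D_def prod.case
      by (intro spreading_comb spread_spreading[OF mat_local mat_norm[OF T]]
          spreading_mono[OF spread_spreading[OF mat_local mat_norm[OF T]]]) simp
    moreover have "bnd (C + norm (-1 :: 'k) * C) (\<lambda>a b. D x (a, b))"
      unfolding D_def prod.case
      by (intro bnd_comb bnd_spread[OF T] inj_on_upd g x)
    moreover have "0 \<le> C + norm (-1 :: 'k) * C" using oper_nonneg[OF T] by simp
    ultimately show ?thesis unfolding V_def by blast
  qed
  have "((\<lambda>x. K * (\<Sum>\<theta>\<in>L\<times>L. norm (D x \<theta>))) \<longlongrightarrow> K * (\<Sum>\<theta>\<in>L\<times>L. 0)) ultra"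
  proof (intro tendsto_mult tendsto_const tendsto_sum tendsto_norm_zero)
    fix \<theta> :: "(nat \<Rightarrow> nat) \<times> (nat \<Rightarrow> nat)"
    obtain a b where \<theta>: "\<theta> = (a, b)" by (cases \<theta>)
    have "((\<lambda>x. spread n (mat T) (Suc d) (g(d := x)) a b + (-1) * spread n (mat T) d g a b) \<longlongrightarrow>
        spread n (mat T) d g a b + (-1) * spread n (mat T) d g a b) ultra"
      by (intro tendsto_add tendsto_const spread_tendsto[OF mat_local mat_norm[OF T]])
    then show "((\<lambda>x. D x \<theta>) \<longlongrightarrow> 0) ultra" by (simp add: D_def \<theta>)
  qed
  then have "eventually (\<lambda>x. K * (\<Sum>\<theta>\<in>L\<times>L. norm (D x \<theta>)) < \<delta>) ultra"
    by (rule order_tendstoD(2)) (use \<delta> in simp)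
  moreover have "eventually (\<lambda>x. x \<notin> g ` {..<d}) ultra"
    by (rule eventually_ultra_notin) simp
  ultimately have "eventually (\<lambda>x. K * (\<Sum>\<theta>\<in>L\<times>L. norm (D x \<theta>)) < \<delta> \<and> x \<notin> g ` {..<d}) ultra"
    by eventually_elim simp
  from eventually_happens'[OF ultra(1) this]
  obtain x where x: "K * (\<Sum>\<theta>\<in>L\<times>L. norm (D x \<theta>)) < \<delta>" "x \<notin> g ` {..<d}"
    by auto
  have "bnd \<delta> (\<lambda>a b. D x (a, b))"
    by (rule bnd_mono[OF K(2)[OF D_V[OF x(2)]] less_imp_le[OF x(1)]])
  then show thesis using that[OF x(2)] by (simp add: D_def)
qed

lemma stabilise:
  assumes T: "oper C T" and \<epsilon>: "0 < \<epsilon>"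
  obtains g where "inj g"
    "bnd \<epsilon> (\<lambda>a b. mat T (g \<circ> a) (g \<circ> b) - spread n (mat T) 0 id a b)"
proof -
  let ?S = "spread n (mat T)"
  have "\<exists>G. \<forall>d. inj_on (G d) {..<d} \<and>
    (\<exists>x. G (Suc d) = (G d)(d := x)) \<and>
    bnd (\<epsilon> / 2 ^ Suc d) (\<lambda>a b. ?S (Suc d) (G (Suc d)) a b - ?S d (G d) a b)"
  proof (rule dependent_nat_choice)
    show "\<exists>g :: nat \<Rightarrow> nat. inj_on g {..<0}" by simp
    fix g :: "nat \<Rightarrow> nat" and d assume g: "inj_on g {..<d}"
    obtain x where x: "x \<notin> g ` {..<d}"
      "bnd (\<epsilon> / 2 ^ Suc d) (\<lambda>a b. ?S (Suc d) (g(d := x)) a b - ?S d g a b)"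
      using stabilise_step[OF T g, of "\<epsilon> / 2 ^ Suc d"] \<epsilon> by auto
    show "\<exists>h. inj_on h {..<Suc d} \<and> (\<exists>x. h = g(d := x)) \<and>
      bnd (\<epsilon> / 2 ^ Suc d) (\<lambda>a b. ?S (Suc d) h a b - ?S d g a b)"
      using x inj_on_upd[OF g x(1)] by blast
  qed
  then obtain G where G: "\<And>d. inj_on (G d) {..<d}" "\<And>d. \<exists>x. G (Suc d) = (G d)(d := x)"
    "\<And>d. bnd (\<epsilon> / 2 ^ Suc d) (\<lambda>a b. ?S (Suc d) (G (Suc d)) a b - ?S d (G d) a b)" by blast
  have stab: "l < d \<Longrightarrow> G d l = G (Suc l) l" for l d
  proof (induction d)
    case (Suc d)
    obtain x where "G (Suc d) = (G d)(d := x)" using G(2) by blast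
    then show ?case using Suc by (cases "l = d") auto
  qed simp
  define g where "g l = G (Suc l) l" for l
  have gG: "l < d \<Longrightarrow> G d l = g l" for l d unfolding g_def by (rule stab)
  have "inj g"
  proof (rule injI)
    fix l m assume eq: "g l = g m"
    let ?d = "Suc (l + m)"
    have "G ?d l = G ?d m" using eq by (simp add: gG)
    then show "l = m" using inj_onD[OF G(1)[of ?d]] by simp
  qed
  moreover have "bnd \<epsilon> (\<lambda>a b. mat T (g \<circ> a) (g \<circ> b) - ?S 0 id a b)"
    unfolding bnd_def
  proof (intro allI ballI)
    fix N v assume v: "v \<in> X"
    have S: "?S d (G d) = ?S d g" for d
      by (rule spread_depends[OF mat_local mat_norm[OF T]]) (rule gG)
    have tele: "sec N (\<lambda>a b. ?S m g a b + (-1) * ?S 0 g a b) v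
        = (\<Sum>d<m. sec N (\<lambda>a b. ?S (Suc d) g a b - ?S d g a b) v)" for m
    proof (induction m)
      case 0
      then show ?case by (simp add: sec_def)
    next
      case (Suc m)
      have "sec N (\<lambda>a b. ?S (Suc m) g a b + (-1) * ?S 0 g a b) v
        = sec N (\<lambda>a b. (?S m g a b + (-1) * ?S 0 g a b) + 1 * (?S (Suc m) g a b - ?S m g a b)) v"
        by simp
      also have "\<dots> = sec N (\<lambda>a b. ?S m g a b + (-1) * ?S 0 g a b) v
         + sec N (\<lambda>a b. ?S (Suc m) g a b - ?S m g a b) v"
        by (subst sec_comb) simp
      finally show ?case using Suc by simp
    qed
    have "sec N (\<lambda>a b. mat T (g \<circ> a) (g \<circ> b) - ?S 0 id a b) v = sec N (\<lambda>a b. ?S N g a b + (-1) * ?S 0 g a b) v"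
    proof (rule sec_cong)
      fix a b assume "a \<in> box N" "b \<in> box N"
      then have "?S N g a b = mat T (g \<circ> a) (g \<circ> b)"
        by (intro spread_full[OF mat_local mat_norm[OF T]]) (auto simp: boxD)
      moreover have "?S 0 g = ?S 0 id"
        by (rule spread_depends[OF mat_local mat_norm[OF T]]) simp
      ultimately show "mat T (g \<circ> a) (g \<circ> b) - ?S 0 id a b = ?S N g a b + (-1) * ?S 0 g a b" by simp
    qed
    then have "norm (sec N (\<lambda>a b. mat T (g \<circ> a) (g \<circ> b) - ?S 0 id a b) v)
        \<le> (\<Sum>d<N. norm (sec N (\<lambda>a b. ?S (Suc d) g a b - ?S d g a b) v))"
      unfolding tele by (simp add: norm_sum)
    also have "\<dots> \<le> (\<Sum>d<N. \<epsilon> / 2 ^ Suc d * norm v)"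
      using bndD[OF G(3)[unfolded S] v] by (intro sum_mono)
    also have "\<dots> = \<epsilon> * norm v * (\<Sum>d<N. (1 / 2) ^ Suc d)"
      by (simp add: sum_distrib_left power_divide algebra_simps)
    also have "(\<Sum>d<N. (1 / 2) ^ Suc d) = 1 - (1 / 2 :: real) ^ N"
      by (induction N) (auto simp: field_simps)
    also have "\<epsilon> * norm v * (1 - (1 / 2) ^ N) \<le> \<epsilon> * norm v"
      using \<epsilon> by (intro mult_left_le) auto
    finally show "norm (sec N (\<lambda>a b. mat T (g \<circ> a) (g \<circ> b) - ?S 0 id a b) v) \<le> \<epsilon> * norm v" .
  qed
  ultimately show thesis using that by blast
qed

section \<open>Factoring the identity through an operator or its complement\<close>


lemma oper_eq_e:
  assumes f: "oper C f" and g: "oper D g" and eq: "\<And>a. f (e a) = g (e a)" and v: "v \<in> X"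
  shows "f v = g v"
proof -
  have "f (proj N v) = g (proj N v)" for N
    unfolding proj_def by (simp add: oper_sum[OF f] oper_sum[OF g] oper_scale[OF f] oper_scale[OF g] X_scale e_X eq)
  then have "(\<lambda>N. f (proj N v)) \<longlonglongrightarrow> g v"
    using oper_tendsto[OF g v proj_X[OF v] proj_tendsto[OF v]] by simp
  with oper_tendsto[OF f v proj_X[OF v] proj_tendsto[OF v]] show ?thesis by (rule LIMSEQ_unique)
qed

lemma eq_from_co:
  assumes "v \<in> X" "w \<in> X" "\<And>a. co a v = co a w"
  shows "v = w"
proof -
  have "(\<lambda>N. proj N v) \<longlonglongrightarrow> w"
    using proj_tendsto[OF assms(2)] assms(3) by (simp add: proj_def)
  with proj_tendsto[OF assms(1)] show ?thesis by (rule LIMSEQ_unique)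
qed

lemma sec_oper:
  assumes "bnd C W" "0 \<le> C"
  shows "oper C (sec N W)"
proof (rule operI)
  show "sec N W v \<in> X" for v
    unfolding sec_def by (intro X_sum X_scale e_X)
qed (use assms in \<open>auto simp: sec_def co_add co_scale sum.distrib scale_left_distrib distrib_left
      scale_sum_right mult.left_commute bndD[unfolded sec_def]\<close>)

lemma co_sec:
  assumes x: "\<And>i. i < n \<Longrightarrow> x i < N" and W: "local_below n W"
  shows "co x (sec N W v) = (\<Sum>b\<in>box N. W x b * co b v)"
proof -
  let ?x = "restrict x {..<n}"
  have box: "?x \<in> box N" by (rule box_restrict) (rule x)
  have cox: "co x = co ?x" by (rule co_cong) simp
  have "co ?x (sec N W v) = (\<Sum>a\<in>box N. (\<Sum>b\<in>box N. W a b * co b v) * co ?x (e a))"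
    unfolding sec_def by (simp add: co_sum X_sum X_scale e_X co_scale sum_distrib_right)
  also have "\<dots> = (\<Sum>a\<in>box N. if a = ?x then (\<Sum>b\<in>box N. W a b * co b v) else 0)"
  proof (rule sum.cong[OF refl])
    fix a assume a: "a \<in> box N"
    have "(\<forall>i<n. ?x i = a i) \<longleftrightarrow> a = ?x"
      using a by (auto simp: box_def PiE_def extensional_def fun_eq_iff)
    then show "(\<Sum>b\<in>box N. W a b * co b v) * co ?x (e a) = (if a = ?x then (\<Sum>b\<in>box N. W a b * co b v) else 0)"
      by (simp add: co_e)
  qed
  also have "\<dots> = (\<Sum>b\<in>box N. W ?x b * co b v)"
    using box by simp
  also have "\<dots> = (\<Sum>b\<in>box N. W x b * co b v)"
    by (intro sum.cong refl arg_cong2[of _ _ _ _ "(*)"] local_belowD[OF W]) auto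
  finally show ?thesis by (simp add: cox)
qed

lemma co_sec_e:
  assumes x: "\<And>i. i < n \<Longrightarrow> x i < N" and y: "\<And>i. i < n \<Longrightarrow> y i < N" and W: "local_below n W"
  shows "co x (sec N W (e y)) = W x y"
proof -
  let ?y = "restrict y {..<n}"
  have box: "?y \<in> box N" by (rule box_restrict) (rule y)
  have "co x (sec N W (e y)) = (\<Sum>b\<in>box N. W x b * co b (e y))"
    by (rule co_sec[OF x W])
  also have "\<dots> = (\<Sum>b\<in>box N. if b = ?y then W x b else 0)"
  proof (rule sum.cong[OF refl])
    fix b assume b: "b \<in> box N"
    have "(\<forall>i<n. b i = y i) \<longleftrightarrow> b = ?y"
      using b by (auto simp: box_def PiE_def extensional_def fun_eq_iff)
    then show "W x b * co b (e y) = (if b = ?y then W x b else 0)" by (simp add: co_e)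
  qed
  also have "\<dots> = W x ?y" using box by simp
  also have "\<dots> = W x y" by (rule local_belowD[OF W]) simp
  finally show ?thesis .
qed

text \<open>If a label of the row occurs neither elsewhere in the row nor in the column, then it can be
  spread over \<open>K\<close> places without changing the entry; so a column has \<open>K\<close> equal coordinates,
  while \<open>K\<close> coordinates of an element of the unit ball sum up to \<open>o(K)\<close>.\<close>

lemma spreading_entry_0:
  assumes bW: "bnd C W" and C: "0 \<le> C" and W: "spreading n 0 W"
    and j: "j < n" and aj: "\<And>i. i < n \<Longrightarrow> i \<noteq> j \<Longrightarrow> a i \<noteq> a j" and bj: "\<And>i. i < n \<Longrightarrow> b i \<noteq> a j"
  shows "W a b = 0"
proof -
  have loc: "local_below n W" using W by (simp add: spreading_def)
  define m where "m = a j"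
  define h where "h K r l = (if l < m then l else if l = m then m + r else l + K)" for K r l :: nat
  have est: "real K * norm (W a b) \<le> (real K * d + d powr (1 - p)) * C" if K: "0 < K" and d: "0 < d" for K d
  proof -
    define a' where "a' = h K 0 \<circ> a"
    define b' where "b' = h K 0 \<circ> b"
    define N where "N = Suc (\<Sum>i<n. a i + b i) + K"
    have entry: "W (a'(j := m + r)) b' = W a b" if r: "r < K" for r
    proof -
      have "W (h K r \<circ> a) (h K r \<circ> b) = W a b"
        by (rule spreading_image[OF W, of "a ` {..<n} \<union> b ` {..<n}"]) (use r in \<open>auto simp: h_def\<close>)
      moreover have "W (h K r \<circ> a) (h K r \<circ> b) = W (a'(j := m + r)) b'"
        using aj bj by (intro local_belowD[OF loc]) (auto simp: a'_def b'_def h_def m_def)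
      ultimately show ?thesis by simp
    qed
    have lab: "a i < Suc (\<Sum>i<n. a i + b i) \<and> b i < Suc (\<Sum>i<n. a i + b i)" if "i < n" for i
      using member_le_sum[of i "{..<n}" "\<lambda>i. a i + b i"] that by (auto simp: less_Suc_eq_le)
    have lt: "h K r (a i) < N \<and> h K r (b i) < N" if "i < n" "r < K" for i r
      using lab[OF that(1)] that(2) by (auto simp: h_def N_def)
    define y where "y = sec N W (e b')"
    have y: "y \<in> X" "norm y \<le> C"
    proof -
      show "y \<in> X" unfolding y_def by (rule oper_X[OF sec_oper[OF bW C] e_X])
      have "norm y \<le> C * norm (e b')" unfolding y_def by (rule bndD[OF bW e_X])
      also have "\<dots> \<le> C" using C e_norm[of b'] by (simp add: mult_left_le)
      finally show "norm y \<le> C" .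
    qed
    define \<psi> where "\<psi> v = (\<Sum>r<K. co (a'(j := m + r)) v)" for v
    have \<psi>: "bounded_linear_on sc (*) X (real K) \<psi>"
      unfolding bounded_linear_on_def linear_map_on_def
    proof (intro conjI ballI allI)
      show "norm (\<psi> v) \<le> real K * norm v" if v: "v \<in> X" for v
        unfolding \<psi>_def using sum_norm_bound[of "{..<K}" "\<lambda>r. co (a'(j := m + r)) v" "norm v"] co_norm[OF v] by simp
    qed (simp_all add: \<psi>_def co_add co_scale sum.distrib sum_distrib_left)
    have "norm (\<psi> y) \<le> (real K * d + d powr (1 - p)) * norm y"
    proof (rule norm_le_from_jt[OF \<psi> _ _ y(1)])
      show "0 \<le> real K * d + d powr (1 - p)" using d by simp
      fix x assume x: "tup x"
      have "\<psi> (jt x) = (\<Sum>r<K. x j (m + r)) * (\<Prod>i\<in>{..<n}-{j}. x i (a' i))"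
        unfolding \<psi>_def co_jt[OF x] sum_distrib_right
        by (intro sum.cong refl, subst prod.remove[of _ j]) (use j in auto)
      moreover have "norm (\<Sum>r<K. x j (m + r)) \<le> (real K * d + d powr (1 - p)) * lp_norm p (x j)"
      proof -
        have "norm (\<Sum>r<K. x j (m + r)) \<le> (\<Sum>r<K. norm (x j (m + r)))" by (rule norm_sum)
        also have "\<dots> = (\<Sum>t\<in>(+) m ` {..<K}. norm (x j t))" by (subst sum.reindex) auto
        also have "\<dots> \<le> (card ((+) m ` {..<K}) * d + d powr (1 - p)) * lp_norm p (x j)"
          by (rule sum_coords_le[OF p1 tupD[OF x j] d]) simp
        finally show ?thesis by (simp add: card_image)
      qed
      moreover have "norm (\<Prod>i\<in>{..<n}-{j}. x i (a' i)) \<le> (\<Prod>i\<in>{..<n}-{j}. lp_norm p (x i))"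
        unfolding prod_norm[symmetric] using x by (intro prod_mono) (auto intro: norm_le_lp_norm p1 tupD)
      ultimately have "norm (\<psi> (jt x)) \<le> (real K * d + d powr (1 - p)) * lp_norm p (x j) * (\<Prod>i\<in>{..<n}-{j}. lp_norm p (x i))"
        using d by (auto simp: norm_mult intro!: mult_mono)
      moreover have "pnorm x = lp_norm p (x j) * (\<Prod>i\<in>{..<n}-{j}. lp_norm p (x i))"
        unfolding pnorm_def using j by (subst prod.remove[of _ j]) auto
      ultimately show "norm (\<psi> (jt x)) \<le> (real K * d + d powr (1 - p)) * pnorm x" by (simp only: mult.assoc)
    qed
    moreover have "\<psi> y = of_nat K * W a b"
    proof -
      have "co (a'(j := m + r)) y = W a b" if r: "r < K" for r
        unfolding y_def entry[OF r, symmetric]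
      proof (rule co_sec_e[OF _ _ loc])
        show "b' i < N" if "i < n" for i using lt[OF that, of 0] K by (simp add: b'_def)
        show "(a'(j := m + r)) i < N" if "i < n" for i
          using lt[OF that, of 0] lt[OF j r] K by (auto simp: a'_def h_def m_def)
      qed
      then show ?thesis by (simp add: \<psi>_def)
    qed
    ultimately have "real K * norm (W a b) \<le> (real K * d + d powr (1 - p)) * norm y"
      by (simp add: norm_mult)
    also have "\<dots> \<le> (real K * d + d powr (1 - p)) * C" using y d by (intro mult_left_mono) auto
    finally show ?thesis .
  qed
  show ?thesis
  proof (rule ccontr)
    assume "W a b \<noteq> 0"
    then have t: "0 < norm (W a b)" by simp
    define d where "d = norm (W a b) / (2 * (C + 1))"
    have d: "0 < d" using t C by (simp add: d_def)
    have dC: "d * C \<le> norm (W a b) / 2" using t C by (simp add: d_def field_simps)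
    obtain K :: nat where K: "d powr (1 - p) * C < real K * (norm (W a b) / 2)"
      using reals_Archimedean3[of "norm (W a b) / 2"] t by auto
    have K0: "0 < K"
    proof (rule ccontr)
      assume "\<not> 0 < K"
      then show False using K C d by (simp add: mult_less_0_iff)
    qed
    have "real K * norm (W a b) \<le> real K * (d * C) + d powr (1 - p) * C"
      using est[OF K0 d] by (simp add: algebra_simps)
    also have "\<dots> \<le> real K * (norm (W a b) / 2) + d powr (1 - p) * C"
      using dC by (intro add_right_mono mult_left_mono) auto
    also have "\<dots> < real K * norm (W a b)" using K by simp
    finally show False by simp
  qed
qed

definition perms :: "(nat \<Rightarrow> nat) set" where
  "perms = {\<sigma>. \<sigma> permutes {..<n}}"

definition pidx :: "(nat \<Rightarrow> nat) \<Rightarrow> nat" where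
  "pidx = (SOME h. bij_betw h perms {0..<card perms})"

lemma finite_perms: "finite perms"
  by (simp add: perms_def finite_permutations)

lemma perms_pos: "0 < card perms"
  using finite_perms permutes_id[of "{..<n}"] unfolding card_gt_0_iff perms_def by blast

lemma pidx: "bij_betw pidx perms {0..<card perms}"
  unfolding pidx_def by (rule someI_ex[OF ex_bij_betw_finite_nat[OF finite_perms]])

lemma pidx_less: "\<sigma> \<in> perms \<Longrightarrow> pidx \<sigma> < card perms"
  using pidx by (auto simp: bij_betw_def)

lemma pidx_inj: "\<sigma> \<in> perms \<Longrightarrow> \<tau> \<in> perms \<Longrightarrow> pidx \<sigma> = pidx \<tau> \<Longrightarrow> \<sigma> = \<tau>"
  using pidx by (auto simp: bij_betw_def inj_on_def)

text \<open>Coordinate \<open>i\<close> carries the labels congruent to \<open>i\<close> modulo \<open>n\<close>, so that labels of different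
  coordinates never coincide; every permutation then gets its own residue class.\<close>

definition enc :: "(nat \<Rightarrow> nat) \<Rightarrow> nat \<Rightarrow> nat \<Rightarrow> nat" where
  "enc \<sigma> i t = (n * t + i) * card perms + pidx \<sigma>"

definition lab :: "(nat \<Rightarrow> nat) \<Rightarrow> (nat \<Rightarrow> nat) \<Rightarrow> nat \<Rightarrow> nat" where
  "lab \<sigma> a j = enc \<sigma> (inv \<sigma> j) (a (inv \<sigma> j))"

lemma enc_eq_iff:
  assumes "\<sigma> \<in> perms" "\<tau> \<in> perms" "i < n" "j < n"
  shows "enc \<sigma> i s = enc \<tau> j t \<longleftrightarrow> \<sigma> = \<tau> \<and> i = j \<and> s = t"
proof
  assume eq: "enc \<sigma> i s = enc \<tau> j t"
  have "enc \<sigma> i s mod card perms = pidx \<sigma>" "enc \<tau> j t mod card perms = pidx \<tau>"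
    "enc \<sigma> i s div card perms = n * s + i" "enc \<tau> j t div card perms = n * t + j"
    using assms pidx_less perms_pos by (simp_all add: enc_def)
  then have "\<sigma> = \<tau>" "n * s + i = n * t + j" using eq pidx_inj assms by auto
  moreover from this(2) have "(n * s + i) mod n = (n * t + j) mod n" "(n * s + i) div n = (n * t + j) div n"
    by (simp_all only:)
  then have "i = j" "s = t" using assms(3,4) by simp_all
  ultimately show "\<sigma> = \<tau> \<and> i = j \<and> s = t" by blast
qed simp

lemma inv_perm:
  assumes "\<sigma> \<in> perms"
  shows "\<sigma> (inv \<sigma> j) = j" "inv \<sigma> (\<sigma> j) = j" "j < n \<Longrightarrow> inv \<sigma> j < n" "inv \<sigma> \<in> perms"
    "inv (inv \<sigma>) = \<sigma>"
proof -
  have \<sigma>: "\<sigma> permutes {..<n}" using assms by (simp add: perms_def)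
  show "\<sigma> (inv \<sigma> j) = j" "inv \<sigma> (\<sigma> j) = j" using permutes_inverses[OF \<sigma>] by auto
  show "inv \<sigma> \<in> perms" using permutes_inv[OF \<sigma>] by (simp add: perms_def)
  show "j < n \<Longrightarrow> inv \<sigma> j < n" using permutes_in_image[OF permutes_inv[OF \<sigma>], of j] by simp
  show "inv (inv \<sigma>) = \<sigma>" by (rule permutes_inv_inv[OF \<sigma>])
qed

definition spread_op :: "(nat \<Rightarrow> nat) \<Rightarrow> 'x \<Rightarrow> 'x" where
  "spread_op \<sigma> = tensor_op (inv \<sigma>)
     (\<lambda>j t. if t \<in> enc \<sigma> (inv \<sigma> j) ` UNIV then 1 else 0) (\<lambda>j. inv_into UNIV (enc \<sigma> (inv \<sigma> j)))"

definition read_op :: "(nat \<Rightarrow> nat) \<Rightarrow> 'x \<Rightarrow> 'x" where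
  "read_op \<sigma> = tensor_op \<sigma> (\<lambda>i t. 1) (enc \<sigma>)"

lemma inj_enc: "inj (enc \<sigma> i)"
  using n0 perms_pos by (auto simp: inj_on_def enc_def)

lemma contractive_read: "contractive (\<lambda>t. 1) (enc \<sigma> i)"
  using inj_enc[of \<sigma> i] by (auto simp: contractive_def intro: inj_on_subset)

lemma spread_op:
  assumes \<sigma>: "\<sigma> \<in> perms"
  shows "oper 1 (spread_op \<sigma>)" "spread_op \<sigma> (e b) = e (lab \<sigma> b)"
proof -
  have p: "inv \<sigma> permutes {..<n}" using inv_perm(4)[OF \<sigma>] by (simp add: perms_def)
  show "oper 1 (spread_op \<sigma>)"
    unfolding spread_op_def by (rule tensor_op(1)[OF p contractive_emb])
  show "spread_op \<sigma> (e b) = e (lab \<sigma> b)"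
    unfolding spread_op_def lab_def
    by (rule tensor_op_e[OF p contractive_emb]) (rule reindex_emb_unit[OF inj_enc], simp)
qed

lemma read_op:
  assumes \<sigma>: "\<sigma> \<in> perms"
  shows "oper 1 (read_op \<sigma>)" "v \<in> X \<Longrightarrow> co a (read_op \<sigma> v) = co (lab \<sigma> a) v"
proof -
  have p: "\<sigma> permutes {..<n}" using \<sigma> by (simp add: perms_def)
  show "oper 1 (read_op \<sigma>)"
    unfolding read_op_def by (rule tensor_op(1)[OF p contractive_read])
  show "v \<in> X \<Longrightarrow> co a (read_op \<sigma> v) = co (lab \<sigma> a) v"
    unfolding read_op_def by (subst co_tensor_op[OF p contractive_read]) (simp_all add: lab_def[abs_def])
qed

lemma perm_sum:
  assumes W: "spreading n 0 W"
  shows "(\<Sum>\<sigma>\<in>perms. W (lab \<sigma> a) (lab \<sigma> a)) = (\<Sum>\<kappa>\<in>perms. W \<kappa> \<kappa>)"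
proof -
  have loc: "local_below n W" using W by (simp add: spreading_def)
  define L where "L i = n * a i + i" for i
  have Linj: "i = j" if "L i = L j" "i < n" "j < n" for i j
  proof -
    have "(n * a i + i) mod n = (n * a j + j) mod n" using that(1) by (simp add: L_def)
    then show ?thesis using that by simp
  qed
  let ?U = "L ` {..<n}"
  define \<rho> where "\<rho> i = (if i < n then rank ?U (L i) else i)" for i
  have rank_less: "rank ?U l < n" if "l \<in> ?U" for l
  proof -
    have "{u \<in> ?U. u < l} \<subset> ?U" using that by blast
    then have "rank ?U l < card ?U" unfolding rank_def by (intro psubset_card_mono) simp_all
    also have "\<dots> \<le> n" using card_image_le[of "{..<n}" L] by simp
    finally show ?thesis .
  qed
  have rank_mono: "rank ?U l < rank ?U l'" if "l \<in> ?U" "l < l'" for l l'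
    unfolding rank_def using that by (intro psubset_card_mono) auto
  have "\<rho> permutes {..<n}"
  proof (rule bij_imp_permutes)
    have "inj_on \<rho> {..<n}"
    proof (rule inj_onI)
      fix i j assume ij: "i \<in> {..<n}" "j \<in> {..<n}" "\<rho> i = \<rho> j"
      then have "rank ?U (L i) = rank ?U (L j)" by (simp add: \<rho>_def)
      then have "L i = L j"
        using rank_mono[of "L i" "L j"] rank_mono[of "L j" "L i"] ij by (cases "L i" "L j" rule: linorder_cases) auto
      then show "i = j" using Linj ij by simp
    qed
    moreover have "\<rho> ` {..<n} \<subseteq> {..<n}" using rank_less by (auto simp: \<rho>_def)
    ultimately show "bij_betw \<rho> {..<n} {..<n}"
      by (simp add: bij_betw_def endo_inj_surj)
  qed (simp add: \<rho>_def)
  have "W (lab \<sigma> a) (lab \<sigma> a) = W (\<rho> \<circ> inv \<sigma>) (\<rho> \<circ> inv \<sigma>)" if \<sigma>: "\<sigma> \<in> perms" for \<sigma>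
  proof -
    let ?h = "\<lambda>l. l * card perms + pidx \<sigma>" and ?b = "L \<circ> inv \<sigma>"
    have b: "?b j \<in> ?U" if "j < n" for j using inv_perm(3)[OF \<sigma> that] by auto
    have "lab \<sigma> a = ?h \<circ> ?b" by (auto simp: lab_def enc_def L_def fun_eq_iff)
    then have "W (lab \<sigma> a) (lab \<sigma> a) = W (?h \<circ> ?b) (?h \<circ> ?b)" by (simp only:)
    also have "\<dots> = W ?b ?b"
      by (rule spreading_image[OF W, of ?U]) (use b perms_pos in auto)
    also have "\<dots> = W (rank ?U \<circ> ?b) (rank ?U \<circ> ?b)"
      by (rule spreading_rank[OF W]) (use b in auto)
    also have "\<dots> = W (\<rho> \<circ> inv \<sigma>) (\<rho> \<circ> inv \<sigma>)"
      by (rule local_belowD[OF loc]) (simp add: \<rho>_def inv_perm(3)[OF \<sigma>])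
    finally show ?thesis .
  qed
  then have "(\<Sum>\<sigma>\<in>perms. W (lab \<sigma> a) (lab \<sigma> a)) = (\<Sum>\<sigma>\<in>perms. W (\<rho> \<circ> inv \<sigma>) (\<rho> \<circ> inv \<sigma>))"
    by (rule sum.cong[OF refl])
  also have "\<dots> = (\<Sum>\<sigma>\<in>perms. W (\<rho> \<circ> \<sigma>) (\<rho> \<circ> \<sigma>))"
    unfolding perms_def by (rule sum_permutations_inverse[symmetric])
  also have "\<dots> = (\<Sum>\<kappa>\<in>perms. W \<kappa> \<kappa>)"
    unfolding perms_def by (rule setum_permutations_compose_left[OF \<open>\<rho> permutes {..<n}\<close>, symmetric])
  finally show ?thesis .
qed

lemma left_inverse_near_scalar:
  assumes R: "oper C R" and s: "s \<noteq> 0"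
    and near: "\<And>v. v \<in> X \<Longrightarrow> norm (R v - sc s v) \<le> norm s / 2 * norm v"
  obtains Q D where "oper D Q" "\<And>v. v \<in> X \<Longrightarrow> Q (R v) = v"
proof -
  have low: "norm s / 2 * norm v \<le> norm (R v)" if v: "v \<in> X" for v
    using near[OF v] norm_triangle_ineq2[of "sc s v" "sc s v - R v"]
    by (simp add: norm_scale norm_minus_commute algebra_simps)
  have inj: "v = w" if "v \<in> X" "w \<in> X" "R v = R w" for v w
  proof -
    have "norm s / 2 * norm (v - w) \<le> 0"
      using low[OF X_diff[OF that(1,2)]] oper_diff[OF R that(1,2)] that(3) by simp
    then show ?thesis using s by (simp add: mult_le_0_iff)
  qed
  have surj: "\<exists>v\<in>X. R v = y" if y: "y \<in> X" for y
  proof -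
    let ?f = "\<lambda>v. v - sc (inverse s) (R v - y)"
    have "\<exists>!v\<in>X. ?f v = v"
    proof (rule Banach_fix[of X "1/2"])
      show "complete X" using closed_X by (simp add: complete_eq_closed)
      show "X \<noteq> {}" using X_0 by blast
      show "?f ` X \<subseteq> X" using y by (auto intro!: X_diff X_scale oper_X[OF R])
      show "dist (?f v) (?f w) \<le> 1/2 * dist v w" if vw: "v \<in> X" "w \<in> X" for v w
      proof -
        have d: "v - w \<in> X" using vw by (simp add: X_diff)
        have "?f v - ?f w = (v - w) - sc (inverse s) (R v - R w)"
          by (simp add: scale_right_diff_distrib)
        also have "\<dots> = - sc (inverse s) (R (v - w) - sc s (v - w))"
          using vw s by (simp add: oper_diff[OF R] scale_right_diff_distrib)
        finally have "dist (?f v) (?f w) = norm (inverse s) * norm (R (v - w) - sc s (v - w))"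
          by (simp add: dist_norm norm_scale)
        also have "\<dots> \<le> norm (inverse s) * (norm s / 2 * norm (v - w))"
          by (intro mult_left_mono near d) simp
        also have "\<dots> = 1/2 * dist v w" using s by (simp add: norm_inverse dist_norm)
        finally show ?thesis .
      qed
    qed auto
    then obtain v where v: "v \<in> X" "?f v = v" by blast
    then have "sc (inverse s) (R v - y) = 0" by simp
    then have "R v = y" using s by simp
    then show ?thesis using v by blast
  qed
  define Q where "Q y = (THE v. v \<in> X \<and> R v = y)" for y
  have QR: "Q (R v) = v" if "v \<in> X" for v
    unfolding Q_def using that inj by blast
  have Q: "Q y \<in> X" "R (Q y) = y" if "y \<in> X" for y
  proof -
    obtain v where "v \<in> X" "R v = y" using surj[OF \<open>y \<in> X\<close>] by blast
    then show "Q y \<in> X" "R (Q y) = y" using QR[of v] by simp_all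
  qed
  have "oper (2 / norm s) Q"
  proof (rule operI)
    show "Q (y + z) = Q y + Q z" if yz: "y \<in> X" "z \<in> X" for y z
      by (rule inj) (simp_all add: Q yz X_add oper_add[OF R])
    show "Q (sc c y) = sc c (Q y)" if y: "y \<in> X" for c y
      by (rule inj) (simp_all add: Q y X_scale oper_scale[OF R])
    show "norm (Q y) \<le> 2 / norm s * norm y" if "y \<in> X" for y
      using low[OF Q(1)[OF that]] Q(2)[OF that] s by (simp add: field_simps)
  qed (use Q in auto)
  then show thesis using that QR by blast
qed

definition spread_all :: "'x \<Rightarrow> 'x" where
  "spread_all v = (\<Sum>\<tau>\<in>perms. spread_op \<tau> v)"

definition read_all :: "'x \<Rightarrow> 'x" where
  "read_all v = (\<Sum>\<sigma>\<in>perms. read_op \<sigma> v)"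

lemma spread_all_oper: "oper (card perms) spread_all"
  using oper_sum_fun[OF finite_perms spread_op(1), of "\<lambda>\<tau>. \<tau>"] by (simp add: spread_all_def[abs_def])

lemma read_all_oper: "oper (card perms) read_all"
  using oper_sum_fun[OF finite_perms read_op(1), of "\<lambda>\<tau>. \<tau>"] by (simp add: read_all_def[abs_def])

lemma co_read_all: "v \<in> X \<Longrightarrow> co a (read_all v) = (\<Sum>\<sigma>\<in>perms. co (lab \<sigma> a) v)"
  unfolding read_all_def by (simp add: co_sum oper_X[OF read_op(1)] read_op(2))

lemma spread_all_e: "spread_all (e b) = (\<Sum>\<tau>\<in>perms. e (lab \<tau> b))"
  unfolding spread_all_def by (simp add: spread_op(2))

lemma lab_eq:
  assumes "\<sigma> \<in> perms" "\<tau> \<in> perms" "\<forall>j<n. lab \<sigma> a j = lab \<tau> b j"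
  shows "\<sigma> = \<tau> \<and> (\<forall>i<n. a i = b i)"
proof -
  have *: "\<sigma> = \<tau> \<and> inv \<sigma> j = inv \<tau> j \<and> a (inv \<sigma> j) = b (inv \<tau> j)" if "j < n" for j
    using assms(3) that enc_eq_iff[OF assms(1,2) inv_perm(3)[OF assms(1) that] inv_perm(3)[OF assms(2) that]]
    unfolding lab_def by blast
  have "\<sigma> = \<tau>" using *[OF n0] by simp
  moreover have "a i = b i" if "i < n" for i
  proof -
    have "\<sigma> i < n" using permutes_in_image[of \<sigma> "{..<n}" i] assms(1) that by (simp add: perms_def)
    then show ?thesis using *[of "\<sigma> i"] inv_perm(2)[OF assms(1)] \<open>\<sigma> = \<tau>\<close> by simp
  qed
  ultimately show ?thesis by blast
qed

lemma lab_entry: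
  assumes bW: "bnd C W" and C: "0 \<le> C" and W: "spreading n 0 W" and \<sigma>: "\<sigma> \<in> perms" and \<tau>: "\<tau> \<in> perms"
  shows "W (lab \<sigma> a) (lab \<tau> b) = (if \<sigma> = \<tau> \<and> (\<forall>i<n. a i = b i) then W (lab \<sigma> a) (lab \<sigma> a) else 0)"
proof (cases "\<sigma> = \<tau> \<and> (\<forall>i<n. a i = b i)")
  case True
  have loc: "local_below n W" using W by (simp add: spreading_def)
  have "W (lab \<sigma> a) (lab \<tau> b) = W (lab \<sigma> a) (lab \<sigma> a)"
    by (rule local_belowD[OF loc]) (use True inv_perm(3)[OF \<tau>] in \<open>simp add: lab_def\<close>)
  then show ?thesis using True by simp
next
  case False
  then obtain j where j: "j < n" "lab \<sigma> a j \<noteq> lab \<tau> b j" using lab_eq[OF \<sigma> \<tau>] by blast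
  have "W (lab \<sigma> a) (lab \<tau> b) = 0"
  proof (rule spreading_entry_0[OF bW C W j(1)])
    show "lab \<sigma> a i \<noteq> lab \<sigma> a j" if "i < n" "i \<noteq> j" for i
    proof
      assume "lab \<sigma> a i = lab \<sigma> a j"
      then have "inv \<sigma> i = inv \<sigma> j"
        using enc_eq_iff[OF \<sigma> \<sigma> inv_perm(3)[OF \<sigma> that(1)] inv_perm(3)[OF \<sigma> j(1)]] by (simp add: lab_def)
      then show False using inv_perm(1)[OF \<sigma>] that(2) by metis
    qed
    show "lab \<tau> b i \<noteq> lab \<sigma> a j" if "i < n" for i
    proof
      assume eq: "lab \<tau> b i = lab \<sigma> a j"
      then have "\<tau> = \<sigma>" "inv \<tau> i = inv \<sigma> j"
        using enc_eq_iff[OF \<tau> \<sigma> inv_perm(3)[OF \<tau> that] inv_perm(3)[OF \<sigma> j(1)]]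
        unfolding lab_def by blast+
      then have "i = j" using inv_perm(1)[OF \<sigma>] by metis
      then show False using eq j(2) by simp
    qed
  qed
  then show ?thesis using False by (simp only: if_False)
qed

lemma read_spread_all:
  assumes v: "v \<in> X"
  shows "read_all (spread_all v) = sc (of_nat (card perms)) v"
proof (rule oper_eq_e[OF oper_comp[OF read_all_oper spread_all_oper] oper_smult[OF oper_id] _ v])
  fix b
  have X: "(\<Sum>\<tau>\<in>perms. e (lab \<tau> b)) \<in> X" by (intro X_sum e_X)
  show "read_all (spread_all (e b)) = sc (of_nat (card perms)) (e b)"
  proof (rule eq_from_co)
    show "read_all (spread_all (e b)) \<in> X" by (intro oper_X[OF read_all_oper] oper_X[OF spread_all_oper] e_X)
    show "sc (of_nat (card perms)) (e b) \<in> X" by (intro X_scale e_X)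
    fix a
    have "co a (read_all (spread_all (e b))) = (\<Sum>\<sigma>\<in>perms. \<Sum>\<tau>\<in>perms. co (lab \<sigma> a) (e (lab \<tau> b)))"
      by (simp add: spread_all_e co_read_all[OF X] co_sum e_X)
    also have "\<dots> = (\<Sum>\<sigma>\<in>perms. \<Sum>\<tau>\<in>perms. if \<tau> = \<sigma> then (if \<forall>i<n. a i = b i then 1 else 0) else 0)"
    proof (intro sum.cong refl)
      fix \<sigma> \<tau> assume st: "\<sigma> \<in> perms" "\<tau> \<in> perms"
      have "(\<forall>j<n. lab \<sigma> a j = lab \<tau> b j) \<longleftrightarrow> \<sigma> = \<tau> \<and> (\<forall>i<n. a i = b i)"
        using lab_eq[OF st] inv_perm(3)[OF st(2)] by (auto simp: lab_def)
      then show "co (lab \<sigma> a) (e (lab \<tau> b)) = (if \<tau> = \<sigma> then (if \<forall>i<n. a i = b i then 1 else 0) else 0)"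
        by (auto simp: co_e)
    qed
    also have "\<dots> = (\<Sum>\<sigma>\<in>perms. if \<forall>i<n. a i = b i then 1 else 0)"
      using finite_perms by simp
    also have "\<dots> = co a (sc (of_nat (card perms)) (e b))"
      by (simp add: co_scale e_X co_e)
    finally show "co a (read_all (spread_all (e b))) = co a (sc (of_nat (card perms)) (e b))" .
  qed
qed

lemma proj_e:
  assumes c: "\<And>i. i < n \<Longrightarrow> c i < N"
  shows "proj N (e c) = e c"
proof -
  let ?c = "restrict c {..<n}"
  have box: "?c \<in> box N" by (rule box_restrict) (rule c)
  have "proj N (e c) = (\<Sum>a\<in>box N. if a = ?c then e a else 0)"
    unfolding proj_def
  proof (rule sum.cong[OF refl])
    fix a assume a: "a \<in> box N"
    have "(\<forall>i<n. a i = c i) \<longleftrightarrow> a = ?c"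
      using a by (auto simp: box_def PiE_def extensional_def fun_eq_iff)
    then show "sc (co a (e c)) (e a) = (if a = ?c then e a else 0)" by (simp add: co_e)
  qed
  also have "\<dots> = e ?c" using box by simp
  also have "\<dots> = e c" by (rule e_cong) simp
  finally show ?thesis .
qed

lemma co_oper:
  assumes Q: "oper C Q" and y: "y \<in> X" "proj N y = y" and c: "\<And>i. i < n \<Longrightarrow> c i < N"
  shows "co c (Q y) = co c (sec N (mat Q) y)"
proof -
  have "Q (proj N y) = (\<Sum>b\<in>box N. sc (co b y) (Q (e b)))"
    unfolding proj_def by (simp add: oper_sum[OF Q] X_scale e_X oper_scale[OF Q])
  then have "co c (Q y) = (\<Sum>b\<in>box N. co b y * mat Q c b)"
    unfolding y(2) mat_def by (simp add: co_sum X_scale oper_X[OF Q] e_X co_scale)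
  also have "\<dots> = co c (sec N (mat Q) y)"
    using co_sec[where x = c and N = N and W = "mat Q" and v = y, OF c mat_local]
    by (simp add: mult.commute)
  finally show ?thesis .
qed

lemma res_emb:
  assumes g: "inj g" and v: "v \<in> X"
  shows "res UNIV g (emb UNIV g v) = v"
proof (rule oper_eq_e[OF oper_comp[OF res_oper[OF g] emb_oper] oper_id _ v])
  fix b
  show "res UNIV g (emb UNIV g (e b)) = e b"
  proof (rule eq_from_co)
    show "res UNIV g (emb UNIV g (e b)) \<in> X" by (intro oper_X[OF res_oper[OF g]] oper_X[OF emb_oper] e_X)
    show "co a (res UNIV g (emb UNIV g (e b))) = co a (e b)" for a
      using g by (simp add: co_res[OF g] oper_X[OF emb_oper] e_X emb_e[OF g] co_e inj_eq)
  qed (rule e_X)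
qed

lemma read_spread_near_scalar:
  assumes Q: "oper C Q" and bW: "bnd D W" and D: "0 \<le> D" and W: "spreading n 0 W"
    and err: "bnd \<epsilon> (\<lambda>a b. mat Q a b - W a b)" and \<epsilon>: "0 \<le> \<epsilon>" and v: "v \<in> X"
  shows "norm (read_all (Q (spread_all v)) - sc (\<Sum>\<kappa>\<in>perms. W \<kappa> \<kappa>) v)
    \<le> real (card perms) * \<epsilon> * real (card perms) * norm v"
proof -
  define s where "s = (\<Sum>\<kappa>\<in>perms. W \<kappa> \<kappa>)"
  define m where "m = real (card perms)"
  have loc: "local_below n W" using W by (simp add: spreading_def)
  note SX = oper_X[OF spread_all_oper] and RX = oper_X[OF read_all_oper]
  define F where "F v = read_all (Q (spread_all v)) - sc s v" for v
  have F: "oper (m * (C * m) + norm s * 1) F"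
    unfolding F_def[abs_def] m_def
    by (intro oper_minus oper_comp[OF read_all_oper oper_comp[OF Q spread_all_oper]] oper_smult[OF oper_id])
  have fin: "norm (proj L (F (proj K v))) \<le> m * \<epsilon> * m * norm (proj K v)" for L K
  proof -
    define x where "x = proj K v"
    have x: "x \<in> X" unfolding x_def by (rule proj_X[OF v])
    define y where "y = spread_all x"
    have yX: "y \<in> X" unfolding y_def by (rule SX[OF x])
    have "finite ((\<lambda>(\<sigma>, a, j). lab \<sigma> a j) ` (perms \<times> (box K \<union> box L) \<times> {..<n}))"
      using finite_perms by (intro finite_imageI) auto
    then obtain N where "\<forall>l\<in>(\<lambda>(\<sigma>, a, j). lab \<sigma> a j) ` (perms \<times> (box K \<union> box L) \<times> {..<n}). l < N"
      unfolding finite_nat_set_iff_bounded by blast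
    then have N: "lab \<sigma> a j < N" if "\<sigma> \<in> perms" "a \<in> box K \<union> box L" "j < n" for \<sigma> a j
      using that by fastforce
    have y_eq: "y = (\<Sum>b\<in>box K. sc (co b v) (\<Sum>\<tau>\<in>perms. e (lab \<tau> b)))"
      unfolding y_def x_def proj_def
      by (simp add: oper_sum[OF spread_all_oper] X_scale e_X oper_scale[OF spread_all_oper] spread_all_e)
    have "proj N y = (\<Sum>b\<in>box K. sc (co b v) (\<Sum>\<tau>\<in>perms. proj N (e (lab \<tau> b))))"
      unfolding y_eq by (simp add: oper_sum[OF proj_oper] X_scale X_sum e_X oper_scale[OF proj_oper])
    also have "\<dots> = y"
      unfolding y_eq by (intro sum.cong refl arg_cong2[of _ _ _ _ sc] proj_e N) auto
    finally have yN: "proj N y = y" .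
    define z where "z = sec N (\<lambda>a b. mat Q a b - W a b) y"
    have zX: "z \<in> X" unfolding z_def by (rule oper_X[OF sec_oper[OF err \<epsilon>] yX])
    have "sec N (mat Q) y = sec N (\<lambda>a b. W a b + 1 * (mat Q a b - W a b)) y" by simp
    also have "\<dots> = sec N W y + z" unfolding sec_comb z_def by simp
    finally have sec_eq: "sec N (mat Q) y = sec N W y + z" .
    have "co a (F x) = co a (read_all z)" if a: "a \<in> box L" for a
    proof -
      have entry: "co (lab \<sigma> a) (sec N W y) = W (lab \<sigma> a) (lab \<sigma> a) * co a x" if \<sigma>: "\<sigma> \<in> perms" for \<sigma>
      proof -
        note S = sec_oper[OF bW D, of N]
        have "co (lab \<sigma> a) (sec N W y) = (\<Sum>b\<in>box K. co b v * (\<Sum>\<tau>\<in>perms. co (lab \<sigma> a) (sec N W (e (lab \<tau> b)))))"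
          unfolding y_eq
          by (simp add: oper_sum[OF S] oper_scale[OF S] X_scale X_sum e_X co_sum co_scale oper_X[OF S])
        also have "\<dots> = (\<Sum>b\<in>box K. co b v * (W (lab \<sigma> a) (lab \<sigma> a) * co a (e b)))"
        proof (intro sum.cong refl arg_cong2[of _ _ _ _ "(*)"])
          fix b assume b: "b \<in> box K"
          have "(\<Sum>\<tau>\<in>perms. co (lab \<sigma> a) (sec N W (e (lab \<tau> b))))
            = (\<Sum>\<tau>\<in>perms. if \<tau> = \<sigma> then W (lab \<sigma> a) (lab \<sigma> a) * co a (e b) else 0)"
          proof (rule sum.cong[OF refl])
            fix \<tau> assume \<tau>: "\<tau> \<in> perms"
            have "co (lab \<sigma> a) (sec N W (e (lab \<tau> b))) = W (lab \<sigma> a) (lab \<tau> b)"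
              by (rule co_sec_e[OF _ _ loc]) (use N \<sigma> \<tau> a b in auto)
            then show "co (lab \<sigma> a) (sec N W (e (lab \<tau> b)))
              = (if \<tau> = \<sigma> then W (lab \<sigma> a) (lab \<sigma> a) * co a (e b) else 0)"
              using lab_entry[OF bW D W \<sigma> \<tau>, of a b] by (auto simp: co_e)
          qed
          also have "\<dots> = W (lab \<sigma> a) (lab \<sigma> a) * co a (e b)" using finite_perms \<sigma> by simp
          finally show "(\<Sum>\<tau>\<in>perms. co (lab \<sigma> a) (sec N W (e (lab \<tau> b)))) = W (lab \<sigma> a) (lab \<sigma> a) * co a (e b)" .
        qed
        also have "\<dots> = W (lab \<sigma> a) (lab \<sigma> a) * (\<Sum>b\<in>box K. co b v * co a (e b))"
          by (simp add: sum_distrib_left mult.left_commute)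
        also have "(\<Sum>b\<in>box K. co b v * co a (e b)) = co a x"
          unfolding x_def proj_def by (simp add: co_sum X_scale e_X co_scale)
        finally show ?thesis .
      qed
      have QX: "Q y \<in> X" by (rule oper_X[OF Q yX])
      have "co a (read_all (Q y)) = (\<Sum>\<sigma>\<in>perms. co (lab \<sigma> a) (sec N W y + z))"
        unfolding co_read_all[OF QX] sec_eq[symmetric]
        by (intro sum.cong refl co_oper[OF Q yX yN]) (use N a in auto)
      also have "\<dots> = (\<Sum>\<sigma>\<in>perms. W (lab \<sigma> a) (lab \<sigma> a)) * co a x + co a (read_all z)"
        by (simp add: co_add oper_X[OF sec_oper[OF bW D] yX] zX entry sum.distrib sum_distrib_right co_read_all)
      also have "(\<Sum>\<sigma>\<in>perms. W (lab \<sigma> a) (lab \<sigma> a)) = s" unfolding s_def by (rule perm_sum[OF W])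
      finally have *: "co a (read_all (Q y)) = s * co a x + co a (read_all z)" .
      have "co a (F x) = co a (read_all (Q y)) - s * co a x"
        unfolding F_def y_def[symmetric] by (simp add: co_diff RX QX X_scale x co_scale)
      then show ?thesis using * by simp
    qed
    then have "proj L (F x) = proj L (read_all z)" by (simp add: proj_def)
    then have "norm (proj L (F x)) \<le> norm (read_all z)" using proj_norm[OF RX[OF zX], of L] by simp
    also have "\<dots> \<le> m * norm z" unfolding m_def by (rule oper_norm[OF read_all_oper zX])
    also have "\<dots> \<le> m * (\<epsilon> * norm y)"
      unfolding z_def m_def by (intro mult_left_mono bndD[OF err yX]) simp
    also have "\<dots> \<le> m * (\<epsilon> * (m * norm x))"
      unfolding y_def m_def by (intro mult_left_mono oper_norm[OF spread_all_oper x] \<epsilon>) simp_all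
    finally show ?thesis unfolding x_def by (simp add: mult.assoc)
  qed
  have "norm (F (proj K v)) \<le> m * \<epsilon> * m * norm (proj K v)" for K
    by (rule LIMSEQ_le_const2[OF tendsto_norm[OF proj_tendsto]])
      (use fin in \<open>auto intro: oper_X[OF F] proj_X v\<close>)
  then have "norm (F v) \<le> m * \<epsilon> * m * norm v"
    by (intro LIMSEQ_le[OF tendsto_norm[OF oper_tendsto[OF F v proj_X[OF v] proj_tendsto[OF v]]]
          tendsto_mult_left[OF tendsto_norm[OF proj_tendsto[OF v]]]]) auto
  then show ?thesis by (simp only: F_def s_def m_def)
qed

lemma factor_identity:
  assumes T: "oper C T"
  obtains A B a b where "oper a A" "oper b B"
    "(\<forall>v\<in>X. B (T (A v)) = v) \<or> (\<forall>v\<in>X. B (A v - T (A v)) = v)"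
proof -
  define W where "W = spread n (mat T) 0 id"
  define m where "m = real (card perms)"
  define s where "s = (\<Sum>\<kappa>\<in>perms. W \<kappa> \<kappa>)"
  have m: "1 \<le> m" using perms_pos by (simp add: m_def)
  have W: "spreading n 0 W" unfolding W_def by (rule spread_spreading[OF mat_local mat_norm[OF T]])
  have bW: "bnd C W" unfolding W_def by (rule bnd_spread[OF T]) simp
  have C: "0 \<le> C" by (rule oper_nonneg[OF T])
  define \<epsilon> where "\<epsilon> = 1 / (4 * m * m)"
  have \<epsilon>: "0 < \<epsilon>" using m by (simp add: \<epsilon>_def)
  obtain g where g: "inj g" and err: "bnd \<epsilon> (\<lambda>a b. mat T (g \<circ> a) (g \<circ> b) - W a b)"
    using stabilise[OF T \<epsilon>] unfolding W_def by blast
  define Q where "Q v = res UNIV g (T (emb UNIV g v))" for v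
  have Q: "oper (1 * (C * 1)) Q"
    unfolding Q_def[abs_def] by (intro oper_comp[OF res_oper[OF g] oper_comp[OF T emb_oper]])
  have "mat Q a b = mat T (g \<circ> a) (g \<circ> b)" for a b
    by (simp add: mat_def Q_def co_res[OF g] oper_X[OF T] oper_X[OF emb_oper] e_X emb_e[OF g])
  then have err': "bnd \<epsilon> (\<lambda>a b. mat Q a b - W a b)" using err by simp
  define A where "A v = emb UNIV g (spread_all v)" for v
  have A: "oper (1 * m) A"
    unfolding A_def[abs_def] m_def by (rule oper_comp[OF emb_oper spread_all_oper])
  define R where "R v = read_all (res UNIV g (T (A v)))" for v
  have rr: "oper (m * 1) (\<lambda>w. read_all (res UNIV g w))"
    unfolding m_def by (rule oper_comp[OF read_all_oper res_oper[OF g]])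
  have R: "oper (m * 1 * (C * (1 * m))) R"
    unfolding R_def[abs_def] by (rule oper_comp[OF rr oper_comp[OF T A]])
  have near: "norm (R v - sc s v) \<le> 1 / 4 * norm v" if v: "v \<in> X" for v
  proof -
    have "norm (R v - sc s v) \<le> m * \<epsilon> * m * norm v"
      using read_spread_near_scalar[OF Q bW C W err' less_imp_le[OF \<epsilon>] v]
      by (simp add: R_def A_def Q_def s_def m_def)
    also have "m * \<epsilon> * m = 1 / 4" using m by (simp add: \<epsilon>_def)
    finally show ?thesis .
  qed
  show thesis
  proof (cases "1 / 2 \<le> norm s")
    case True
    have "norm (R v - sc s v) \<le> norm s / 2 * norm v" if "v \<in> X" for v
      using near[OF that] True mult_right_mono[of "1/4" "norm s / 2" "norm v"] by simp
    moreover have "s \<noteq> 0" using True by auto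
    ultimately obtain D S where S: "oper D S" "\<And>v. v \<in> X \<Longrightarrow> S (R v) = v"
      using left_inverse_near_scalar[OF R, of s] by metis
    show thesis
      by (rule that[OF A oper_comp[OF S(1) rr]]) (use S(2) in \<open>simp add: R_def\<close>)
  next
    case False
    define t where "t = of_nat (card perms) - s"
    have "m \<le> norm t + norm s"
      using norm_triangle_ineq[of t s] by (simp add: t_def m_def)
    then have t: "1 / 2 \<le> norm t" using False m by simp
    define R' where "R' v = read_all (res UNIV g (A v - T (A v)))" for v
    have R': "oper (m * 1 * (1 * m + C * (1 * m))) R'"
      unfolding R'_def[abs_def] by (rule oper_comp[OF rr oper_minus[OF A oper_comp[OF T A]]])
    have "norm (R' v - sc t v) \<le> norm t / 2 * norm v" if v: "v \<in> X" for v
    proof -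
      have AX: "A v \<in> X" "T (A v) \<in> X" using v by (simp_all add: oper_X[OF A] oper_X[OF T])
      have "R' v = read_all (res UNIV g (A v)) - R v"
        unfolding R'_def R_def by (rule oper_diff[OF rr AX])
      also have "read_all (res UNIV g (A v)) = sc (of_nat (card perms)) v"
        unfolding A_def res_emb[OF g oper_X[OF spread_all_oper v]] by (rule read_spread_all[OF v])
      finally have "R' v - sc t v = - (R v - sc s v)" by (simp add: t_def scale_left_diff_distrib)
      then have "norm (R' v - sc t v) \<le> 1 / 4 * norm v" using near[OF v] by (simp add: norm_minus_commute)
      then show ?thesis using t mult_right_mono[of "1/4" "norm t / 2" "norm v"] by simp
    qed
    moreover have "t \<noteq> 0" using t by auto
    ultimately obtain D S where S: "oper D S" "\<And>v. v \<in> X \<Longrightarrow> S (R' v) = v"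
      using left_inverse_near_scalar[OF R', of t] by metis
    show thesis
      by (rule that[OF A oper_comp[OF S(1) rr]]) (use S(2) in \<open>simp add: R'_def\<close>)
  qed
qed

section \<open>Block diagonal operators\<close>


definition mask :: "nat set \<Rightarrow> (nat \<Rightarrow> 'k) \<Rightarrow> nat \<Rightarrow> 'k" where
  "mask G y = (\<lambda>t. (if t \<in> G then 1 else 0) * y t)"

lemma mask_E: "y \<in> E \<Longrightarrow> mask G y \<in> E"
  using lp_scaled_reindex(1)[OF p1, of y "\<lambda>t. if t \<in> G then 1 else 0" 1 id] by (auto simp: mask_def inj_on_def)

lemma mask_mask: "mask G (mask H y) = mask (G \<inter> H) y"
  by (auto simp: mask_def)

lemma mask_split: "mask G y + mask (- G) y = y"
  by (auto simp: mask_def)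

definition flip :: "nat set \<Rightarrow> nat \<Rightarrow> 'x \<Rightarrow> 'x" where
  "flip G m = tensor_op id (\<lambda>j t. if (j = m \<or> j = Suc m) \<and> t \<in> G then -1 else 1) (\<lambda>_ t. t)"

lemma contractive_id: "(\<And>t. norm (c t) \<le> 1) \<Longrightarrow> contractive c (\<lambda>t. t)"
  by (simp add: contractive_def)

lemma flip_oper: "oper 1 (flip G m)"
  unfolding flip_def by (rule tensor_op(1)[OF permutes_id contractive_id]) simp

lemma flip_jt:
  assumes x: "tup x" and m: "Suc m < n"
  shows "flip G m (jt x) = jt (x(m := fscale (-1) (mask G (x m)) + mask (- G) (x m),
    Suc m := fscale (-1) (mask G (x (Suc m))) + mask (- G) (x (Suc m))))"
  unfolding flip_def
  by (subst tensor_op(2)[OF permutes_id contractive_id x], simp, rule jt_cong)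
    (auto simp: reindex_op_def mask_def fscale_def)

lemma jt_eq_add:
  assumes "tup x" "i < n" "y \<in> E" "z \<in> E" "x i = y + z"
  shows "jt x = jt (x(i := y)) + jt (x(i := z))"
  using jt_add[OF assms(1-4)] by (simp only: assms(5)[symmetric] fun_upd_triv)

lemma jt_neg:
  assumes "tup x" "i < n" "y \<in> E"
  shows "jt (x(i := fscale (-1) y)) = - jt (x(i := y))"
  using jt_scale[OF assms, of "-1"] by simp

primrec avg :: "nat set \<Rightarrow> nat \<Rightarrow> 'x \<Rightarrow> 'x" where
  "avg G 0 v = v"
| "avg G (Suc m) v = sc (1/2) (avg G m v + flip G m (avg G m v))"

lemma avg_oper: "oper 1 (avg G m)"
proof (induction m)
  case 0
  then show ?case using oper_id by (simp add: avg.simps(1)[abs_def])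
next
  case (Suc m)
  have "oper (norm (1/2 :: 'k) * (1 + 1 * 1)) (\<lambda>v. sc (1/2) (avg G m v + flip G m (avg G m v)))"
    by (intro oper_smult oper_plus Suc oper_comp[OF flip_oper])
  then show ?case by (simp add: norm_divide avg.simps(2)[abs_def])
qed

text \<open>Averaging over simultaneous sign changes on \<open>G\<close> in two neighbouring coordinates kills
  the components whose two coordinates lie on different sides of \<open>G\<close>.\<close>

lemma avg_jt:
  assumes x: "tup x"
  shows "m < n \<Longrightarrow> avg G m (jt x) =
    jt (\<lambda>i. if i \<le> m then mask G (x i) else x i) + jt (\<lambda>i. if i \<le> m then mask (- G) (x i) else x i)"
proof (induction m)
  case 0
  have x0: "x 0 \<in> E" by (rule tupD[OF x n0])
  have "jt x = jt (x(0 := mask G (x 0))) + jt (x(0 := mask (- G) (x 0)))"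
    by (rule jt_eq_add[OF x n0 mask_E[OF x0] mask_E[OF x0]]) (simp add: mask_split)
  moreover have "jt (x(0 := mask G (x 0))) = jt (\<lambda>i. if i \<le> 0 then mask G (x i) else x i)" for G
    by (rule jt_cong) auto
  ultimately show ?case by (simp only: avg.simps)
next
  case (Suc m)
  have m: "Suc m < n" "m < n" using Suc.prems by auto
  let ?y = "x (Suc m)"
  have y: "?y \<in> E" by (rule tupD[OF x m(1)])
  let ?w = "\<lambda>G i. if i \<le> m then mask G (x i) else x i"
  have w: "tup (?w G)" for G using x by (auto simp: tup_def mask_E)
  define a where "a H = jt ((?w H)(Suc m := mask G ?y))" for H
  define b where "b H = jt ((?w H)(Suc m := mask (- G) ?y))" for H
  have ab: "jt (?w H) = a H + b H" for H
    unfolding a_def b_def by (rule jt_eq_add[OF w m(1)]) (simp_all add: mask_E y mask_split)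
  let ?u = "fscale (-1) (mask G ?y) + mask (- G) ?y"
  have upd: "jt ((?w H)(Suc m := ?u)) = - a H + b H" for H
    unfolding a_def b_def
    by (simp only: jt_add[OF w m(1) lp_fscale(1)[OF p1 mask_E[OF y]] mask_E[OF y]] jt_neg[OF w m(1) mask_E[OF y]])
  have uE: "?u \<in> E"
  proof -
    have "?u = (\<lambda>t. (if t \<in> G then -1 else 1) * ?y t)" by (auto simp: fscale_def mask_def)
    then show ?thesis
      using lp_scaled_reindex(1)[OF p1 y, of "\<lambda>t. if t \<in> G then -1 else 1" 1 id] by auto
  qed
  have fl: "flip G m (jt (?w H)) = jt ((?w H)(m := fscale (-1) (mask G (mask H (x m))) + mask (- G) (mask H (x m)), Suc m := ?u))" for H
    using flip_jt[OF w m(1), of G H] by simp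
  have f1: "flip G m (jt (?w G)) = a G - b G"
  proof -
    have xm: "mask G (x m) \<in> E" by (rule mask_E[OF tupD[OF x m(2)]])
    have "fscale (-1) (mask G (mask G (x m))) + mask (- G) (mask G (x m)) = fscale (-1) (mask G (x m))"
      by (auto simp: mask_def fscale_def)
    then have "flip G m (jt (?w G)) = jt (((?w G)(Suc m := ?u))(m := fscale (-1) (mask G (x m))))"
      unfolding fl by (simp only: fun_upd_twist[of m "Suc m"] n_not_Suc_n not_False_eq_True)
    also have "\<dots> = - jt (((?w G)(Suc m := ?u))(m := mask G (x m)))"
      by (rule jt_neg[OF tup_upd[OF w uE] m(2) xm])
    also have "jt (((?w G)(Suc m := ?u))(m := mask G (x m))) = jt ((?w G)(Suc m := ?u))"
      by (rule jt_cong) auto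
    finally show ?thesis unfolding upd by simp
  qed
  have f2: "flip G m (jt (?w (- G))) = - a (- G) + b (- G)"
  proof -
    have "fscale (-1) (mask G (mask (- G) (x m))) + mask (- G) (mask (- G) (x m)) = mask (- G) (x m)"
      by (auto simp: mask_def fscale_def)
    then have "flip G m (jt (?w (- G))) = jt ((?w (- G))(m := mask (- G) (x m), Suc m := ?u))"
      unfolding fl by (simp only:)
    also have "\<dots> = jt ((?w (- G))(Suc m := ?u))" by (rule jt_cong) auto
    finally show ?thesis unfolding upd .
  qed
  have wX: "jt (?w H) \<in> X" for H by (rule jt_X[OF w])
  have half: "sc (1/2) (v + v) = v" for v
    by (simp add: scale_right_distrib flip: scale_left_distrib)
  have "avg G (Suc m) (jt x) = sc (1/2) ((jt (?w G) + jt (?w (- G))) + (flip G m (jt (?w G)) + flip G m (jt (?w (- G)))))"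
    by (simp only: avg.simps Suc.IH[OF m(2)] oper_add[OF flip_oper wX wX])
  also have "\<dots> = sc (1/2) ((jt (?w G) + jt (?w (- G))) + ((a G - b G) + (- a (- G) + b (- G))))"
    by (simp only: f1 f2)
  also have "\<dots> = sc (1/2) ((a G + b (- G)) + (a G + b (- G)))"
    unfolding ab by (rule arg_cong[of _ _ "sc (1/2)"]) simp
  also have "\<dots> = a G + b (- G)" by (rule half)
  also have "a G = jt (\<lambda>i. if i \<le> Suc m then mask G (x i) else x i)"
    unfolding a_def by (rule jt_cong) auto
  also have "b (- G) = jt (\<lambda>i. if i \<le> Suc m then mask (- G) (x i) else x i)"
    unfolding b_def by (rule jt_cong) auto
  finally show ?case .
qed

definition block :: "nat \<Rightarrow> nat set" where
  "block k = {s. fst (prod_decode s) = k}"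

definition rest :: "nat \<Rightarrow> nat set" where
  "rest K = {s. K \<le> fst (prod_decode s)}"

primrec bdiag :: "nat \<Rightarrow> 'x \<Rightarrow> 'x" where
  "bdiag 0 v = v"
| "bdiag (Suc K) v = avg (block K) (n - 1) (bdiag K v)"

lemma bdiag_oper: "oper 1 (bdiag K)"
proof (induction K)
  case 0
  then show ?case using oper_id by (simp add: bdiag.simps(1)[abs_def])
next
  case (Suc K)
  have "oper (1 * 1) (\<lambda>v. avg (block K) (n - 1) (bdiag K v))"
    by (intro oper_comp avg_oper Suc)
  then show ?case by (simp add: bdiag.simps(2)[abs_def])
qed

lemma jt_mask_0:
  assumes "tup x" "\<And>i. i < n \<Longrightarrow> mask G (x i) = (\<lambda>t. 0)"
  shows "jt (\<lambda>i. mask G (x i)) = 0"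
proof (rule jt_eq_0[OF _ n0])
  show "tup (\<lambda>i. mask G (x i))" using assms(1) mask_E unfolding tup_def by blast
qed (rule assms(2)[OF n0])

lemma bdiag_jt:
  assumes x: "tup x"
  shows "bdiag K (jt x) = (\<Sum>k<K. jt (\<lambda>i. mask (block k) (x i))) + jt (\<lambda>i. mask (rest K) (x i))"
proof (induction K)
  case 0
  have "mask (rest 0) y = y" for y by (auto simp: mask_def rest_def)
  then show ?case by simp
next
  case (Suc K)
  have tm: "tup (\<lambda>i. mask H (x i))" for H using x by (simp add: tup_def mask_E)
  have av: "avg (block K) (n - 1) (jt (\<lambda>i. mask H (x i)))
    = jt (\<lambda>i. mask (block K \<inter> H) (x i)) + jt (\<lambda>i. mask (- block K \<inter> H) (x i))" for H
  proof -
    have le: "i < n \<Longrightarrow> i \<le> n - Suc 0" for i by simp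
    show ?thesis
      unfolding avg_jt[OF tm diff_less[OF zero_less_one n0]]
      by (intro arg_cong2[of _ _ _ _ "(+)"] jt_cong) (simp_all add: le mask_mask)
  qed
  have e1: "avg (block K) (n - 1) (jt (\<lambda>i. mask (block k) (x i))) = jt (\<lambda>i. mask (block k) (x i))" if "k < K" for k
  proof -
    have "block K \<inter> block k = {}" "- block K \<inter> block k = block k" using that by (auto simp: block_def)
    moreover have "jt (\<lambda>i. mask {} (x i)) = 0" by (rule jt_mask_0[OF x]) (simp add: mask_def)
    ultimately show ?thesis unfolding av by (simp only: add_0)
  qed
  have e2: "avg (block K) (n - 1) (jt (\<lambda>i. mask (rest K) (x i)))
      = jt (\<lambda>i. mask (block K) (x i)) + jt (\<lambda>i. mask (rest (Suc K)) (x i))"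
  proof -
    have "block K \<inter> rest K = block K" "- block K \<inter> rest K = rest (Suc K)"
      by (auto simp: block_def rest_def)
    then show ?thesis unfolding av by (simp only:)
  qed
  have tX: "jt (\<lambda>i. mask H (x i)) \<in> X" for H by (rule jt_X[OF tm])
  have "bdiag (Suc K) (jt x) = (\<Sum>k<K. avg (block K) (n - 1) (jt (\<lambda>i. mask (block k) (x i))))
      + avg (block K) (n - 1) (jt (\<lambda>i. mask (rest K) (x i)))"
    by (simp add: Suc oper_add[OF avg_oper] oper_sum[OF avg_oper] X_sum tX)
  also have "(\<Sum>k<K. avg (block K) (n - 1) (jt (\<lambda>i. mask (block k) (x i)))) = (\<Sum>k<K. jt (\<lambda>i. mask (block k) (x i)))"
    by (intro sum.cong refl e1) simp
  finally show ?case unfolding e2 by (simp add: add.assoc)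
qed

definition iota :: "nat \<Rightarrow> 'x \<Rightarrow> 'x" where
  "iota k = tensor_op id (\<lambda>_ s. if fst (prod_decode s) = k then 1 else 0) (\<lambda>_ s. snd (prod_decode s))"

definition pr :: "nat \<Rightarrow> 'x \<Rightarrow> 'x" where
  "pr k = tensor_op id (\<lambda>_ t. 1) (\<lambda>_ t. prod_encode (k, t))"

lemma iota: "oper 1 (iota k)" "tup x \<Longrightarrow> iota k (jt x) = jt (\<lambda>i. block_embed k (x i))"
proof -
  have *: "contractive (\<lambda>s. if fst (prod_decode s) = k then 1 else 0) (\<lambda>s. snd (prod_decode s))"
    using inj_on_block[of k] by (simp add: contractive_def)
  show "oper 1 (iota k)" unfolding iota_def by (rule tensor_op(1)[OF permutes_id *])
  show "tup x \<Longrightarrow> iota k (jt x) = jt (\<lambda>i. block_embed k (x i))"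
    unfolding iota_def by (subst tensor_op(2)[OF permutes_id *]) (auto simp: reindex_op_def block_embed_def)
qed

lemma pr: "oper 1 (pr k)" "tup x \<Longrightarrow> pr k (jt x) = jt (\<lambda>i. block_coord k (x i))"
proof -
  have *: "contractive (\<lambda>t. 1) (\<lambda>t. prod_encode (k, t))"
    by (simp add: contractive_def inj_block)
  show "oper 1 (pr k)" unfolding pr_def by (rule tensor_op(1)[OF permutes_id *])
  show "tup x \<Longrightarrow> pr k (jt x) = jt (\<lambda>i. block_coord k (x i))"
    unfolding pr_def by (subst tensor_op(2)[OF permutes_id *]) (auto simp: reindex_op_def block_coord_def)
qed

lemma norm_sum_iota_jt:
  assumes y: "\<And>k. k < K \<Longrightarrow> tup (y k)"
  shows "norm (\<Sum>k<K. iota k (jt (y k))) \<le> (\<Prod>i<n. (\<Sum>k<K. lp_norm p (y k i) powr p) powr (1/p))"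
proof -
  define x where "x i = block_glue K (\<lambda>k. y k i)" for i
  have xE: "x i \<in> E" "lp_norm p (x i) \<le> (\<Sum>k<K. lp_norm p (y k i) powr p) powr (1/p)" if "i < n" for i
    unfolding x_def using y that by (intro block_glue_lp p1; simp add: tup_def)+
  have x: "tup x" using xE by (simp add: tup_def)
  have "jt (\<lambda>i. mask (rest K) (x i)) = 0"
    by (rule jt_mask_0[OF x]) (auto simp: mask_def rest_def x_def block_glue_def)
  moreover have "jt (\<lambda>i. mask (block k) (x i)) = iota k (jt (y k))" if "k < K" for k
    unfolding iota(2)[OF y[OF that]] using that
    by (intro jt_cong) (auto simp: mask_def block_def x_def block_glue_def block_embed_def)
  ultimately have "bdiag K (jt x) = (\<Sum>k<K. iota k (jt (y k)))"
    by (simp add: bdiag_jt[OF x])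
  then have "norm (\<Sum>k<K. iota k (jt (y k))) \<le> norm (jt x)"
    using oper_norm[OF bdiag_oper jt_X[OF x], of K] by simp
  also have "\<dots> \<le> pnorm x" by (rule jt_norm[OF x])
  also have "\<dots> \<le> (\<Prod>i<n. (\<Sum>k<K. lp_norm p (y k i) powr p) powr (1/p))"
    unfolding pnorm_def using xE by (intro prod_mono) auto
  finally show ?thesis .
qed

lemma jt_scale_all:
  assumes x: "tup x"
  shows "jt (\<lambda>i. fscale (c i) (x i)) = sc (\<Prod>i<n. c i) (jt x)"
proof -
  have "m \<le> n \<Longrightarrow> jt (\<lambda>i. if i < m then fscale (c i) (x i) else x i) = sc (\<Prod>i<m. c i) (jt x)" for m
  proof (induction m)
    case 0
    then show ?case by simp
  next
    case (Suc m)
    then have m: "m < n" by simp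
    have xm: "x m \<in> E" by (rule tupD[OF x m])
    let ?w = "\<lambda>i. if i < m then fscale (c i) (x i) else x i"
    have w: "tup ?w" using x by (auto simp: tup_def lp_fscale p1)
    have "jt (\<lambda>i. if i < Suc m then fscale (c i) (x i) else x i) = jt (?w(m := fscale (c m) (x m)))"
      by (rule jt_cong) auto
    also have "\<dots> = sc (c m) (jt (?w(m := x m)))" by (rule jt_scale[OF w m xm])
    also have "jt (?w(m := x m)) = jt ?w" by (rule jt_cong) auto
    also have "\<dots> = sc (\<Prod>i<m. c i) (jt x)" using Suc by simp
    finally show ?case by (simp add: mult.commute)
  qed
  from this[OF order_refl] have "jt (\<lambda>i. if i < n then fscale (c i) (x i) else x i) = sc (\<Prod>i<n. c i) (jt x)" .
  moreover have "jt (\<lambda>i. if i < n then fscale (c i) (x i) else x i) = jt (\<lambda>i. fscale (c i) (x i))"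
    by (rule jt_cong) simp
  ultimately show ?thesis by simp
qed

text \<open>This holds because the ball of radius \<open>\<Prod>z\<close> is the closed convex hull of the elementary
  tensors whose factors have norms at most \<open>z i\<close>.\<close>

lemma ball_convex_hull:
  assumes Q: "oper 1 Q" and z: "\<And>i. i < n \<Longrightarrow> 0 \<le> z i"
    and le: "\<And>y. tup y \<Longrightarrow> (\<And>i. i < n \<Longrightarrow> lp_norm p (y i) \<le> z i) \<Longrightarrow> norm (w + Q (jt y)) \<le> Z"
    and v: "v \<in> X" "norm v \<le> (\<Prod>i<n. z i)"
  shows "norm (w + Q v) \<le> Z"
proof -
  define \<rho> where "\<rho> = (\<Prod>i<n. z i)"
  have zero_E: "(\<lambda>t. 0) \<in> E" by (simp add: lp_space_iff)
  have zero_tup: "tup (\<lambda>i t. 0)" by (simp add: tup_def zero_E)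
  have jt0: "jt (\<lambda>i t. 0) = 0" by (rule jt_eq_0[OF zero_tup n0]) simp
  have w: "norm w \<le> Z"
    using le[OF zero_tup] z by (simp add: jt0 oper_0[OF Q] lp_norm_def)
  then have Z: "0 \<le> Z" using norm_ge_zero order_trans by blast
  show ?thesis
  proof (cases "\<rho> = 0")
    case True
    then have "v = 0" using v(2)[folded \<rho>_def] by simp
    then show ?thesis using w by (simp add: oper_0[OF Q])
  next
    case False
    then have z0: "0 < z i" if "i < n" for i
      using that z[OF that] by (auto simp: \<rho>_def less_le)
    have \<rho>: "0 < \<rho>" unfolding \<rho>_def using z0 by (intro prod_pos) auto
    have elem: "norm ((pnorm x / \<rho>) *\<^sub>R w + Q (jt x)) \<le> pnorm x / \<rho> * Z" if x: "tup x" for x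
    proof (cases "pnorm x = 0")
      case True
      then have "jt x = 0" using jt_norm[OF x] by simp
      then show ?thesis using True by (simp add: oper_0[OF Q])
    next
      case False
      then have nz: "lp_norm p (x i) \<noteq> 0" if "i < n" for i using that by (auto simp: pnorm_def)
      define y where "y i = fscale (of_real (z i / lp_norm p (x i))) (x i)" for i
      have y: "tup y" using x by (simp add: y_def tup_def lp_fscale p1)
      have yz: "lp_norm p (y i) \<le> z i" if "i < n" for i
        unfolding y_def using lp_fscale(2)[OF p1 tupD[OF x that]] nz[OF that] z[OF that] by (simp add: norm_divide)
      have "jt y = sc (\<Prod>i<n. of_real (z i / lp_norm p (x i))) (jt x)"
        unfolding y_def by (rule jt_scale_all[OF x])
      also have "(\<Prod>i<n. of_real (z i / lp_norm p (x i))) = (of_real (\<rho> / pnorm x) :: 'k)"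
        unfolding \<rho>_def pnorm_def by (simp add: prod_dividef flip: of_real_prod)
      finally have "jt y = (\<rho> / pnorm x) *\<^sub>R jt x" by (simp only: scale_of_real)
      then have "jt x = (pnorm x / \<rho>) *\<^sub>R jt y" using False \<rho> by simp
      then have "Q (jt x) = (pnorm x / \<rho>) *\<^sub>R Q (jt y)"
        using oper_scale[OF Q jt_X[OF y], of "of_real (pnorm x / \<rho>)"] by (simp only: scale_of_real)
      then have "norm ((pnorm x / \<rho>) *\<^sub>R w + Q (jt x)) = norm ((pnorm x / \<rho>) *\<^sub>R (w + Q (jt y)))"
        by (simp only: scaleR_add_right)
      also have "\<dots> = pnorm x / \<rho> * norm (w + Q (jt y))" using \<rho> by simp
      also have "\<dots> \<le> pnorm x / \<rho> * Z"
        using \<rho> by (intro mult_left_mono le[OF y yz]) auto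
      finally show ?thesis .
    qed
    show ?thesis
    proof (rule field_le_epsilon)
      fix \<delta> :: real assume \<delta>: "0 < \<delta>"
      define \<epsilon> where "\<epsilon> = \<delta> / (2 * Z + 1)"
      have \<epsilon>: "0 < \<epsilon>" using \<delta> Z by (simp add: \<epsilon>_def)
      have "norm v < \<rho> * (1 + \<epsilon>)" using v(2)[folded \<rho>_def] mult_pos_pos[OF \<rho> \<epsilon>] by (simp add: distrib_left)
      then obtain xs where xs: "\<And>x. x \<in> set xs \<Longrightarrow> tup x" "norm (v - (\<Sum>x\<leftarrow>xs. jt x)) < \<epsilon>"
        "(\<Sum>x\<leftarrow>xs. pnorm x) < \<rho> * (1 + \<epsilon>)"
        using jt_approx[OF v(1) _ \<epsilon>] by metis
      let ?s = "\<Sum>x\<leftarrow>xs. jt x"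
      define \<Lambda> where "\<Lambda> = (\<Sum>x\<leftarrow>xs. pnorm x / \<rho>)"
      have "\<Lambda> = (\<Sum>x\<leftarrow>xs. pnorm x) / \<rho>" unfolding \<Lambda>_def by (induction xs) (auto simp: add_divide_distrib)
      also have "\<dots> \<le> \<rho> * (1 + \<epsilon>) / \<rho>" using xs(3) \<rho> by (intro divide_right_mono) auto
      finally have \<Lambda>1: "\<Lambda> \<le> 1 + \<epsilon>" using \<rho> by simp
      have \<Lambda>0: "0 \<le> \<Lambda>" unfolding \<Lambda>_def using \<rho> by (intro sum_list_nonneg) auto
      have s: "?s \<in> X" using xs(1) by (intro X_sum_list jt_X)
      have "(\<And>x. x \<in> set ys \<Longrightarrow> tup x) \<Longrightarrow>
        norm ((\<Sum>x\<leftarrow>ys. pnorm x / \<rho>) *\<^sub>R w + (\<Sum>x\<leftarrow>ys. Q (jt x))) \<le> (\<Sum>x\<leftarrow>ys. pnorm x / \<rho>) * Z" for ys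
      proof (induction ys)
        case (Cons x ys)
        have "norm ((pnorm x / \<rho> + (\<Sum>x\<leftarrow>ys. pnorm x / \<rho>)) *\<^sub>R w + (Q (jt x) + (\<Sum>x\<leftarrow>ys. Q (jt x))))
          = norm (((pnorm x / \<rho>) *\<^sub>R w + Q (jt x)) + ((\<Sum>x\<leftarrow>ys. pnorm x / \<rho>) *\<^sub>R w + (\<Sum>x\<leftarrow>ys. Q (jt x))))"
          by (simp only: scaleR_add_left add.assoc add.left_commute)
        also have "\<dots> \<le> pnorm x / \<rho> * Z + (\<Sum>x\<leftarrow>ys. pnorm x / \<rho>) * Z"
          using Cons by (intro norm_triangle_mono elem) auto
        finally show ?case by (simp add: distrib_right)
      qed simp
      from this[OF xs(1)] have "norm (\<Lambda> *\<^sub>R w + Q ?s) \<le> \<Lambda> * Z"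
        unfolding \<Lambda>_def by (subst oper_sum_list[OF Q]) (auto intro: jt_X xs(1))
      then have 1: "norm (w + Q ?s) \<le> \<Lambda> * Z + \<bar>1 - \<Lambda>\<bar> * norm w"
      proof -
        have "w + Q ?s = (\<Lambda> *\<^sub>R w + Q ?s) + (1 - \<Lambda>) *\<^sub>R w" by (simp add: algebra_simps)
        then have "norm (w + Q ?s) \<le> norm (\<Lambda> *\<^sub>R w + Q ?s) + norm ((1 - \<Lambda>) *\<^sub>R w)"
          by (metis norm_triangle_ineq)
        then show ?thesis using \<open>norm (\<Lambda> *\<^sub>R w + Q ?s) \<le> \<Lambda> * Z\<close> by simp
      qed
      have 2: "\<Lambda> * Z + \<bar>1 - \<Lambda>\<bar> * norm w \<le> (1 + 2 * \<epsilon>) * Z"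
      proof -
        have "\<Lambda> * Z + \<bar>1 - \<Lambda>\<bar> * norm w \<le> (\<Lambda> + \<bar>1 - \<Lambda>\<bar>) * Z"
          using w by (simp add: distrib_right mult_left_mono)
        also have "\<dots> \<le> (1 + 2 * \<epsilon>) * Z" using \<Lambda>1 \<epsilon> Z by (intro mult_right_mono) auto
        finally show ?thesis .
      qed
      have eq: "w + Q v = (w + Q ?s) + Q (v - ?s)" by (simp add: oper_diff[OF Q v(1) s])
      have "norm (w + Q v) \<le> norm (w + Q ?s) + norm (Q (v - ?s))"
        unfolding eq by (rule norm_triangle_ineq)
      moreover have "norm (Q (v - ?s)) \<le> \<epsilon>" using oper_norm[OF Q X_diff[OF v(1) s]] xs(2) by simp
      ultimately have "norm (w + Q v) \<le> (1 + 2 * \<epsilon>) * Z + \<epsilon>"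
        using 1 2 by linarith
      also have "\<dots> = Z + \<epsilon> * (2 * Z + 1)" by (simp add: algebra_simps)
      also have "\<epsilon> * (2 * Z + 1) = \<delta>" using Z by (simp add: \<epsilon>_def)
      finally show "norm (w + Q v) \<le> Z + \<delta>" .
    qed
  qed
qed

lemma norm_sum_iota:
  assumes z: "\<And>i k. i < n \<Longrightarrow> k < K \<Longrightarrow> 0 \<le> z i k"
    and v: "\<And>k. k < K \<Longrightarrow> v k \<in> X \<and> norm (v k) \<le> (\<Prod>i<n. z i k)"
  shows "norm (\<Sum>k<K. iota k (v k)) \<le> (\<Prod>i<n. (\<Sum>k<K. z i k powr p) powr (1/p))" (is "_ \<le> ?Z")
proof -
  define elt where "elt k u \<longleftrightarrow> (\<exists>y. tup y \<and> (\<forall>i<n. lp_norm p (y i) \<le> z i k) \<and> u = jt y)" for k u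
  have "m \<le> K \<Longrightarrow> (\<And>k. k < m \<Longrightarrow> v k \<in> X \<and> norm (v k) \<le> (\<Prod>i<n. z i k)) \<Longrightarrow>
    (\<And>k. m \<le> k \<Longrightarrow> k < K \<Longrightarrow> elt k (v k)) \<Longrightarrow> norm (\<Sum>k<K. iota k (v k)) \<le> ?Z" for m v
  proof (induction m arbitrary: v)
    case 0
    then have "\<forall>k. \<exists>y. k < K \<longrightarrow> tup y \<and> (\<forall>i<n. lp_norm p (y i) \<le> z i k) \<and> v k = jt y"
      by (auto simp: elt_def)
    then obtain y where y: "\<And>k. k < K \<Longrightarrow> tup (y k) \<and> (\<forall>i<n. lp_norm p (y k i) \<le> z i k) \<and> v k = jt (y k)"
      by metis
    have "norm (\<Sum>k<K. iota k (v k)) = norm (\<Sum>k<K. iota k (jt (y k)))"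
      using y by (intro arg_cong[of _ _ norm] sum.cong) auto
    also have "\<dots> \<le> (\<Prod>i<n. (\<Sum>k<K. lp_norm p (y k i) powr p) powr (1/p))"
      by (rule norm_sum_iota_jt) (use y in blast)
    also have "\<dots> \<le> ?Z"
      using y p1 by (intro prod_mono conjI powr_mono2 sum_mono) (auto intro!: sum_nonneg)
    finally show ?case .
  next
    case (Suc m)
    have m: "m < K" using Suc.prems(1) by simp
    define w where "w = (\<Sum>k\<in>{..<K}-{m}. iota k (v k))"
    have split: "(\<Sum>k<K. iota k ((v(m := u)) k)) = w + iota m u" for u
      unfolding w_def using m by (subst sum.remove[of _ m]) (auto simp: add.commute)
    have "norm (w + iota m (v m)) \<le> ?Z"
    proof (rule ball_convex_hull[OF iota(1), of "\<lambda>i. z i m"])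
      show "v m \<in> X" "norm (v m) \<le> (\<Prod>i<n. z i m)" using Suc.prems(2)[of m] by auto
      show "0 \<le> z i m" if "i < n" for i using z that m by simp
      show "norm (w + iota m (jt y)) \<le> ?Z" if y: "tup y" "\<And>i. i < n \<Longrightarrow> lp_norm p (y i) \<le> z i m" for y
        unfolding split[symmetric]
      proof (rule Suc.IH)
        show "elt k ((v(m := jt y)) k)" if "m \<le> k" "k < K" for k
          using that y Suc.prems(3)[of k] by (cases "k = m") (auto simp: elt_def)
      qed (use Suc.prems m in auto)
    qed
    then show ?case using split[of "v m"] by simp
  qed
  from this[of K v] v show ?thesis by auto
qed

definition Phi :: "nat \<Rightarrow> ('x \<Rightarrow> 'x) \<Rightarrow> 'x \<Rightarrow> 'x" where
  "Phi K S v = (\<Sum>k<K. iota k (S (pr k v)))"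

lemma Phi_oper:
  assumes S: "oper C S"
  shows "oper (C + 1) (Phi K S)"
proof -
  have crude: "oper (\<Sum>k<K. 1 * (C * 1)) (Phi K S)"
    unfolding Phi_def[abs_def] by (intro oper_sum_fun oper_comp[OF iota(1) oper_comp[OF S pr(1)]]) simp
  define D where "D = C + 1"
  have D: "0 < D" "C \<le> D" using oper_nonneg[OF S] by (simp_all add: D_def)
  have "norm (Phi K S (jt x)) \<le> D * pnorm x" if x: "tup x" for x
  proof -
    define v where "v k = sc (of_real (1 / D)) (S (pr k (jt x)))" for k
    have prX: "pr k (jt x) \<in> X" for k by (rule oper_X[OF pr(1) jt_X[OF x]])
    have SX: "S (pr k (jt x)) \<in> X" for k by (rule oper_X[OF S prX])
    have bt: "tup (\<lambda>i. block_coord k (x i))" for k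
      using x by (simp add: tup_def block_coord_lp p1)
    have v: "v k \<in> X \<and> norm (v k) \<le> (\<Prod>i<n. lp_norm p (block_coord k (x i)))" for k
    proof
      show "v k \<in> X" unfolding v_def by (rule X_scale[OF SX])
      have "norm (S (pr k (jt x))) \<le> D * norm (pr k (jt x))"
        using oper_norm[OF oper_mono[OF S D(2)] prX] .
      also have "\<dots> \<le> D * pnorm (\<lambda>i. block_coord k (x i))"
        unfolding pr(2)[OF x] using D jt_norm[OF bt] by (intro mult_left_mono) auto
      finally show "norm (v k) \<le> (\<Prod>i<n. lp_norm p (block_coord k (x i)))"
        using D by (simp add: v_def norm_scale norm_divide pnorm_def field_simps)
    qed
    have "norm (\<Sum>k<K. iota k (v k)) \<le> (\<Prod>i<n. (\<Sum>k<K. lp_norm p (block_coord k (x i)) powr p) powr (1/p))"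
      by (rule norm_sum_iota) (use v in auto)
    also have "\<dots> \<le> (\<Prod>i<n. (lp_norm p (x i) powr p) powr (1/p))"
      using p1 x by (intro prod_mono conjI powr_mono2 sum_lp_norm_block_coord_le)
        (auto intro!: sum_nonneg simp: tup_def)
    also have "\<dots> = pnorm x" using p1 by (simp add: pnorm_def powr_powr)
    finally have "norm (\<Sum>k<K. iota k (v k)) \<le> pnorm x" .
    moreover have "(\<Sum>k<K. iota k (v k)) = sc (of_real (1 / D)) (Phi K S (jt x))"
      unfolding Phi_def v_def by (simp only: oper_scale[OF iota(1) SX] scale_sum_right)
    ultimately show ?thesis using D by (simp add: norm_scale norm_divide field_simps)
  qed
  then have "norm (Phi K S v) \<le> (C + 1) * norm v" if "v \<in> X" for v
    using norm_le_from_jt[OF oper_bl[OF crude], of "C + 1" v] D that by (simp add: D_def)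
  then show ?thesis using crude oper_nonneg[OF S] by (auto simp: oper_def bounded_linear_on_def)
qed

lemma tup_block: "tup x \<Longrightarrow> tup (\<lambda>i. block_embed k (x i))" "tup x \<Longrightarrow> tup (\<lambda>i. block_coord k (x i))"
  by (simp_all add: tup_def block_embed_lp block_coord_lp p1)

lemma jt_zero_fun: "jt (\<lambda>i t. 0) = 0"
  by (rule jt_eq_0[OF _ n0]) (simp_all add: tup_def lp_space_iff)

lemma pr_iota:
  assumes v: "v \<in> X"
  shows "pr j (iota k v) = (if j = k then v else 0)"
proof (rule oper_eqI[OF oper_comp[OF pr(1) iota(1)] _ _ v])
  show "oper 1 (\<lambda>v. if j = k then v else 0)"
    using oper_id oper_mono[OF oper_zero, of 1] by (cases "j = k") simp_all
  show "pr j (iota k (jt x)) = (if j = k then jt x else 0)" if x: "tup x" for x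
  proof -
    have "block_coord j (block_embed k y) = (if j = k then y else (\<lambda>t. 0))" for y :: "nat \<Rightarrow> 'k"
      by (auto simp: block_coord_def block_embed_def)
    then show ?thesis
      using x by (simp add: iota(2) pr(2) tup_block jt_zero_fun)
  qed
qed

lemma pr_e:
  assumes "k \<noteq> fst (prod_decode (a 0))"
  shows "pr k (e a) = 0"
  unfolding e_def pr(2)[OF tup_unit]
proof (rule jt_eq_0[OF tup_block(2)[OF tup_unit] n0])
  show "block_coord k (unit_seq (a 0)) = (\<lambda>t. 0)"
    using assms by (auto simp: block_coord_def unit_seq_def fun_eq_iff) (metis fst_conv prod_encode_inverse)
qed

lemma Phi_Cauchy:
  assumes S: "oper C S" and v: "v \<in> X"
  shows "Cauchy (\<lambda>K. Phi K S v)"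
proof (rule CauchyI)
  note P = Phi_oper[OF S]
  fix \<epsilon> :: real assume \<epsilon>: "0 < \<epsilon>"
  define D where "D = C + 1"
  have D: "0 < D" using oper_nonneg[OF S] by (simp add: D_def)
  have d: "0 < \<epsilon> / (2 * D)" using D \<epsilon> by simp
  obtain N where N: "norm (v - proj N v) < \<epsilon> / (2 * D)" using proj_approx[OF v d] by metis
  define K0 where "K0 = Suc (\<Sum>a\<in>box N. fst (prod_decode (a 0)))"
  have e: "Phi K S (e a) = Phi K0 S (e a)" if K: "K0 \<le> K" and a: "a \<in> box N" for K a
  proof -
    have lt: "fst (prod_decode (a 0)) < K0"
      unfolding K0_def using member_le_sum[OF a, of "\<lambda>a. fst (prod_decode (a 0))"] by simp
    have "(\<Sum>k<K. iota k (S (pr k (e a)))) = (\<Sum>k<K0. iota k (S (pr k (e a))))"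
    proof (rule sum.mono_neutral_right)
      show "\<forall>k\<in>{..<K} - {..<K0}. iota k (S (pr k (e a))) = 0"
        using lt by (auto simp: pr_e oper_0[OF S] oper_0[OF iota(1)])
    qed (use K in auto)
    then show ?thesis by (simp add: Phi_def)
  qed
  have pv: "Phi K S (proj N v) = Phi K0 S (proj N v)" if K: "K0 \<le> K" for K
    unfolding proj_def by (simp add: oper_sum[OF P] oper_scale[OF P] X_scale e_X e[OF K])
  have pX: "proj N v \<in> X" by (rule proj_X[OF v])
  note dX = X_diff[OF v pX]
  show "\<exists>M. \<forall>m\<ge>M. \<forall>m'\<ge>M. norm (Phi m S v - Phi m' S v) < \<epsilon>"
  proof (intro exI[of _ K0] allI impI)
    fix m m' assume m: "K0 \<le> m" "K0 \<le> m'"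
    have "Phi m S v - Phi m' S v = Phi m S (v - proj N v) - Phi m' S (v - proj N v)"
      using pv[OF m(1)] pv[OF m(2)] by (simp add: oper_diff[OF P v pX])
    then have "norm (Phi m S v - Phi m' S v) \<le> D * norm (v - proj N v) + D * norm (v - proj N v)"
      using norm_triangle_le_diff[OF add_mono[OF oper_norm[OF P dX, of m] oper_norm[OF P dX, of m']]]
      by (simp add: D_def)
    also have "\<dots> < \<epsilon>" using N D by (simp add: field_simps)
    finally show "norm (Phi m S v - Phi m' S v) < \<epsilon>" .
  qed
qed

lemma block_diagonal:
  assumes S: "oper C S"
  obtains G where "oper (C + 1) G" "\<And>v. v \<in> X \<Longrightarrow> (\<lambda>K. Phi K S v) \<longlonglongrightarrow> G v"
proof -
  note P = Phi_oper[OF S]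
  define G where "G v = lim (\<lambda>K. Phi K S v)" for v
  have lim: "(\<lambda>K. Phi K S v) \<longlonglongrightarrow> G v" if "v \<in> X" for v
    unfolding G_def using Phi_Cauchy[OF S that] by (simp add: Cauchy_convergent_iff convergent_LIMSEQ_iff)
  have "oper (C + 1) G"
  proof (rule operI)
    show "G (v + w) = G v + G w" if vw: "v \<in> X" "w \<in> X" for v w
      using LIMSEQ_unique[OF lim[OF X_add[OF vw]]] tendsto_add[OF lim[OF vw(1)] lim[OF vw(2)]]
      by (simp add: oper_add[OF P vw])
    show "G (sc c v) = sc c (G v)" if v: "v \<in> X" for c v
      using LIMSEQ_unique[OF lim[OF X_scale[OF v]]] scale_tendsto[OF lim[OF v], of c]
      by (simp add: oper_scale[OF P v])
    show "norm (G v) \<le> (C + 1) * norm v" if v: "v \<in> X" for v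
      by (rule LIMSEQ_le_const2[OF tendsto_norm[OF lim[OF v]]]) (use oper_norm[OF P v] in blast)
    show "0 \<le> C + 1" using oper_nonneg[OF S] by simp
    show "G v \<in> X" if v: "v \<in> X" for v
      using closed_X oper_X[OF P v] lim[OF v] by (auto elim!: closed_sequentially)
  qed
  then show thesis using that lim by blast
qed

definition up :: "'x \<Rightarrow> 'x" where
  "up = tensor_op id (\<lambda>_ s. if 0 < fst (prod_decode s) then 1 else 0)
    (\<lambda>_ s. prod_encode (fst (prod_decode s) - 1, snd (prod_decode s)))"

definition dn :: "'x \<Rightarrow> 'x" where
  "dn = tensor_op id (\<lambda>_ s. 1) (\<lambda>_ s. prod_encode (Suc (fst (prod_decode s)), snd (prod_decode s)))"

definition up_seq :: "(nat \<Rightarrow> 'k) \<Rightarrow> nat \<Rightarrow> 'k" where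
  "up_seq y = (\<lambda>s. if 0 < fst (prod_decode s) then y (prod_encode (fst (prod_decode s) - 1, snd (prod_decode s))) else 0)"

definition dn_seq :: "(nat \<Rightarrow> 'k) \<Rightarrow> nat \<Rightarrow> 'k" where
  "dn_seq y = (\<lambda>s. y (prod_encode (Suc (fst (prod_decode s)), snd (prod_decode s))))"

lemma contractive_up: "contractive (\<lambda>s. if 0 < fst (prod_decode s) then 1 else 0)
    (\<lambda>s. prod_encode (fst (prod_decode s) - 1, snd (prod_decode s)))"
  unfolding contractive_def
proof
  show "inj_on (\<lambda>s. prod_encode (fst (prod_decode s) - 1, snd (prod_decode s)))
      {t. (if 0 < fst (prod_decode t) then 1 else 0 :: 'k) \<noteq> 0}"
  proof (rule inj_onI)
    fix s t assume "s \<in> {t. (if 0 < fst (prod_decode t) then 1 else 0 :: 'k) \<noteq> 0}"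
      "t \<in> {t. (if 0 < fst (prod_decode t) then 1 else 0 :: 'k) \<noteq> 0}"
      "prod_encode (fst (prod_decode s) - 1, snd (prod_decode s)) = prod_encode (fst (prod_decode t) - 1, snd (prod_decode t))"
    then have "prod_decode s = prod_decode t" by (auto simp: prod_eq_iff split: if_splits)
    then show "s = t" by (metis prod_decode_inverse)
  qed
qed simp

lemma contractive_dn: "contractive (\<lambda>s. 1) (\<lambda>s. prod_encode (Suc (fst (prod_decode s)), snd (prod_decode s)))"
  unfolding contractive_def
proof
  show "inj_on (\<lambda>s. prod_encode (Suc (fst (prod_decode s)), snd (prod_decode s))) {t. (1 :: 'k) \<noteq> 0}"
  proof (rule inj_onI)
    fix s t
    assume "prod_encode (Suc (fst (prod_decode s)), snd (prod_decode s)) = prod_encode (Suc (fst (prod_decode t)), snd (prod_decode t))"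
    then have "prod_decode s = prod_decode t" by (simp add: prod_eq_iff)
    then show "s = t" by (metis prod_decode_inverse)
  qed
qed simp

lemma up: "oper 1 up" "tup x \<Longrightarrow> up (jt x) = jt (\<lambda>i. up_seq (x i))" "tup x \<Longrightarrow> tup (\<lambda>i. up_seq (x i))"
proof -
  have eq: "reindex_op (\<lambda>s. if 0 < fst (prod_decode s) then 1 else 0)
    (\<lambda>s. prod_encode (fst (prod_decode s) - 1, snd (prod_decode s))) y = up_seq y" for y
    by (auto simp: reindex_op_def up_seq_def)
  show "oper 1 up" unfolding up_def by (rule tensor_op(1)[OF permutes_id contractive_up])
  show "tup x \<Longrightarrow> up (jt x) = jt (\<lambda>i. up_seq (x i))"
    unfolding up_def tensor_op(2)[OF permutes_id contractive_up] eq by simp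
  show "tup x \<Longrightarrow> tup (\<lambda>i. up_seq (x i))"
    using tup_reindex[OF permutes_id contractive_up, of x] unfolding eq by simp
qed

lemma dn: "oper 1 dn" "tup x \<Longrightarrow> dn (jt x) = jt (\<lambda>i. dn_seq (x i))" "tup x \<Longrightarrow> tup (\<lambda>i. dn_seq (x i))"
proof -
  have eq: "reindex_op (\<lambda>s. 1) (\<lambda>s. prod_encode (Suc (fst (prod_decode s)), snd (prod_decode s))) y = dn_seq y" for y
    by (auto simp: reindex_op_def dn_seq_def)
  show "oper 1 dn" unfolding dn_def by (rule tensor_op(1)[OF permutes_id contractive_dn])
  show "tup x \<Longrightarrow> dn (jt x) = jt (\<lambda>i. dn_seq (x i))"
    unfolding dn_def tensor_op(2)[OF permutes_id contractive_dn] eq by simp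
  show "tup x \<Longrightarrow> tup (\<lambda>i. dn_seq (x i))"
    using tup_reindex[OF permutes_id contractive_dn, of x] unfolding eq by simp
qed

lemma dn_up: "v \<in> X \<Longrightarrow> dn (up v) = v"
proof (rule oper_eqI[OF oper_comp[OF dn(1) up(1)] oper_id])
  show "dn (up (jt x)) = jt x" if x: "tup x" for x
  proof -
    have "dn_seq (up_seq y) = y" for y by (auto simp: dn_seq_def up_seq_def)
    then show ?thesis using x by (simp add: dn(2) up(2,3))
  qed
qed

lemma pr_up: "v \<in> X \<Longrightarrow> pr 0 (up v) = 0"
proof (rule oper_eqI[OF oper_comp[OF pr(1) up(1)] oper_zero])
  show "pr 0 (up (jt x)) = 0" if x: "tup x" for x
  proof -
    have "block_coord 0 (up_seq y) = (\<lambda>t. 0)" for y by (auto simp: block_coord_def up_seq_def)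
    then show ?thesis using x by (simp add: pr(2) up(2,3) jt_zero_fun)
  qed
qed

lemma dn_iota: "v \<in> X \<Longrightarrow> dn (iota 0 v) = 0"
proof (rule oper_eqI[OF oper_comp[OF dn(1) iota(1)] oper_zero])
  show "dn (iota 0 (jt x)) = 0" if x: "tup x" for x
  proof -
    have "dn_seq (block_embed 0 y) = (\<lambda>t. 0)" for y by (auto simp: dn_seq_def block_embed_def)
    then show ?thesis using x by (simp add: iota(2) dn(2) tup_block jt_zero_fun)
  qed
qed

lemma up_iota: "v \<in> X \<Longrightarrow> up (iota k v) = iota (Suc k) v"
proof (rule oper_eqI[OF oper_comp[OF up(1) iota(1)] iota(1)])
  show "up (iota k (jt x)) = iota (Suc k) (jt x)" if x: "tup x" for x
  proof -
    have "up_seq (block_embed k y) = block_embed (Suc k) y" for y :: "nat \<Rightarrow> 'k"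
      by (rule ext) (auto simp: up_seq_def block_embed_def)
    then show ?thesis using x by (simp add: iota(2) up(2) tup_block)
  qed
qed

lemma pr_dn: "v \<in> X \<Longrightarrow> pr k (dn v) = pr (Suc k) v"
proof (rule oper_eqI[OF oper_comp[OF pr(1) dn(1)] pr(1)])
  show "pr k (dn (jt x)) = pr (Suc k) (jt x)" if x: "tup x" for x
  proof -
    have "block_coord k (dn_seq y) = block_coord (Suc k) y" for y :: "nat \<Rightarrow> 'k"
      by (auto simp: dn_seq_def block_coord_def)
    then show ?thesis using x by (simp add: pr(2) dn(2,3))
  qed
qed

lemma Phi_Suc:
  assumes S: "oper C S" and v: "v \<in> X"
  shows "Phi (Suc K) S v = iota 0 (S (pr 0 v)) + up (Phi K S (dn v))"
proof -
  have X: "S (pr k v) \<in> X" for k using v by (intro oper_X[OF S] oper_X[OF pr(1)])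
  have "up (Phi K S (dn v)) = (\<Sum>k<K. iota (Suc k) (S (pr (Suc k) v)))"
    unfolding Phi_def by (simp add: pr_dn[OF v] oper_sum[OF up(1)] oper_X[OF iota(1)] X up_iota)
  then show ?thesis by (simp only: Phi_def sum.lessThan_Suc_shift)
qed

lemma block_idempotent:
  assumes S: "oper C S" and idem: "\<And>v. v \<in> X \<Longrightarrow> S (S v) = S v"
  obtains G where "oper (C + 1) G" "\<And>v. v \<in> X \<Longrightarrow> G (G v) = G v"
    "\<And>v. v \<in> X \<Longrightarrow> G v = iota 0 (S (pr 0 v)) + up (G (dn v))"
proof -
  obtain G where G: "oper (C + 1) G" and lim: "\<And>v. v \<in> X \<Longrightarrow> (\<lambda>K. Phi K S v) \<longlonglongrightarrow> G v"
    using block_diagonal[OF S] by blast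
  note P = Phi_oper[OF S]
  have prG: "pr j (G v) = S (pr j v)" if v: "v \<in> X" for j v
  proof -
    have SX: "S (pr k v) \<in> X" for k using v by (intro oper_X[OF S] oper_X[OF pr(1)])
    have "pr j (Phi K S v) = S (pr j v)" if "j < K" for K
    proof -
      have "pr j (Phi K S v) = (\<Sum>k<K. if k = j then S (pr k v) else 0)"
        unfolding Phi_def
        by (subst oper_sum[OF pr(1)]) (auto simp: oper_X[OF iota(1)] SX pr_iota intro!: sum.cong)
      then show ?thesis using that by simp
    qed
    then have "eventually (\<lambda>K. pr j (Phi K S v) = S (pr j v)) sequentially"
      by (auto simp: eventually_sequentially intro!: exI[of _ "Suc j"])
    then have "(\<lambda>K. pr j (Phi K S v)) \<longlonglongrightarrow> S (pr j v)"
      by (rule tendsto_eventually)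
    with oper_tendsto[OF pr(1) oper_X[OF G v] oper_X[OF P v] lim[OF v]] show ?thesis
      by (rule LIMSEQ_unique)
  qed
  have "G (G v) = G v" if v: "v \<in> X" for v
  proof -
    have "Phi K S (G v) = Phi K S v" for K
      unfolding Phi_def using v by (simp add: prG idem oper_X[OF pr(1)])
    then show ?thesis using LIMSEQ_unique[OF lim[OF oper_X[OF G v]]] lim[OF v] by simp
  qed
  moreover have "G v = iota 0 (S (pr 0 v)) + up (G (dn v))" if v: "v \<in> X" for v
  proof -
    have dv: "dn v \<in> X" by (rule oper_X[OF dn(1) v])
    have "(\<lambda>K. iota 0 (S (pr 0 v)) + up (Phi K S (dn v))) \<longlonglongrightarrow> iota 0 (S (pr 0 v)) + up (G (dn v))"
      by (intro tendsto_add tendsto_const oper_tendsto[OF up(1) oper_X[OF G dv] oper_X[OF P dv] lim[OF dv]])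
    then have "(\<lambda>K. Phi (Suc K) S v) \<longlonglongrightarrow> iota 0 (S (pr 0 v)) + up (G (dn v))"
      by (simp only: Phi_Suc[OF S v])
    with LIMSEQ_Suc[OF lim[OF v]] show ?thesis by (rule LIMSEQ_unique)
  qed
  ultimately show thesis using that G by blast
qed

section \<open>Primarity\<close>

lemma oper_continuous:
  assumes "oper C f"
  shows "continuous_on X f"
proof (rule uniformly_continuous_imp_continuous[OF lipschitz_on_uniformly_continuous[of C]], rule lipschitz_onI)
  show "dist (f v) (f w) \<le> C * dist v w" if "v \<in> X" "w \<in> X" for v w
    using oper_norm[OF assms X_diff[OF that]] oper_diff[OF assms that] by (simp add: dist_norm)
qed (rule oper_nonneg[OF assms])

text \<open>The range of \<open>P\<close> is \<open>F X \<oplus> PA X\<close> with \<open>F = P - PABP\<close> idempotent, and \<open>PA X\<close> is a copy of \<open>X\<close>.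
  The summand \<open>F X\<close> is absorbed by \<open>X\<close>, since the shift takes the block diagonal operator \<open>G\<close>
  with blocks \<open>F\<close> to \<open>G\<close> without its first block.\<close>

lemma complemented_copy_imp_isomorphic:
  assumes P: "oper C P" and idem: "\<And>v. v \<in> X \<Longrightarrow> P (P v) = P v"
    and Y: "Y = {v \<in> X. P v = v}"
    and A: "oper a A" and B: "oper b B" and BPA: "\<And>v. v \<in> X \<Longrightarrow> B (P (A v)) = v"
  shows "linearly_homeomorphic sc X Y"
proof -
  define F where "F v = P v - P (A (B (P v)))" for v
  have F: "oper (C + C * (a * (b * C))) F"
    unfolding F_def[abs_def] by (rule oper_minus[OF P oper_comp[OF P oper_comp[OF A oper_comp[OF B P]]]])
  note pX = oper_X[OF P] and aX = oper_X[OF A] and bX = oper_X[OF B] and fX = oper_X[OF F]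
  have BF: "B (F v) = 0" if v: "v \<in> X" for v
    using v by (simp add: F_def oper_diff[OF B] pX aX bX BPA)
  have PF: "P (F v) = F v" if v: "v \<in> X" for v
    using v by (simp add: F_def oper_diff[OF P] pX aX bX idem)
  have FPA: "F (P (A v)) = 0" if v: "v \<in> X" for v
    using v by (simp add: F_def pX aX idem BPA)
  have FF: "F (F v) = F v" if v: "v \<in> X" for v
    using v by (simp add: F_def[of "F v"] PF BF fX oper_0[OF A] oper_0[OF P])
  have FPY: "F y + P (A (B y)) = y" if "y \<in> Y" for y
    using that by (simp add: F_def Y)
  obtain G where G: "oper (C + C * (a * (b * C)) + 1) G" and GG: "\<And>v. v \<in> X \<Longrightarrow> G (G v) = G v"
    and Geq: "\<And>v. v \<in> X \<Longrightarrow> G v = iota 0 (F (pr 0 v)) + up (G (dn v))"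
    using block_idempotent[OF F FF] by blast
  note gX = oper_X[OF G] and uX = oper_X[OF up(1)] and dX = oper_X[OF dn(1)]
    and iX = oper_X[OF iota(1)] and prX = oper_X[OF pr(1)]
  note mem = pX aX bX fX gX uX dX iX prX X_add X_diff
  have dG: "dn (G v) = G (dn v)" if v: "v \<in> X" for v
    using v Geq[OF v] by (simp add: oper_add[OF dn(1)] dn_iota dn_up mem)
  have Gup: "G (up v) = up (G v)" if v: "v \<in> X" for v
    using v by (subst Geq) (simp_all add: pr_up dn_up mem oper_0[OF F] oper_0[OF iota(1)])
  have Giota: "G (iota 0 v) = iota 0 (F v)" if v: "v \<in> X" for v
    using v by (subst Geq) (simp_all add: pr_iota dn_iota mem oper_0[OF G] oper_0[OF up(1)])
  have prG: "pr 0 (G v) = F (pr 0 v)" if v: "v \<in> X" for v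
    using v by (subst Geq) (simp_all add: oper_add[OF pr(1)] pr_iota pr_up mem)
  define f where "f v = P (A ((v - G v) + dn (G v))) + F (pr 0 v)" for v
  define k where "k y = ((B y - G (B y)) + up (G (B y))) + iota 0 (F y)" for y
  have f: "\<exists>c. oper c f"
    unfolding f_def[abs_def]
    by (intro exI) (rule oper_plus[OF oper_comp[OF P oper_comp[OF A oper_plus[OF oper_minus[OF oper_id G] oper_comp[OF dn(1) G]]]]
          oper_comp[OF F pr(1)]])
  have k: "\<exists>c. oper c k"
    unfolding k_def[abs_def]
    by (intro exI) (rule oper_plus[OF oper_plus[OF oper_minus[OF B oper_comp[OF G B]] oper_comp[OF up(1) oper_comp[OF G B]]]
          oper_comp[OF iota(1) F]])
  have YX: "Y \<subseteq> X" by (auto simp: Y)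
  have fY: "f v \<in> Y" if v: "v \<in> X" for v
    using v by (simp add: Y f_def mem oper_add[OF P] idem PF)
  have fk: "f (k y) = y" if y: "y \<in> Y" for y
  proof -
    have yX: "y \<in> X" using y YX by blast
    define x where "x = B y"
    have x: "x \<in> X" using yX by (simp add: x_def mem)
    have ky: "k y = (x - G x) + up (G x) + iota 0 (F y)" by (simp add: k_def x_def)
    have Gk: "G (k y) = up (G x) + iota 0 (F y)"
    proof -
      have m: "x - G x \<in> X" "up (G x) \<in> X" "iota 0 (F y) \<in> X" using x yX by (simp_all add: mem)
      have "G (k y) = G (x - G x) + G (up (G x)) + G (iota 0 (F y))"
        unfolding ky by (simp only: oper_add[OF G X_add[OF m(1,2)] m(3)] oper_add[OF G m(1,2)])
      also have "G (x - G x) = 0" using x by (simp add: oper_diff[OF G] mem GG)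
      also have "G (up (G x)) = up (G x)" using x by (simp add: Gup GG mem)
      also have "G (iota 0 (F y)) = iota 0 (F y)" using yX by (simp add: Giota FF mem)
      finally show ?thesis by simp
    qed
    have "dn (G (k y)) = G x"
      unfolding Gk using x yX by (simp add: oper_add[OF dn(1)] mem dn_up dn_iota)
    moreover have "k y - G (k y) = x - G x" by (simp only: Gk) (simp add: ky)
    moreover have "F (pr 0 (k y)) = F y"
      unfolding ky using x yX
      by (simp add: oper_add[OF pr(1)] oper_diff[OF pr(1)] mem pr_up pr_iota prG oper_add[OF F] oper_diff[OF F] FF)
    ultimately have "f (k y) = P (A x) + F y" by (simp add: f_def)
    then show ?thesis using FPY[OF y] by (simp add: x_def add.commute)
  qed
  have kf: "k (f v) = v" if v: "v \<in> X" for v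
  proof -
    define w where "w = (v - G v) + dn (G v)"
    have w: "w \<in> X" using v by (simp add: w_def mem)
    have fv: "f v = P (A w) + F (pr 0 v)" by (simp add: f_def w_def)
    have Bf: "B (f v) = w"
      unfolding fv using v w by (simp add: oper_add[OF B] mem BPA BF)
    have Ff: "F (f v) = F (pr 0 v)"
      unfolding fv using v w by (simp add: oper_add[OF F] mem FPA FF)
    have Gw: "G w = dn (G v)"
      unfolding w_def using v by (simp add: oper_add[OF G] oper_diff[OF G] mem GG dG[symmetric])
    have "up (dn (G v)) + iota 0 (F (pr 0 v)) = G v"
      unfolding dG[OF v] by (subst Geq[OF v]) (rule add.commute)
    then show ?thesis
      unfolding k_def Bf Ff Gw by (simp add: w_def add.assoc)
  qed
  obtain c1 c2 where fo: "oper c1 f" and ko: "oper c2 k" using f k by blast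
  have "homeomorphism X Y f k"
    unfolding homeomorphism_def
  proof (intro conjI ballI)
    show "f ` X = Y"
    proof
      show "f ` X \<subseteq> Y" using fY by blast
      show "Y \<subseteq> f ` X"
      proof
        fix y assume y: "y \<in> Y"
        then have "k y \<in> X" using YX oper_X[OF ko] by blast
        then show "y \<in> f ` X" using fk[OF y] by (metis imageI)
      qed
    qed
    show "k ` Y = X"
    proof
      show "k ` Y \<subseteq> X" using YX oper_X[OF ko] by blast
      show "X \<subseteq> k ` Y"
      proof
        fix v assume "v \<in> X"
        then show "v \<in> k ` Y" using kf fY by (metis imageI)
      qed
    qed
    show "continuous_on X f" by (rule oper_continuous[OF fo])
    show "continuous_on Y k" by (rule continuous_on_subset[OF oper_continuous[OF ko] YX])
  qed (use fk kf in auto)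
  moreover have "linear_map_on sc sc X f"
    using oper_bl[OF fo] by (simp add: bounded_linear_on_def)
  ultimately show ?thesis unfolding linearly_homeomorphic_def by blast
qed

lemma projection_of_direct_sum:
  assumes "topological_direct_sum sc X Y Z"
  obtains C P where "oper C P" "\<forall>v\<in>X. P (P v) = P v"
    "Y = {v \<in> X. P v = v}" "Z = {v \<in> X. v - P v = v}"
proof -
  obtain h where Y: "subspace Y" and Z: "subspace Z" and h: "homeomorphism (Y \<times> Z) X (\<lambda>(y, z). y + z) h"
    using assms unfolding topological_direct_sum_def by blast
  have h1: "h (y + z) = (y, z)" if "y \<in> Y" "z \<in> Z" for y z
  proof -
    have "\<forall>u\<in>Y \<times> Z. h ((\<lambda>(y, z). y + z) u) = u" using h unfolding homeomorphism_def by blast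
    then have "h ((\<lambda>(y, z). y + z) (y, z)) = (y, z)" using that by blast
    then show ?thesis by simp
  qed
  have h2: "fst (h v) \<in> Y" "snd (h v) \<in> Z" "fst (h v) + snd (h v) = v" if v: "v \<in> X" for v
  proof -
    have "h v \<in> Y \<times> Z" using h v unfolding homeomorphism_def by blast
    then show "fst (h v) \<in> Y" "snd (h v) \<in> Z" by auto
    show "fst (h v) + snd (h v) = v"
    proof -
      have "\<forall>v\<in>X. (\<lambda>(y, z). y + z) (h v) = v" using h unfolding homeomorphism_def by blast
      then show ?thesis using v by (simp add: case_prod_unfold)
    qed
  qed
  have img: "(\<lambda>(y, z). y + z) ` (Y \<times> Z) = X" using h unfolding homeomorphism_def by blast
  have sum_X: "y + z \<in> X" if "y \<in> Y" "z \<in> Z" for y z using img that by force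
  have Y0: "0 \<in> Y" and Z0: "0 \<in> Z" using Y Z by (simp_all add: subspace_0)
  have YX: "y \<in> X" if "y \<in> Y" for y using sum_X[OF that Z0] by simp
  have ZX: "z \<in> X" if "z \<in> Z" for z using sum_X[OF Y0 that] by simp
  define P where "P v = fst (h v)" for v
  have PY: "P y = y" if "y \<in> Y" for y using h1[OF that Z0] by (simp add: P_def)
  have PZ: "P z = 0" if "z \<in> Z" for z using h1[OF Y0 that] by (simp add: P_def)
  have P_add: "P (v + w) = P v + P w" if v: "v \<in> X" and w: "w \<in> X" for v w
  proof -
    have "v + w = (fst (h v) + fst (h w)) + (snd (h v) + snd (h w))"
      using h2(3)[OF v] h2(3)[OF w] by (metis add.assoc add.left_commute)
    then show ?thesis
      using h1[OF subspace_add[OF Y h2(1)[OF v] h2(1)[OF w]] subspace_add[OF Z h2(2)[OF v] h2(2)[OF w]]]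
      by (simp add: P_def)
  qed
  have P_scale: "P (sc c v) = sc c (P v)" if v: "v \<in> X" for c v
  proof -
    have "sc c v = sc c (fst (h v)) + sc c (snd (h v))"
      using h2(3)[OF v] by (metis scale_right_distrib)
    then show ?thesis
      using h1[OF subspace_scale[OF Y h2(1)[OF v], of c] subspace_scale[OF Z h2(2)[OF v], of c]] by (simp add: P_def)
  qed
  have "continuous_on X h" using h unfolding homeomorphism_def by blast
  then have "continuous_on X P" unfolding P_def[abs_def] by (intro continuous_intros)
  then obtain d where d: "0 < d" "\<And>v. v \<in> X \<Longrightarrow> dist v 0 < d \<Longrightarrow> dist (P v) (P 0) < 1"
    unfolding continuous_on_iff using X_0 zero_less_one by blast
  have P0: "P 0 = 0" by (rule PY[OF Y0])
  have P_norm: "norm (P v) \<le> 2 / d * norm v" if v: "v \<in> X" for v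
  proof (cases "v = 0")
    case True
    then show ?thesis by (simp add: P0)
  next
    case False
    define r where "r = d / (2 * norm v)"
    have r: "0 < r" using False d by (simp add: r_def)
    have "norm (sc (of_real r) v) < d" using False d r by (simp add: norm_scale) (simp add: r_def)
    then have "norm (P (sc (of_real r) v)) < 1" using d(2)[OF X_scale[OF v]] by (simp add: P0)
    then have "r * norm (P v) < 1" using r by (simp add: P_scale[OF v] norm_scale)
    then show ?thesis using False d by (simp add: r_def field_simps)
  qed
  have PX: "P v \<in> X" if "v \<in> X" for v using YX[OF h2(1)[OF that]] by (simp add: P_def)
  have P: "oper (2 / d) P"
    by (rule operI) (use P_add P_scale P_norm PX d(1) in auto)
  have PP: "\<forall>v\<in>X. P (P v) = P v" using PY h2(1) by (simp add: P_def)
  have Y_eq: "Y = {v \<in> X. P v = v}"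
  proof
    show "Y \<subseteq> {v \<in> X. P v = v}" using YX PY by blast
    show "{v \<in> X. P v = v} \<subseteq> Y" using h2(1) by (force simp: P_def)
  qed
  have Z_eq: "Z = {v \<in> X. v - P v = v}"
  proof
    show "Z \<subseteq> {v \<in> X. v - P v = v}" using ZX PZ by auto
    show "{v \<in> X. v - P v = v} \<subseteq> Z"
    proof
      fix v assume v: "v \<in> {v \<in> X. v - P v = v}"
      then have "snd (h v) = v" using h2(3)[of v] by (simp add: P_def)
      then show "v \<in> Z" using h2(2)[of v] v by simp
    qed
  qed
  show thesis by (rule that[OF P PP Y_eq Z_eq])
qed

lemma primary_X: "primary sc X"
  unfolding primary_def
proof (intro allI impI)
  fix Y Z assume "topological_direct_sum sc X Y Z"
  then obtain C P where P: "oper C P" and idem: "\<forall>v\<in>X. P (P v) = P v"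
    and Y: "Y = {v \<in> X. P v = v}" and Z: "Z = {v \<in> X. v - P v = v}"
    by (rule projection_of_direct_sum)
  have PP: "P (P v) = P v" if "v \<in> X" for v using idem that by blast
  obtain A B a b where A: "oper a A" and B: "oper b B"
    and or: "(\<forall>v\<in>X. B (P (A v)) = v) \<or> (\<forall>v\<in>X. B (A v - P (A v)) = v)"
    by (rule factor_identity[OF P], rule that)
  from or show "linearly_homeomorphic sc X Y \<or> linearly_homeomorphic sc X Z"
  proof
    assume "\<forall>v\<in>X. B (P (A v)) = v"
    then have "linearly_homeomorphic sc X Y"
      by (intro complemented_copy_imp_isomorphic[OF P PP Y A B]) auto
    then show ?thesis ..
  next
    assume BPA: "\<forall>v\<in>X. B (A v - P (A v)) = v"
    have "linearly_homeomorphic sc X Z"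
    proof (rule complemented_copy_imp_isomorphic[OF oper_minus[OF oper_id P] _ Z A B])
      show "(v - P v) - P (v - P v) = v - P v" if v: "v \<in> X" for v
        using v by (simp add: oper_diff[OF P] oper_X[OF P] PP)
      show "B (A v - P (A v)) = v" if "v \<in> X" for v using BPA that by blast
    qed
    then show ?thesis ..
  qed
qed

end

theorem theorem3p3:
  fixes p :: real and n :: nat
    and sc :: "'k::{real_normed_field,euclidean_space} \<Rightarrow> 'x::banach \<Rightarrow> 'x"
    and J :: "(((nat \<Rightarrow> nat \<Rightarrow> 'k) \<Rightarrow> 'k) \<Rightarrow> 'k) \<Rightarrow> 'x"
    and X :: "'x set"
  assumes "1 \<le> p" and "n \<ge> 1"
    and "banach_space_over sc"
    and "is_projective_tensor_power fscale n (lp_space p) (lp_norm p) sc J X"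
  shows "primary sc X"
proof -
  interpret lp_tensor sc p n J X
    using assms by (intro lp_tensor.intro lp_tensor_axioms.intro)
  show ?thesis by (rule primary_X)
qed

end
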